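(* Let $L:=L^{\mathrm{skew}}_{A_{n-1}}(P/Q)$ with the edge scalars $X,Y$, and let $V:=V[L]$ be the $\mathfrak{sl}(n,\mathbb C)$-module it defines. (0) For each $\star\in\{\varepsilon,\sigma_0,*,\bowtie\}$: $V[L^\star]\cong V^\star$ and $\mathrm{WGF}(L^\star)=\mathrm{WGF}(L)^\star$. (1) If for some $\star$ the skew-tabular lattice $L^{\mathrm{skew}}_{A_{n-1}}((P/Q)^\star)$ is a solitary (respectively edge-minimal) supporting graph for $V^\star$, then for every $\lozenge\in\{\varepsilon,\sigma_0,*,\bowtie\}$, $L^{\mathrm{skew}}_{A_{n-1}}((P/Q)^\lozenge)$ is a solitary (respectively edge-minimal) supporting graph for $V^\lozenge$. (2) If for some $\star$ the cell set $(P/Q)^\star$ is (after translation) the Young diagram of a partition, then for every $\lozenge$, $L^{\mathrm{skew}}_{A_{n-1}}((P/Q)^\lozenge)$ is a solitary and edge-minimal supporting graph for the irreducible $\mathfrak{sl}(n,\mathbb C)$-module $V^\lozenge$.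
   Context: Fix integers $m\ge n\ge 2$ and weakly decreasing $m$-tuples of nonnegative integers $P,Q$ with $Q_r\le P_r$; $P/Q$ is the set of cells $(r,c)$ with $Q_r<c\le P_r$, no column having more than $n$ cells. For a skew cell set $D$, $L^{\mathrm{skew}}_{A_{n-1}}(D)$ is the set of semistandard fillings of $D$ with entries in $\{1,\dots,n\}$, ordered by $S\le T$ iff $S_{r,c}\ge T_{r,c}$ for all cells, with the covering $S\to T$ (differing only in a cell where $S_{r,c}=T_{r,c}+1$) colored $T_{r,c}$. Each edge $S\xrightarrow{i}T$ carries scalars $X_{T,S},Y_{S,T}$: with $C_i=\{i-m+1,\dots,i\}$ and $g_{i,i+1-r}(T):=Q_r+|\{c:(r,c)\in P/Q,T_{r,c}\le i\}|$, $(i,j)$ the unique position where $g_{i,j}(T)=g_{i,j}(S)+1$ and $g=g(T)$: $X_{T,S}=-\prod_{k\in C_{i+1}}(g_{i,j}-g_{i+1,k}+j-k)/\prod_{k\in C_i\setminus\{j\}}(g_{i,j}-g_{i,k}+j-k-1)$, $Y_{S,T}=\prod_{k\in C_{i-1}}(g_{i,j}-g_{i-1,k}+j-k-1)/\prod_{k\in C_i\setminus\{j\}}(g_{i,j}-g_{i,k}+j-k)$ (and analogously for the other shapes). For an edge-tagged colored poset $R$, $V[R]$ has basis $\{v_t\}$ with $x_i.v_t=\sum_{t\xrightarrow{i}u}X_{u,t}v_u$, $y_i.v_t=\sum_{s\xrightarrow{i}t}Y_{s,t}v_s$, $h_i$ acting diagonally by $m_i(t)=2\rho_i(t)-l_i(t)$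 ($l_i(t)$ the length of the $i$-colored component of $t$, $\rho_i(t)$ the rank of $t$ in it); $\mathrm{WGF}(R):=\sum_t z^{\sum_i m_i(t)\omega_i}$. Shape operations: $(P/Q)^\varepsilon:=P/Q$; $(P/Q)^{\sigma_0}$: for each nonempty column of $P/Q$ with cells in rows $a+1,\dots,a+k$, take the cells of that column in rows $a+k+1,\dots,a+n$; $(P/Q)^*$: $(P/Q)^{\sigma_0}$ rotated $180^\circ$; $(P/Q)^{\bowtie}$: $P/Q$ rotated $180^\circ$. Poset operations on edge-tagged $R$: $R^\varepsilon:=R$; $R^{\sigma_0}$: colors $i\mapsto n-i$, same scalars; $R^*$: dual poset with edge $t^*\xrightarrow{i}s^*$ for each $s\xrightarrow{i}t$, with $X_{s^*,t^*}:=Y_{s,t}$ and $Y_{t^*,s^*}:=X_{t,s}$; $R^{\bowtie}:=(R^{\sigma_0})^*$. Module operations: $V^\varepsilon=V$; $V^*$ the dual module; $V^{\sigma_0}$ is $V$ with $x_i,y_i,h_i$ acting as $x_{n-i},y_{n-i},h_{n-i}$; $V^{\bowtie}:=(V^* )^{\sigma_0}$. On Laurent polynomials: $(z^\mu)^*=z^{-\mu}$, $(z^\mu)^{\sigma_0}=z^{-w_0\mu}$, $(z^\mu)^{\bowtie}=z^{w_0\mu}$, $w_0$ the longest Weyl group element. Supporting graph of a weight basis $\{v_r\}$: edge $s\xrightarrow{i}t$ iff $x_i.v_s$ has nonzero $v_t$-coefficient or $y_i.v_t$ has nonzero $v_s$-coefficient. A supporting graph $R$ for $V$ is solitary if every weight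 basis $\{w_r\}$ of $V$ with the same supporting graph satisfies $w_r=a_rv_r$ for nonzero scalars $a_r$; it is edge-minimal if no supporting graph of $V$ is isomorphic (as edge-colored digraph) to a graph obtained from $R$ by deleting at least one edge. *)

theory Defs
  imports Complex_Main "HOL-Library.Multiset"
begin

type_synonym cell = "int \<times> int"
type_synonym filling = "cell \<Rightarrow> nat"

definition skewD :: "nat \<Rightarrow> (nat \<Rightarrow> nat) \<Rightarrow> (nat \<Rightarrow> nat) \<Rightarrow> cell set" where
  "skewD m P Q = {(r, c). 1 \<le> r \<and> r \<le> int m \<and> int (Q (nat r)) < c \<and> c \<le> int (P (nat r))}"

text \<open>Column complement: a nonempty column with cells in rows a+1..a+k is replaced by
  the cells in rows a+k+1..a+n of that column.\<close>
definition sigD :: "nat \<Rightarrow> cell set \<Rightarrow> cell set" where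
  "sigD n D = {(r, c). (\<exists>r0. (r0, c) \<in> D) \<and>
      (let a = Min {r'. (r', c) \<in> D} - 1; k = int (card {r'. (r', c) \<in> D})
       in a + k < r \<and> r \<le> a + int n)}"

text \<open>Rotation by 180 degrees (cell sets are considered up to translation).\<close>
definition rotD :: "cell set \<Rightarrow> cell set" where
  "rotD D = (\<lambda>(r, c). (- r, - c)) ` D"

datatype symop = Eps | Sig | Star | Bow

fun sop :: "nat \<Rightarrow> symop \<Rightarrow> cell set \<Rightarrow> cell set" where
  "sop n Eps D = D"
| "sop n Sig D = sigD n D"
| "sop n Star D = rotD (sigD n D)"
| "sop n Bow D = rotD D"

definition young_translate :: "cell set \<Rightarrow> bool" where
  "young_translate D \<longleftrightarrow> (\<exists>a b (lam :: nat \<Rightarrow> nat).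
      (\<forall>r. 1 \<le> r \<longrightarrow> lam (Suc r) \<le> lam r) \<and>
      D = {(a + int r, b + int c) | r c. 1 \<le> r \<and> 1 \<le> c \<and> c \<le> lam r})"

definition lsk_verts :: "nat \<Rightarrow> cell set \<Rightarrow> filling set" where
  "lsk_verts n D = {T. (\<forall>p. p \<notin> D \<longrightarrow> T p = 0) \<and> (\<forall>p\<in>D. 1 \<le> T p \<and> T p \<le> n) \<and>
      (\<forall>r c c'. (r, c) \<in> D \<longrightarrow> (r, c') \<in> D \<longrightarrow> c < c' \<longrightarrow> T (r, c) \<le> T (r, c')) \<and>
      (\<forall>r r' c. (r, c) \<in> D \<longrightarrow> (r', c) \<in> D \<longrightarrow> r < r' \<longrightarrow> T (r, c) < T (r', c))}"

definition lsk_edges :: "nat \<Rightarrow> cell set \<Rightarrow> (filling \<times> nat \<times> filling) set" where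
  "lsk_edges n D = {(S, T p, T) | S T p. S \<in> lsk_verts n D \<and> T \<in> lsk_verts n D \<and> p \<in> D \<and>
      S p = T p + 1 \<and> (\<forall>q. q \<noteq> p \<longrightarrow> S q = T q)}"

text \<open>Edge-tagged colored posets: Xs u t = X_{u,t} for an edge t -> u,
  Ys s t = Y_{s,t} for an edge s -> t.\<close>
record 'v ctposet =
  verts :: "'v set"
  edges :: "('v \<times> nat \<times> 'v) set"
  Xs :: "'v \<Rightarrow> 'v \<Rightarrow> complex"
  Ys :: "'v \<Rightarrow> 'v \<Rightarrow> complex"

definition gfun :: "nat \<Rightarrow> (nat \<Rightarrow> nat) \<Rightarrow> (nat \<Rightarrow> nat) \<Rightarrow> filling \<Rightarrow> int \<Rightarrow> int \<Rightarrow> int" where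
  "gfun m P Q T i j = (let r = i + 1 - j in
     if 1 \<le> r \<and> r \<le> int m
     then int (Q (nat r)) + int (card {c. (r, c) \<in> skewD m P Q \<and> int (T (r, c)) \<le> i})
     else 0)"

definition gpos :: "nat \<Rightarrow> (nat \<Rightarrow> nat) \<Rightarrow> (nat \<Rightarrow> nat) \<Rightarrow> filling \<Rightarrow> filling \<Rightarrow> int \<times> int" where
  "gpos m P Q S T = (THE ij. gfun m P Q T (fst ij) (snd ij) = gfun m P Q S (fst ij) (snd ij) + 1)"

definition Xval :: "nat \<Rightarrow> (nat \<Rightarrow> nat) \<Rightarrow> (nat \<Rightarrow> nat) \<Rightarrow> filling \<Rightarrow> filling \<Rightarrow> complex" where
  "Xval m P Q T S = (let i = fst (gpos m P Q S T); j = snd (gpos m P Q S T); g = gfun m P Q T in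
     - (\<Prod>k\<in>{i + 1 - int m + 1 .. i + 1}. of_int (g i j - g (i + 1) k + j - k))
     / (\<Prod>k\<in>{i - int m + 1 .. i} - {j}. of_int (g i j - g i k + j - k - 1)))"

definition Yval :: "nat \<Rightarrow> (nat \<Rightarrow> nat) \<Rightarrow> (nat \<Rightarrow> nat) \<Rightarrow> filling \<Rightarrow> filling \<Rightarrow> complex" where
  "Yval m P Q S T = (let i = fst (gpos m P Q S T); j = snd (gpos m P Q S T); g = gfun m P Q T in
     (\<Prod>k\<in>{i - 1 - int m + 1 .. i - 1}. of_int (g i j - g (i - 1) k + j - k - 1))
     / (\<Prod>k\<in>{i - int m + 1 .. i} - {j}. of_int (g i j - g i k + j - k)))"

definition Lskew :: "nat \<Rightarrow> nat \<Rightarrow> (nat \<Rightarrow> nat) \<Rightarrow> (nat \<Rightarrow> nat) \<Rightarrow> filling ctposet" where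
  "Lskew n m P Q = \<lparr> verts = lsk_verts n (skewD m P Q), edges = lsk_edges n (skewD m P Q),
      Xs = (\<lambda>T S. Xval m P Q T S), Ys = (\<lambda>S T. Yval m P Q S T) \<rparr>"

definition pdual :: "'v ctposet \<Rightarrow> 'v ctposet" where
  "pdual R = \<lparr> verts = verts R, edges = {(t, i, s) | s i t. (s, i, t) \<in> edges R},
      Xs = Ys R, Ys = Xs R \<rparr>"

definition psig :: "nat \<Rightarrow> 'v ctposet \<Rightarrow> 'v ctposet" where
  "psig n R = \<lparr> verts = verts R, edges = {(s, n - i, t) | s i t. (s, i, t) \<in> edges R},
      Xs = Xs R, Ys = Ys R \<rparr>"

fun pop :: "nat \<Rightarrow> symop \<Rightarrow> 'v ctposet \<Rightarrow> 'v ctposet" where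
  "pop n Eps R = R"
| "pop n Sig R = psig n R"
| "pop n Star R = pdual R"
| "pop n Bow R = pdual (psig n R)"

definition ipath :: "('v \<times> nat \<times> 'v) set \<Rightarrow> nat \<Rightarrow> 'v list \<Rightarrow> bool" where
  "ipath E i xs \<longleftrightarrow> xs \<noteq> [] \<and> (\<forall>k. Suc k < length xs \<longrightarrow> (xs ! k, i, xs ! Suc k) \<in> E)"

definition icomp :: "('v \<times> nat \<times> 'v) set \<Rightarrow> nat \<Rightarrow> 'v \<Rightarrow> 'v set" where
  "icomp E i t = {u. (t, u) \<in> ({(a, b). (a, i, b) \<in> E} \<union> {(b, a). (a, i, b) \<in> E})\<^sup>*}"

definition irank :: "('v \<times> nat \<times> 'v) set \<Rightarrow> nat \<Rightarrow> 'v \<Rightarrow> int" where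
  "irank E i t = Max {int (length xs) - 1 | xs. ipath E i xs \<and> last xs = t}"

definition ilen :: "('v \<times> nat \<times> 'v) set \<Rightarrow> nat \<Rightarrow> 'v \<Rightarrow> int" where
  "ilen E i t = Max {int (length xs) - 1 | xs. ipath E i xs \<and> hd xs \<in> icomp E i t}"

definition mval :: "('v \<times> nat \<times> 'v) set \<Rightarrow> nat \<Rightarrow> 'v \<Rightarrow> int" where
  "mval E i t = 2 * irank E i t - ilen E i t"

text \<open>Weights are coefficient vectors w.r.t. fundamental weights omega_1..omega_{n-1}
  (zero outside 1..n-1); a Laurent polynomial with nonnegative integer coefficients
  sum z^mu is represented by the multiset of its exponents mu.\<close>
definition wvec :: "nat \<Rightarrow> 'v ctposet \<Rightarrow> 'v \<Rightarrow> nat \<Rightarrow> int" where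
  "wvec n R t = (\<lambda>i. if 1 \<le> i \<and> i \<le> n - 1 then mval (edges R) i t else 0)"

definition WGF :: "nat \<Rightarrow> 'v ctposet \<Rightarrow> (nat \<Rightarrow> int) multiset" where
  "WGF n R = image_mset (wvec n R) (mset_set (verts R))"

text \<open>(z^mu)^* = z^{-mu}, (z^mu)^sigma0 = z^{-w0 mu}, (z^mu)^bowtie = z^{w0 mu},
  using w0 omega_i = - omega_{n-i}.\<close>
fun wop :: "nat \<Rightarrow> symop \<Rightarrow> (nat \<Rightarrow> int) \<Rightarrow> (nat \<Rightarrow> int)" where
  "wop n Eps mu = mu"
| "wop n Sig mu = (\<lambda>i. if 1 \<le> i \<and> i \<le> n - 1 then mu (n - i) else 0)"
| "wop n Star mu = (\<lambda>i. - mu i)"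
| "wop n Bow mu = (\<lambda>i. if 1 \<le> i \<and> i \<le> n - 1 then - mu (n - i) else 0)"

definition WGFop :: "nat \<Rightarrow> symop \<Rightarrow> (nat \<Rightarrow> int) multiset \<Rightarrow> (nat \<Rightarrow> int) multiset" where
  "WGFop n s F = image_mset (wop n s) F"

text \<open>A module on the space of functions bas -> C (vectors vanish outside bas), with
  matrices: xop V i b b' = coefficient of e_b in x_i . e_{b'} (similarly y_i, h_i),
  for i in 1..n-1.\<close>
record 'b smod =
  bas :: "'b set"
  xop :: "nat \<Rightarrow> 'b \<Rightarrow> 'b \<Rightarrow> complex"
  yop :: "nat \<Rightarrow> 'b \<Rightarrow> 'b \<Rightarrow> complex"
  hop :: "nat \<Rightarrow> 'b \<Rightarrow> 'b \<Rightarrow> complex"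

definition Vmod :: "'v ctposet \<Rightarrow> 'v smod" where
  "Vmod R = \<lparr> bas = verts R,
     xop = (\<lambda>i u t. if (t, i, u) \<in> edges R then Xs R u t else 0),
     yop = (\<lambda>i s t. if (s, i, t) \<in> edges R then Ys R s t else 0),
     hop = (\<lambda>i s t. if s = t then of_int (mval (edges R) i t) else 0) \<rparr>"

definition mdual :: "'b smod \<Rightarrow> 'b smod" where
  "mdual V = \<lparr> bas = bas V,
     xop = (\<lambda>i a b. - xop V i b a), yop = (\<lambda>i a b. - yop V i b a),
     hop = (\<lambda>i a b. - hop V i b a) \<rparr>"

definition msig :: "nat \<Rightarrow> 'b smod \<Rightarrow> 'b smod" where
  "msig n V = \<lparr> bas = bas V, xop = (\<lambda>i. xop V (n - i)), yop = (\<lambda>i. yop V (n - i)),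
     hop = (\<lambda>i. hop V (n - i)) \<rparr>"

fun mop :: "nat \<Rightarrow> symop \<Rightarrow> 'b smod \<Rightarrow> 'b smod" where
  "mop n Eps V = V"
| "mop n Sig V = msig n V"
| "mop n Star V = mdual V"
| "mop n Bow V = msig n (mdual V)"

definition intertw :: "'a set \<Rightarrow> 'b set \<Rightarrow> ('a \<Rightarrow> 'a \<Rightarrow> complex) \<Rightarrow> ('b \<Rightarrow> 'b \<Rightarrow> complex)
    \<Rightarrow> ('b \<Rightarrow> 'a \<Rightarrow> complex) \<Rightarrow> bool" where
  "intertw A B M N T \<longleftrightarrow> (\<forall>b\<in>B. \<forall>a\<in>A.
      (\<Sum>a'\<in>A. T b a' * M a' a) = (\<Sum>b'\<in>B. N b b' * T b' a))"

definition miso :: "nat \<Rightarrow> 'a smod \<Rightarrow> 'b smod \<Rightarrow> bool" where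
  "miso n V W \<longleftrightarrow> (\<exists>(T :: 'b \<Rightarrow> 'a \<Rightarrow> complex) (S :: 'a \<Rightarrow> 'b \<Rightarrow> complex).
      (\<forall>b\<in>bas W. \<forall>b'\<in>bas W. (\<Sum>a\<in>bas V. T b a * S a b') = (if b = b' then 1 else 0)) \<and>
      (\<forall>a\<in>bas V. \<forall>a'\<in>bas V. (\<Sum>b\<in>bas W. S a b * T b a') = (if a = a' then 1 else 0)) \<and>
      (\<forall>i\<in>{1..n - 1}. intertw (bas V) (bas W) (xop V i) (xop W i) T \<and>
                      intertw (bas V) (bas W) (yop V i) (yop W i) T \<and>
                      intertw (bas V) (bas W) (hop V i) (hop W i) T))"

definition vecs :: "'b set \<Rightarrow> ('b \<Rightarrow> complex) set" where
  "vecs B = {u. \<forall>b. b \<notin> B \<longrightarrow> u b = 0}"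

definition mact :: "('b \<Rightarrow> 'b \<Rightarrow> complex) \<Rightarrow> 'b set \<Rightarrow> ('b \<Rightarrow> complex) \<Rightarrow> ('b \<Rightarrow> complex)" where
  "mact M B u = (\<lambda>b. if b \<in> B then (\<Sum>b'\<in>B. M b b' * u b') else 0)"

definition irreducible_mod :: "nat \<Rightarrow> 'b smod \<Rightarrow> bool" where
  "irreducible_mod n V \<longleftrightarrow> finite (bas V) \<and> bas V \<noteq> {} \<and>
    (\<forall>U. U \<subseteq> vecs (bas V) \<and> (\<lambda>_. 0) \<in> U \<and> (\<forall>u\<in>U. \<forall>v\<in>U. (\<lambda>b. u b + v b) \<in> U) \<and>
         (\<forall>u\<in>U. \<forall>c. (\<lambda>b. c * u b) \<in> U) \<and>
         (\<forall>i\<in>{1..n - 1}. \<forall>u\<in>U. mact (xop V i) (bas V) u \<in> U \<and> mact (yop V i) (bas V) u \<in> U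
              \<and> mact (hop V i) (bas V) u \<in> U)
       \<longrightarrow> U = {\<lambda>_. 0} \<or> U = vecs (bas V))"

definition vbasis :: "'b set \<Rightarrow> 'r set \<Rightarrow> ('r \<Rightarrow> 'b \<Rightarrow> complex) \<Rightarrow> bool" where
  "vbasis B I w \<longleftrightarrow> finite I \<and> (\<forall>r\<in>I. w r \<in> vecs B) \<and>
     (\<forall>u\<in>vecs B. \<exists>!c. (\<forall>r. r \<notin> I \<longrightarrow> c r = 0) \<and> u = (\<lambda>b. \<Sum>r\<in>I. c r * w r b))"

definition coord :: "'r set \<Rightarrow> ('r \<Rightarrow> 'b \<Rightarrow> complex) \<Rightarrow> ('b \<Rightarrow> complex) \<Rightarrow> 'r \<Rightarrow> complex" where
  "coord I w u = (THE c. (\<forall>r. r \<notin> I \<longrightarrow> c r = 0) \<and> u = (\<lambda>b. \<Sum>r\<in>I. c r * w r b))"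

definition weight_basis :: "nat \<Rightarrow> 'b smod \<Rightarrow> 'r set \<Rightarrow> ('r \<Rightarrow> 'b \<Rightarrow> complex) \<Rightarrow> bool" where
  "weight_basis n V I w \<longleftrightarrow> vbasis (bas V) I w \<and>
     (\<forall>r\<in>I. \<forall>i\<in>{1..n - 1}. \<exists>c. mact (hop V i) (bas V) (w r) = (\<lambda>b. c * w r b))"

definition suppg :: "nat \<Rightarrow> 'b smod \<Rightarrow> 'r set \<Rightarrow> ('r \<Rightarrow> 'b \<Rightarrow> complex) \<Rightarrow> ('r \<times> nat \<times> 'r) set" where
  "suppg n V I w = {(s, i, t) | s i t. s \<in> I \<and> t \<in> I \<and> i \<in> {1..n - 1} \<and>
      (coord I w (mact (xop V i) (bas V) (w s)) t \<noteq> 0 \<or>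
       coord I w (mact (yop V i) (bas V) (w t)) s \<noteq> 0)}"

definition is_supp_graph :: "nat \<Rightarrow> 'b smod \<Rightarrow> 'r set \<Rightarrow> ('r \<times> nat \<times> 'r) set \<Rightarrow> bool" where
  "is_supp_graph n V I E \<longleftrightarrow> (\<exists>w. weight_basis n V I w \<and> suppg n V I w = E)"

definition solitary :: "nat \<Rightarrow> 'b smod \<Rightarrow> 'r set \<Rightarrow> ('r \<times> nat \<times> 'r) set \<Rightarrow> bool" where
  "solitary n V I E \<longleftrightarrow> (\<exists>v. weight_basis n V I v \<and> suppg n V I v = E \<and>
     (\<forall>w. weight_basis n V I w \<and> suppg n V I w = E \<longrightarrow>
          (\<exists>a. \<forall>r\<in>I. a r \<noteq> 0 \<and> w r = (\<lambda>b. a r * v r b))))"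

definition edge_minimal :: "nat \<Rightarrow> 'b smod \<Rightarrow> 'r set \<Rightarrow> ('r \<times> nat \<times> 'r) set \<Rightarrow> bool" where
  "edge_minimal n V I E \<longleftrightarrow> is_supp_graph n V I E \<and>
     \<not> (\<exists>E' w f. E' \<subset> E \<and> weight_basis n V I w \<and> bij_betw f I I \<and>
          (\<forall>s\<in>I. \<forall>t\<in>I. \<forall>i. (s, i, t) \<in> suppg n V I w \<longleftrightarrow> (f s, i, f t) \<in> E'))"

end

theory Submission
  imports Defs
begin

text \<open>A filling is encoded by its column pattern: for each column, the row of the last entry
  \<open>\<le> i\<close>, for \<open>i = 0..n\<close>. In this language an edge of color \<open>i\<close> adds one to a single entry of level \<open>i\<close>,
  column complement and rotation are reindexings of patterns, and the weight is a second
  difference of the level sums; so the four lattices \<open>(P/Q)\<^sup>\<star>\<close> are the four versions of \<open>L\<close>.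
  The module of the dual poset is the twist of \<open>V\<close> exchanging \<open>x\<close> and \<open>y\<close>, and
  a diagonal rescaling (the Gelfand-Tsetlin norm, a product of factorials) identifies it with the
  dual module. Solitarity and edge-minimality are transported along dual bases.

  In the Young case call a pattern \<open>k\<close>-maximal if no edge of color at most \<open>k\<close> leaves it. For two
  edges of color \<open>k\<close> with the same target, at most one source is \<open>(k - 1)\<close>-maximal. Since the
  edge scalars do not vanish, the common kernel of \<open>x\<^sub>1, \<dots>, x\<^sub>k\<close> is therefore spanned by the
  \<open>k\<close>-maximal basis vectors; ordering the \<open>(k - 1)\<close>-maximal elements suitably, one also sees that each
  \<open>k\<close>-maximal vector generates its whole component under \<open>y\<^sub>1, \<dots>, y\<^sub>k\<close>. Irreducibility follows at once. A weight basis whose supporting graph lies in \<open>L\<close> is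
  then shown, by downward induction on \<open>k\<close>, to agree with the standard one up to scalars on
  \<open>k\<close>-maximal elements, because \<open>(k - 1)\<close>-maximal elements of one \<open>k\<close>-component have distinct weights.\<close>

section \<open>Bases and dual bases\<close>

text \<open>The scalars X and Y are prescribed for P/Q only. Passing to the dual poset exchanges
  them, whereas passing to the dual module transposes and negates them. The two agree after
  rescaling by a vertex function \<tau> with \<tau>(S) Y = - X \<tau>(T) on each edge S -> T. The
  ratio \<tau>(T) / \<tau>(S) is then a quotient of products of differences of shifted pattern
  entries, which makes \<tau> a product of factorials; the differences take both signs, so the
  factorial has to be continued to negative integers. The Young case is argued from the positions of
  the nonzero coefficients of x and y and from the weights. It therefore covers every module whose
  scalars are nonzero exactly on the edges of \<open>L\<close>, among them V and the twisted dual of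
  V, and so any of the four shapes may be the Young diagram. Special about a Young shape is that all
  columns begin in the same row: level 0 is constant, and a k-maximal pattern is the minimum of a
  ceiling and its own level k + 1. Uniqueness of maxima, distinctness of weights and the one-source
  property all come from this formula.\<close>

definition dual_pair :: "'b set \<Rightarrow> 'r set \<Rightarrow> ('r \<Rightarrow> 'b \<Rightarrow> complex) \<Rightarrow> ('r \<Rightarrow> 'b \<Rightarrow> complex) \<Rightarrow> bool" where
  "dual_pair B I w u \<longleftrightarrow> (\<forall>r\<in>I. w r \<in> vecs B) \<and> (\<forall>r\<in>I. u r \<in> vecs B) \<and>
    (\<forall>r\<in>I. \<forall>r'\<in>I. (\<Sum>b\<in>B. u r b * w r' b) = (if r = r' then 1 else 0)) \<and>
    (\<forall>b\<in>B. \<forall>b'\<in>B. (\<Sum>r\<in>I. w r b * u r b') = (if b = b' then 1 else 0))"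

lemma dual_pair_sym: "dual_pair B I w u \<Longrightarrow> dual_pair B I u w"
  unfolding dual_pair_def by (auto simp: mult.commute)

lemma sum_indicator:
  fixes g :: "'a \<Rightarrow> complex"
  assumes "finite A" "a \<in> A"
  shows "(\<Sum>x\<in>A. (if a = x then 1 else 0) * g x) = g a"
    "(\<Sum>x\<in>A. (if x = a then 1 else 0) * g x) = g a"
    "(\<Sum>x\<in>A. g x * (if a = x then 1 else 0)) = g a"
    "(\<Sum>x\<in>A. g x * (if x = a then 1 else 0)) = g a"
  using assms by (simp_all add: if_distrib if_distribR sum.delta sum.delta' cong: if_cong)

lemma dual_pair_expand:
  assumes "finite B" "finite I" "dual_pair B I w u" "v \<in> vecs B"
  shows "v = (\<lambda>b. \<Sum>r\<in>I. (\<Sum>b'\<in>B. u r b' * v b') * w r b)"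
proof
  fix b
  show "v b = (\<Sum>r\<in>I. (\<Sum>b'\<in>B. u r b' * v b') * w r b)"
  proof (cases "b \<in> B")
    case True
    have "(\<Sum>r\<in>I. (\<Sum>b'\<in>B. u r b' * v b') * w r b) = (\<Sum>r\<in>I. \<Sum>b'\<in>B. (w r b * u r b') * v b')"
      by (simp add: sum_distrib_left sum_distrib_right mult_ac)
    also have "\<dots> = (\<Sum>b'\<in>B. (\<Sum>r\<in>I. w r b * u r b') * v b')"
      by (subst sum.swap) (simp add: sum_distrib_right)
    also have "\<dots> = (\<Sum>b'\<in>B. (if b = b' then 1 else 0) * v b')"
      using assms(3) True by (intro sum.cong) (auto simp: dual_pair_def)
    also have "\<dots> = v b" using assms(1) True by (simp add: sum_indicator)
    finally show ?thesis by simp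
  next
    case False
    then have "v b = 0" "\<forall>r\<in>I. w r b = 0" using assms(3,4) by (auto simp: dual_pair_def vecs_def)
    then show ?thesis by simp
  qed
qed

lemma dual_pair_coeff_unique:
  assumes "finite B" "finite I" "dual_pair B I w u" "r \<in> I" "v = (\<lambda>b. \<Sum>r\<in>I. c r * w r b)"
  shows "c r = (\<Sum>b\<in>B. u r b * v b)"
proof -
  have "(\<Sum>b\<in>B. u r b * v b) = (\<Sum>b\<in>B. \<Sum>r'\<in>I. c r' * (u r b * w r' b))"
    using assms(5) by (simp add: sum_distrib_left mult_ac)
  also have "\<dots> = (\<Sum>r'\<in>I. c r' * (\<Sum>b\<in>B. u r b * w r' b))"
    by (subst sum.swap) (simp add: sum_distrib_left)
  also have "\<dots> = (\<Sum>r'\<in>I. c r' * (if r = r' then 1 else 0))"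
    using assms(3,4) by (intro sum.cong) (auto simp: dual_pair_def)
  also have "\<dots> = c r" using assms(2,4) by (simp add: sum_indicator)
  finally show ?thesis by simp
qed

text \<open>Put as an equation for \<open>c\<close>, so that both the definite description in
  \<open>coord\<close> and the unique existence in \<open>vbasis\<close> collapse by
  rewriting.\<close>

lemma dual_pair_coord_ex1:
  assumes "finite B" "finite I" "dual_pair B I w u" "v \<in> vecs B"
  shows "(\<forall>r. r \<notin> I \<longrightarrow> c r = 0) \<and> v = (\<lambda>b. \<Sum>r\<in>I. c r * w r b)
    \<longleftrightarrow> c = (\<lambda>r. if r \<in> I then \<Sum>b\<in>B. u r b * v b else 0)"
proof
  assume l: "(\<forall>r. r \<notin> I \<longrightarrow> c r = 0) \<and> v = (\<lambda>b. \<Sum>r\<in>I. c r * w r b)"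
  have "c r = (\<Sum>b\<in>B. u r b * v b)" if "r \<in> I" for r
    using dual_pair_coeff_unique[OF assms(1-3) that, of v c] l by blast
  moreover have "c r = 0" if "r \<notin> I" for r using l that by blast
  ultimately show "c = (\<lambda>r. if r \<in> I then \<Sum>b\<in>B. u r b * v b else 0)" by auto
next
  assume r: "c = (\<lambda>r. if r \<in> I then \<Sum>b\<in>B. u r b * v b else 0)"
  then have "(\<lambda>b. \<Sum>r\<in>I. c r * w r b) = (\<lambda>b. \<Sum>r\<in>I. (\<Sum>b'\<in>B. u r b' * v b') * w r b)"
    by (auto intro!: sum.cong)
  then show "(\<forall>r. r \<notin> I \<longrightarrow> c r = 0) \<and> v = (\<lambda>b. \<Sum>r\<in>I. c r * w r b)"
    using dual_pair_expand[OF assms] r by (metis (no_types, lifting))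
qed

lemma coord_dual_pair:
  assumes "finite B" "finite I" "dual_pair B I w u" "v \<in> vecs B" "r \<in> I"
  shows "coord I w v r = (\<Sum>b\<in>B. u r b * v b)"
  unfolding coord_def dual_pair_coord_ex1[OF assms(1-4)] using assms(5) by simp

lemma dual_pair_vbasis:
  assumes "finite B" "finite I" "dual_pair B I w u"
  shows "vbasis B I w"
  unfolding vbasis_def
proof (intro conjI ballI)
  fix v assume "v \<in> vecs B"
  from dual_pair_coord_ex1[OF assms this]
  show "\<exists>!c. (\<forall>r. r \<notin> I \<longrightarrow> c r = 0) \<and> v = (\<lambda>b. \<Sum>r\<in>I. c r * w r b)"
    by (simp only:) blast
qed (use assms in \<open>auto simp: dual_pair_def\<close>)

lemma ex1_eq: "\<exists>!x. R x \<Longrightarrow> R x \<Longrightarrow> R y \<Longrightarrow> x = y"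
  by blast

text \<open>Expanding the unit vectors in \<open>w\<close> gives a one-sided inverse of the matrix
  of \<open>w\<close>. That it is two-sided comes from uniqueness of coordinates and not from a
  dimension count, since \<open>I\<close> and \<open>B\<close> are not yet known to have the same
  size.\<close>

lemma vbasis_dual_pair:
  assumes fB: "finite B" and vb: "vbasis B I w"
  shows "\<exists>u. dual_pair B I w u"
proof -
  have fI: "finite I" and wB: "\<And>r. r \<in> I \<Longrightarrow> w r \<in> vecs B"
    and ex: "\<And>v. v \<in> vecs B \<Longrightarrow> \<exists>!c. (\<forall>r. r \<notin> I \<longrightarrow> c r = 0) \<and> v = (\<lambda>b. \<Sum>r\<in>I. c r * w r b)"
    using vb by (auto simp: vbasis_def)
  define e where "e b = (\<lambda>b'. if b = b' then 1 else (0::complex))" for b :: 'a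
  have "\<forall>b\<in>B. \<exists>c. (\<forall>r. r \<notin> I \<longrightarrow> c r = 0) \<and> e b = (\<lambda>b. \<Sum>r\<in>I. c r * w r b)"
  proof
    fix b assume "b \<in> B"
    then have "e b \<in> vecs B" by (auto simp: e_def vecs_def)
    from ex1_implies_ex[OF ex[OF this]]
    show "\<exists>c. (\<forall>r. r \<notin> I \<longrightarrow> c r = 0) \<and> e b = (\<lambda>b. \<Sum>r\<in>I. c r * w r b)" .
  qed
  from bchoice[OF this] obtain c where c: "\<And>b. b \<in> B \<Longrightarrow> e b = (\<lambda>b'. \<Sum>r\<in>I. c b r * w r b')"
    by blast
  define u where "u r b = (if b \<in> B then c b r else 0)" for r b
  have 1: "(\<Sum>r\<in>I. w r b * u r b') = (if b = b' then 1 else 0)" if "b \<in> B" "b' \<in> B" for b b'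
    using fun_cong[OF c[OF that(2)], of b] that by (simp add: e_def u_def mult.commute eq_commute)
  have 2: "(\<Sum>b\<in>B. u r b * w r' b) = (if r = r' then 1 else 0)" if r: "r \<in> I" "r' \<in> I" for r r'
  proof -
    \<comment> \<open>Both \<open>?d\<close> and \<open>?d'\<close> are coordinate functions of
      \<open>w r'\<close>; uniqueness identifies them, and their values at \<open>r\<close> give the
      claim.\<close>
    let ?d = "\<lambda>r. if r \<in> I then (\<Sum>b\<in>B. u r b * w r' b) else 0"
    let ?d' = "\<lambda>r. if r = r' then 1 else (0::complex)"
    have d: "w r' = (\<lambda>b. \<Sum>r\<in>I. ?d r * w r b)"
    proof
      fix b
      show "w r' b = (\<Sum>r\<in>I. ?d r * w r b)"
      proof (cases "b \<in> B")
        case True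
        have "(\<Sum>r\<in>I. ?d r * w r b) = (\<Sum>r\<in>I. \<Sum>b'\<in>B. w r' b' * (w r b * u r b'))"
          by (auto intro!: sum.cong simp: sum_distrib_left sum_distrib_right mult_ac)
        also have "\<dots> = (\<Sum>b'\<in>B. w r' b' * (\<Sum>r\<in>I. w r b * u r b'))"
          by (subst sum.swap) (simp add: sum_distrib_left)
        also have "\<dots> = (\<Sum>b'\<in>B. w r' b' * (if b = b' then 1 else 0))"
          using True 1 by (intro sum.cong) auto
        also have "\<dots> = w r' b" using fB True by (simp add: sum_indicator)
        finally show ?thesis by simp
      next
        case False
        then show ?thesis using wB r by (auto simp: vecs_def)
      qed
    qed
    have d': "w r' = (\<lambda>b. \<Sum>r\<in>I. ?d' r * w r b)"
      using sum_indicator(2)[OF fI r(2)] by (intro ext) (rule sym)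
    have "?d = ?d'"
    proof (rule ex1_eq[OF ex[OF wB[OF r(2)]]])
      show "(\<forall>r. r \<notin> I \<longrightarrow> ?d r = 0) \<and> w r' = (\<lambda>b. \<Sum>r\<in>I. ?d r * w r b)"
        by (rule conjI[OF _ d]) simp
      show "(\<forall>r. r \<notin> I \<longrightarrow> ?d' r = 0) \<and> w r' = (\<lambda>b. \<Sum>r\<in>I. ?d' r * w r b)"
        by (rule conjI[OF _ d']) (use r in auto)
    qed
    from fun_cong[OF this, of r] show ?thesis using r(1) by (simp only: if_True)
  qed
  have "dual_pair B I w u" unfolding dual_pair_def using 1 2 wB by (auto simp: u_def vecs_def)
  then show ?thesis by blast
qed

lemma mact_vecs: "mact M B v \<in> vecs B"
  by (auto simp: mact_def vecs_def)

text \<open>The matrix of \<open>M\<close> in the basis \<open>w\<close>, row \<open>t\<close> and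
  column \<open>s\<close>. Exchanging \<open>w\<close> and \<open>u\<close> transposes it, which is
  what passing to the dual module calls for.\<close>

definition mcoef :: "'b set \<Rightarrow> ('r \<Rightarrow> 'b \<Rightarrow> complex) \<Rightarrow> ('r \<Rightarrow> 'b \<Rightarrow> complex) \<Rightarrow> ('b \<Rightarrow> 'b \<Rightarrow> complex) \<Rightarrow> 'r \<Rightarrow> 'r \<Rightarrow> complex" where
  "mcoef B w u M t s = (\<Sum>b\<in>B. \<Sum>b'\<in>B. u t b * M b b' * w s b')"

lemma coord_mact:
  assumes "finite B" "finite I" "dual_pair B I w u" "t \<in> I"
  shows "coord I w (mact M B (w s)) t = mcoef B w u M t s"
  unfolding coord_dual_pair[OF assms(1-3) mact_vecs assms(4)] mcoef_def
  by (auto intro!: sum.cong simp: mact_def sum_distrib_left mult.assoc)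

lemma mact_expand:
  assumes "finite B" "finite I" "dual_pair B I w u"
  shows "mact M B (w s) = (\<lambda>b. \<Sum>t\<in>I. mcoef B w u M t s * w t b)"
proof -
  have *: "(\<Sum>b'\<in>B. u t b' * mact M B (w s) b') = mcoef B w u M t s" for t
    unfolding mcoef_def by (auto intro!: sum.cong simp: mact_def sum_distrib_left mult.assoc)
  show ?thesis using dual_pair_expand[OF assms mact_vecs, of M "w s"] unfolding * by simp
qed

lemma suppg_dual_pair:
  assumes "finite (bas V)" "finite I" "dual_pair (bas V) I w u"
  shows "suppg n V I w = {(s, i, t) | s i t. s \<in> I \<and> t \<in> I \<and> i \<in> {1..n - 1} \<and>
      (mcoef (bas V) w u (xop V i) t s \<noteq> 0 \<or> mcoef (bas V) w u (yop V i) s t \<noteq> 0)}"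
  unfolding suppg_def using coord_mact[OF assms] by auto

definition diag_on :: "'b set \<Rightarrow> 'r set \<Rightarrow> ('r \<Rightarrow> 'b \<Rightarrow> complex) \<Rightarrow> ('r \<Rightarrow> 'b \<Rightarrow> complex) \<Rightarrow> ('b \<Rightarrow> 'b \<Rightarrow> complex) \<Rightarrow> bool" where
  "diag_on B I w u M \<longleftrightarrow> (\<forall>r\<in>I. \<forall>t\<in>I. t \<noteq> r \<longrightarrow> mcoef B w u M t r = 0)"

lemma diag_on_iff:
  assumes "finite B" "finite I" "dual_pair B I w u"
  shows "diag_on B I w u M \<longleftrightarrow> (\<forall>r\<in>I. \<exists>c. mact M B (w r) = (\<lambda>b. c * w r b))"
proof
  assume d: "diag_on B I w u M"
  show "\<forall>r\<in>I. \<exists>c. mact M B (w r) = (\<lambda>b. c * w r b)"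
  proof
    fix r assume r: "r \<in> I"
    have "mact M B (w r) = (\<lambda>b. \<Sum>t\<in>I. mcoef B w u M t r * w t b)"
      by (rule mact_expand[OF assms])
    also have "\<dots> = (\<lambda>b. \<Sum>t\<in>I. (if t = r then 1 else 0) * (mcoef B w u M t r * w t b))"
      using d r by (intro ext sum.cong) (auto simp: diag_on_def)
    also have "\<dots> = (\<lambda>b. mcoef B w u M r r * w r b)"
      using r assms(2) by (simp only: sum_indicator)
    finally show "\<exists>c. mact M B (w r) = (\<lambda>b. c * w r b)" by blast
  qed
next
  assume d: "\<forall>r\<in>I. \<exists>c. mact M B (w r) = (\<lambda>b. c * w r b)"
  show "diag_on B I w u M" unfolding diag_on_def
  proof (intro ballI impI)
    fix r t assume rt: "r \<in> I" "t \<in> I" "t \<noteq> r"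
    obtain c where c: "mact M B (w r) = (\<lambda>b. c * w r b)" using d rt by blast
    have "mcoef B w u M t r = (\<Sum>b\<in>B. u t b * mact M B (w r) b)"
      unfolding mcoef_def by (auto intro!: sum.cong simp: mact_def sum_distrib_left mult.assoc)
    also have "\<dots> = c * (\<Sum>b\<in>B. u t b * w r b)" unfolding c by (simp add: sum_distrib_left mult_ac)
    also have "\<dots> = 0" using assms(3) rt by (auto simp: dual_pair_def)
    finally show "mcoef B w u M t r = 0" .
  qed
qed

text \<open>Trades unique existence of coordinates for an explicit dual basis and eigenvectors for
  vanishing off-diagonal entries, a form that survives transposition.\<close>

lemma weight_basis_iff:
  assumes "finite (bas V)"
  shows "weight_basis n V I w \<longleftrightarrow> finite I \<and>
    (\<exists>u. dual_pair (bas V) I w u \<and> (\<forall>i\<in>{1..n-1}. diag_on (bas V) I w u (hop V i)))"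
proof
  assume wb: "weight_basis n V I w"
  then have vb: "vbasis (bas V) I w" by (simp add: weight_basis_def)
  then have fI: "finite I" by (simp add: vbasis_def)
  obtain u where u: "dual_pair (bas V) I w u" using vbasis_dual_pair[OF assms vb] by blast
  then show "finite I \<and> (\<exists>u. dual_pair (bas V) I w u \<and> (\<forall>i\<in>{1..n-1}. diag_on (bas V) I w u (hop V i)))"
    using fI wb diag_on_iff[OF assms fI u] by (force simp: weight_basis_def)
next
  assume r: "finite I \<and> (\<exists>u. dual_pair (bas V) I w u \<and> (\<forall>i\<in>{1..n-1}. diag_on (bas V) I w u (hop V i)))"
  then obtain u where u: "dual_pair (bas V) I w u" and d: "\<forall>i\<in>{1..n-1}. diag_on (bas V) I w u (hop V i)"
    by blast
  then show "weight_basis n V I w"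
    using r dual_pair_vbasis[OF assms _ u] diag_on_iff[OF assms _ u] by (force simp: weight_basis_def)
qed

lemma dual_pair_unique:
  assumes "finite B" "finite I" "dual_pair B I w u" "dual_pair B I w u'" "r \<in> I"
  shows "u r = u' r"
proof -
  have d: "dual_pair B I u w" using dual_pair_sym assms(3) .
  have v: "u' r \<in> vecs B" using assms(4,5) by (simp add: dual_pair_def)
  have "u' r = (\<lambda>b. \<Sum>t\<in>I. (\<Sum>b'\<in>B. w t b' * u' r b') * u t b)"
    by (rule dual_pair_expand[OF assms(1,2) d v])
  also have "\<dots> = (\<lambda>b. \<Sum>t\<in>I. (if t = r then 1 else 0) * u t b)"
    using assms(4,5) by (intro ext sum.cong) (auto simp: dual_pair_def mult.commute)
  also have "\<dots> = u r" using assms(2,5) by (simp only: sum_indicator)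
  finally show ?thesis by simp
qed

definition proportional_on :: "'r set \<Rightarrow> ('r \<Rightarrow> 'b \<Rightarrow> complex) \<Rightarrow> ('r \<Rightarrow> 'b \<Rightarrow> complex) \<Rightarrow> bool" where
  "proportional_on I w v \<longleftrightarrow> (\<exists>a. \<forall>r\<in>I. a r \<noteq> 0 \<and> w r = (\<lambda>b. a r * v r b))"

text \<open>Rescaling \<open>w\<close> by \<open>a\<close> rescales its dual basis by the inverses.
  This is why solitarity is invariant under duality.\<close>

lemma proportional_dual:
  assumes "finite B" "finite I" "dual_pair B I w u" "dual_pair B I w' u'" "proportional_on I w w'"
  shows "proportional_on I u u'"
proof -
  obtain a where a: "\<And>r. r \<in> I \<Longrightarrow> a r \<noteq> 0 \<and> w r = (\<lambda>b. a r * w' r b)"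
    using assms(5) by (auto simp: proportional_on_def)
  define u2 where "u2 r b = inverse (a r) * u' r b" for r b
  have 1: "(\<Sum>b\<in>B. u2 r b * w r' b) = (if r = r' then 1 else 0)" if "r \<in> I" "r' \<in> I" for r r'
  proof -
    have "(\<Sum>b\<in>B. u2 r b * w r' b) = (a r' * inverse (a r)) * (\<Sum>b\<in>B. u' r b * w' r' b)"
      using a[OF that(2)] by (simp add: u2_def sum_distrib_left mult_ac)
    also have "\<dots> = (if r = r' then 1 else 0)"
      using assms(4) that a[OF that(1)] by (auto simp: dual_pair_def)
    finally show ?thesis .
  qed
  have 2: "(\<Sum>r\<in>I. w r b * u2 r b') = (if b = b' then 1 else 0)" if "b \<in> B" "b' \<in> B" for b b'
  proof -
    have "(\<Sum>r\<in>I. w r b * u2 r b') = (\<Sum>r\<in>I. w' r b * u' r b')"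
      using a by (intro sum.cong) (auto simp: u2_def)
    then show ?thesis using assms(4) that by (auto simp: dual_pair_def)
  qed
  have "dual_pair B I w u2" unfolding dual_pair_def using 1 2 assms(3,4)
    by (auto simp: dual_pair_def vecs_def u2_def)
  then have "u r = u2 r" if "r \<in> I" for r
    using dual_pair_unique[OF assms(1-3) _ that] by blast
  then show ?thesis unfolding proportional_on_def
    by (intro exI[of _ "\<lambda>r. inverse (a r)"]) (auto simp: u2_def fun_eq_iff a)
qed

lemma suppg_subset: "suppg n V I w \<subseteq> I \<times> {1..n - 1} \<times> I"
  by (auto simp: suppg_def)

lemma weight_basis_reindex:
  assumes fB: "finite (bas V)" and bij: "bij_betw \<psi> J I" and wb: "weight_basis n V I w"
  shows "weight_basis n V J (w \<circ> \<psi>)"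
    and "suppg n V J (w \<circ> \<psi>) = {(s, i, t). s \<in> J \<and> t \<in> J \<and> (\<psi> s, i, \<psi> t) \<in> suppg n V I w}"
proof -
  obtain u where fI: "finite I" and u: "dual_pair (bas V) I w u"
    and d: "\<forall>i\<in>{1..n-1}. diag_on (bas V) I w u (hop V i)"
    using wb weight_basis_iff[OF fB] by blast
  have fJ: "finite J" using bij fI bij_betw_finite by blast
  have mem: "r \<in> J \<Longrightarrow> \<psi> r \<in> I" for r using bij by (auto simp: bij_betw_def)
  have eq: "r \<in> J \<Longrightarrow> r' \<in> J \<Longrightarrow> \<psi> r = \<psi> r' \<longleftrightarrow> r = r'" for r r'
    using bij by (auto simp: bij_betw_def inj_on_def)
  have u': "dual_pair (bas V) J (w \<circ> \<psi>) (u \<circ> \<psi>)"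
    using u mem eq sum.reindex_bij_betw[OF bij, of "\<lambda>r. w r b * u r b'" for b b']
    by (simp add: dual_pair_def)
  have m: "mcoef (bas V) (w \<circ> \<psi>) (u \<circ> \<psi>) M t s = mcoef (bas V) w u M (\<psi> t) (\<psi> s)" for M t s
    by (simp add: mcoef_def)
  have "\<forall>i\<in>{1..n-1}. diag_on (bas V) J (w \<circ> \<psi>) (u \<circ> \<psi>) (hop V i)"
    using d mem eq unfolding diag_on_def m by blast
  then show "weight_basis n V J (w \<circ> \<psi>)" using weight_basis_iff[OF fB] u' fJ by blast
  show "suppg n V J (w \<circ> \<psi>) = {(s, i, t). s \<in> J \<and> t \<in> J \<and> (\<psi> s, i, \<psi> t) \<in> suppg n V I w}"
    unfolding suppg_dual_pair[OF fB fI u] suppg_dual_pair[OF fB fJ u'] m using mem by auto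
qed

text \<open>An isomorphism onto a smaller graph can be absorbed by relabelling the basis along its
  inverse, so it suffices to compare edge sets on the fixed index set.\<close>

lemma edge_minimal_iff:
  assumes fB: "finite (bas V)"
  shows "edge_minimal n V I E \<longleftrightarrow> is_supp_graph n V I E \<and>
     \<not> (\<exists>w. weight_basis n V I w \<and> suppg n V I w \<subset> E)"
proof (cases "is_supp_graph n V I E")
  case True
  then have E: "E \<subseteq> I \<times> {1..n - 1} \<times> I" using suppg_subset unfolding is_supp_graph_def by metis
  have "(\<exists>E' w f. E' \<subset> E \<and> weight_basis n V I w \<and> bij_betw f I I \<and>
          (\<forall>s\<in>I. \<forall>t\<in>I. \<forall>i. (s, i, t) \<in> suppg n V I w \<longleftrightarrow> (f s, i, f t) \<in> E'))
    \<longleftrightarrow> (\<exists>w. weight_basis n V I w \<and> suppg n V I w \<subset> E)" (is "?L \<longleftrightarrow> ?R")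
  proof
    assume ?L
    then obtain E' w f where a: "E' \<subset> E" "weight_basis n V I w" "bij_betw f I I"
      "\<And>s t i. s \<in> I \<Longrightarrow> t \<in> I \<Longrightarrow> (s, i, t) \<in> suppg n V I w \<longleftrightarrow> (f s, i, f t) \<in> E'" by blast
    define g where "g = the_inv_into I f"
    have g: "bij_betw g I I" unfolding g_def by (rule bij_betw_the_inv_into[OF a(3)])
    have fg: "f (g s) = s" "g s \<in> I" if "s \<in> I" for s
      using a(3) that g by (auto simp: g_def bij_betw_def f_the_inv_into_f)
    have "suppg n V I (w \<circ> g) = {(s, i, t). s \<in> I \<and> t \<in> I \<and> (g s, i, g t) \<in> suppg n V I w}"
      by (rule weight_basis_reindex(2)[OF fB g a(2)])
    also have "\<dots> = {(s, i, t). s \<in> I \<and> t \<in> I \<and> (s, i, t) \<in> E'}"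
      using a(4) fg by auto
    also have "\<dots> = E'" using a(1) E by auto
    finally have "suppg n V I (w \<circ> g) = E'" .
    then show ?R using weight_basis_reindex(1)[OF fB g a(2)] a(1) by metis
  next
    assume ?R
    then obtain w where "weight_basis n V I w" "suppg n V I w \<subset> E" by blast
    then show ?L
      by (intro exI[of _ "suppg n V I w"] exI[of _ w] exI[of _ id]) auto
  qed
  then show ?thesis unfolding edge_minimal_def by blast
qed (simp add: edge_minimal_def)

section \<open>Transport of solitarity and edge-minimality between modules\<close>

lemma solitary_iff:
  "solitary n V I E \<longleftrightarrow> (\<exists>v. weight_basis n V I v \<and> suppg n V I v = E \<and>
     (\<forall>w. weight_basis n V I w \<and> suppg n V I w = E \<longrightarrow> proportional_on I w v))"
  unfolding solitary_def proportional_on_def by blast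

text \<open>A correspondence between the weight bases of two modules that acts on supporting graphs
  through a map \<open>\<theta>\<close> of labelled edges. \<open>F\<close> and \<open>G\<close>
  need not be inverse to each other; the last clause asks for this only up to scalars, which is all
  that solitarity can see.\<close>

definition linked :: "nat \<Rightarrow> 'a smod \<Rightarrow> 'r set \<Rightarrow> 'b smod \<Rightarrow> 's set \<Rightarrow> (('r \<times> nat \<times> 'r) \<Rightarrow> ('s \<times> nat \<times> 's)) \<Rightarrow> bool" where
  "linked n V I W J \<theta> \<longleftrightarrow> inj_on \<theta> (I \<times> {1..n - 1} \<times> I) \<and> (\<exists>F G.
    (\<forall>w. weight_basis n V I w \<longrightarrow>
      weight_basis n W J (F w) \<and> suppg n W J (F w) = \<theta> ` suppg n V I w) \<and>
    (\<forall>w. weight_basis n W J w \<longrightarrow>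
      weight_basis n V I (G w) \<and> suppg n W J w = \<theta> ` suppg n V I (G w)) \<and>
    (\<forall>w v. weight_basis n W J w \<longrightarrow> weight_basis n V I v \<longrightarrow>
      proportional_on I (G w) v \<longrightarrow> proportional_on J w (F v)))"

lemma linkedI:
  assumes "inj_on \<theta> (I \<times> {1..n - 1} \<times> I)"
    and "\<And>w. weight_basis n V I w \<Longrightarrow>
      weight_basis n W J (F w) \<and> suppg n W J (F w) = \<theta> ` suppg n V I w"
    and "\<And>w. weight_basis n W J w \<Longrightarrow>
      weight_basis n V I (G w) \<and> suppg n W J w = \<theta> ` suppg n V I (G w)"
    and "\<And>w v. weight_basis n W J w \<Longrightarrow> weight_basis n V I v \<Longrightarrow>
      proportional_on I (G w) v \<Longrightarrow> proportional_on J w (F v)"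
  shows "linked n V I W J \<theta>"
  unfolding linked_def using assms(1)
  by (intro conjI exI[of _ F] exI[of _ G] allI impI assms(2-4)) assumption+

lemma linked_solitary:
  assumes l: "linked n V I W J \<theta>" and s: "solitary n V I E"
  shows "solitary n W J (\<theta> ` E)"
proof -
  obtain F G where inj: "inj_on \<theta> (I \<times> {1..n - 1} \<times> I)"
    and F: "\<And>w. weight_basis n V I w \<Longrightarrow>
      weight_basis n W J (F w) \<and> suppg n W J (F w) = \<theta> ` suppg n V I w"
    and G: "\<And>w. weight_basis n W J w \<Longrightarrow>
      weight_basis n V I (G w) \<and> suppg n W J w = \<theta> ` suppg n V I (G w)"
    and p: "\<And>w v. weight_basis n W J w \<Longrightarrow> weight_basis n V I v \<Longrightarrow>
      proportional_on I (G w) v \<Longrightarrow> proportional_on J w (F v)"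
    using l unfolding linked_def by metis
  obtain v where v: "weight_basis n V I v" "suppg n V I v = E"
    and u: "\<And>w. weight_basis n V I w \<Longrightarrow> suppg n V I w = E \<Longrightarrow> proportional_on I w v"
    using s unfolding solitary_iff by blast
  have E: "E \<subseteq> I \<times> {1..n - 1} \<times> I" using suppg_subset v by blast
  have "proportional_on J w (F v)" if w: "weight_basis n W J w" "suppg n W J w = \<theta> ` E" for w
  proof -
    have "\<theta> ` suppg n V I (G w) = \<theta> ` E" using G w by metis
    \<comment> \<open>The graph of \<open>G w\<close> is not known beforehand, hence the injectivity
      of \<open>\<theta>\<close> on all conceivable edges rather than on \<open>E\<close>.\<close>
    then have "suppg n V I (G w) = E" using inj_on_image_eq_iff[OF inj suppg_subset E] by blast
    then show ?thesis using p u w v G by blast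
  qed
  then show ?thesis unfolding solitary_iff using F v by blast
qed

lemma linked_edge_minimal:
  assumes l: "linked n V I W J \<theta>" and s: "edge_minimal n V I E"
    and fin: "finite (bas V)" "finite (bas W)"
  shows "edge_minimal n W J (\<theta> ` E)"
proof -
  obtain F G where inj: "inj_on \<theta> (I \<times> {1..n - 1} \<times> I)"
    and F: "\<And>w. weight_basis n V I w \<Longrightarrow>
      weight_basis n W J (F w) \<and> suppg n W J (F w) = \<theta> ` suppg n V I w"
    and G: "\<And>w. weight_basis n W J w \<Longrightarrow>
      weight_basis n V I (G w) \<and> suppg n W J w = \<theta> ` suppg n V I (G w)"
    using l unfolding linked_def by metis
  have sg: "is_supp_graph n V I E"
    and u: "\<not> (\<exists>w. weight_basis n V I w \<and> suppg n V I w \<subset> E)"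
    using s unfolding edge_minimal_iff[OF fin(1)] by blast+
  have E: "E \<subseteq> I \<times> {1..n - 1} \<times> I" using suppg_subset sg unfolding is_supp_graph_def by metis
  have "\<not> suppg n W J w \<subset> \<theta> ` E" if w: "weight_basis n W J w" for w
  proof
    assume a: "suppg n W J w \<subset> \<theta> ` E"
    have "\<theta> ` suppg n V I (G w) \<subset> \<theta> ` E" using G w a by metis
    then have "suppg n V I (G w) \<subset> E"
      using inj_on_image_mem_iff[OF inj _ E] suppg_subset[of n V I "G w"] E by blast
    then show False using u G w by blast
  qed
  moreover have "is_supp_graph n W J (\<theta> ` E)" using sg F unfolding is_supp_graph_def by blast
  ultimately show ?thesis unfolding edge_minimal_iff[OF fin(2)] by blast
qed

lemma proportional_on_reindex:
  assumes "proportional_on I w v" "\<And>r. r \<in> J \<Longrightarrow> \<psi> r \<in> I"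
  shows "proportional_on J (w \<circ> \<psi>) (v \<circ> \<psi>)"
proof -
  obtain a where a: "\<forall>r\<in>I. a r \<noteq> 0 \<and> w r = (\<lambda>b. a r * v r b)"
    using assms(1) unfolding proportional_on_def by blast
  show ?thesis unfolding proportional_on_def
    by (rule exI[of _ "a \<circ> \<psi>"]) (use a assms(2) in simp)
qed

lemma proportional_on_cong:
  assumes "proportional_on I w v" "\<And>r. r \<in> I \<Longrightarrow> w' r = w r"
  shows "proportional_on I w' v"
  using assms unfolding proportional_on_def by auto

lemma linked_reindex:
  assumes fB: "finite (bas V)" and bij: "bij_betw \<phi> I J"
  shows "linked n V I V J (\<lambda>(s, i, t). (\<phi> s, i, \<phi> t))"
proof -
  define \<psi> where "\<psi> = the_inv_into I \<phi>"
  have b: "bij_betw \<psi> J I" unfolding \<psi>_def by (rule bij_betw_the_inv_into[OF bij])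
  have \<phi>: "\<phi> r \<in> J" "\<psi> (\<phi> r) = r" if "r \<in> I" for r
    using bij that by (auto simp: \<psi>_def bij_betw_def the_inv_into_f_f)
  have \<psi>: "\<psi> r \<in> I" "\<phi> (\<psi> r) = r" if "r \<in> J" for r
    using bij that b by (auto simp: \<psi>_def bij_betw_def f_the_inv_into_f)
  let ?t = "\<lambda>(s, i, t). (\<phi> s, i :: nat, \<phi> t)"
  have "inj_on ?t (I \<times> {1..n - 1} \<times> I)"
    using bij by (auto simp: inj_on_def bij_betw_def)
  moreover have "weight_basis n V J (w \<circ> \<psi>) \<and> suppg n V J (w \<circ> \<psi>) = ?t ` suppg n V I w"
    if w: "weight_basis n V I w" for w
  proof -
    have "{(s, i, t). s \<in> J \<and> t \<in> J \<and> (\<psi> s, i, \<psi> t) \<in> suppg n V I w} = ?t ` suppg n V I w"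
      (is "?A = ?B")
    proof
      show "?A \<subseteq> ?B"
      proof clarify
        fix s i t assume "s \<in> J" "t \<in> J" "(\<psi> s, i, \<psi> t) \<in> suppg n V I w"
        then show "(s, i, t) \<in> ?B" using \<psi> by (intro image_eqI[of _ _ "(\<psi> s, i, \<psi> t)"]) auto
      qed
      show "?B \<subseteq> ?A" using \<phi> suppg_subset[of n V I w] by auto
    qed
    then show ?thesis using weight_basis_reindex[OF fB b w] by metis
  qed
  moreover have "weight_basis n V I (w \<circ> \<phi>) \<and> suppg n V J w = ?t ` suppg n V I (w \<circ> \<phi>)"
    if w: "weight_basis n V J w" for w
  proof -
    have "?t ` {(s, i, t). s \<in> I \<and> t \<in> I \<and> (\<phi> s, i, \<phi> t) \<in> suppg n V J w} = suppg n V J w"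
      (is "?A = ?B")
    proof
      show "?B \<subseteq> ?A"
      proof clarify
        fix s i t assume a: "(s, i, t) \<in> ?B"
        then have "s \<in> J" "t \<in> J" using suppg_subset[of n V J w] by auto
        then show "(s, i, t) \<in> ?A" using \<psi> a by (intro image_eqI[of _ _ "(\<psi> s, i, \<psi> t)"]) auto
      qed
    qed auto
    then show ?thesis using weight_basis_reindex[OF fB bij w] by metis
  qed
  moreover have "proportional_on J w (v \<circ> \<psi>)" if "proportional_on I (w \<circ> \<phi>) v" for w v :: "_ \<Rightarrow> 'a \<Rightarrow> complex"
    using proportional_on_reindex[OF that, of J \<psi>] \<psi> by (auto intro: proportional_on_cong)
  ultimately show ?thesis by (rule linkedI)
qed

lemma ball_color_flip: "(\<forall>i\<in>{1..n-1}. R (n - i)) \<longleftrightarrow> (\<forall>i\<in>{1..n-1}. R (i :: nat))"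
proof safe
  fix i assume "\<forall>i\<in>{1..n-1}. R (n - i)" "i \<in> {1..n-1}"
  moreover from this have "n - i \<in> {1..n-1}" "n - (n - i) = i" by auto
  ultimately show "R i" by metis
next
  fix i assume "\<forall>i\<in>{1..n-1}. R i" "i \<in> {1..n-1}"
  moreover from this have "n - i \<in> {1..n-1}" by auto
  ultimately show "R (n - i)" by blast
qed

lemma msig_bases:
  "weight_basis n (msig n V) I w \<longleftrightarrow> weight_basis n V I w"
  "suppg n (msig n V) I w = (\<lambda>(s, i, t). (s, n - i, t)) ` suppg n V I w"
  "suppg n V I w = (\<lambda>(s, i, t). (s, n - i, t)) ` suppg n (msig n V) I w"
proof -
  note R = ball_color_flip[of n "\<lambda>i. \<exists>c. mact (hop V i) (bas V) (w r) = (\<lambda>b. c * w r b)" for r]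
  show "weight_basis n (msig n V) I w \<longleftrightarrow> weight_basis n V I w"
    unfolding weight_basis_def msig_def by (simp only: smod.simps R)
  have *: "(s, n - i, t) \<in> suppg n (msig n V) I w" if "(s, i, t) \<in> suppg n V I w" for s i t
    using that by (auto simp: suppg_def msig_def)
  have **: "(s, n - i, t) \<in> suppg n V I w" if "(s, i, t) \<in> suppg n (msig n V) I w" for s i t
    using that by (auto simp: suppg_def msig_def)
  have inv: "n - (n - i) = i" if "(s, i, t) \<in> suppg n W I w" for s i t W
    using that by (auto simp: suppg_def)
  show "suppg n (msig n V) I w = (\<lambda>(s, i, t). (s, n - i, t)) ` suppg n V I w" (is "?A = ?B")
  proof
    show "?A \<subseteq> ?B"
    proof clarify
      fix s i t assume a: "(s, i, t) \<in> ?A"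
      show "(s, i, t) \<in> ?B" using **[OF a] inv[OF a] by (intro image_eqI[of _ _ "(s, n - i, t)"]) auto
    qed
  qed (use * in auto)
  show "suppg n V I w = (\<lambda>(s, i, t). (s, n - i, t)) ` suppg n (msig n V) I w" (is "?A = ?B")
  proof
    show "?A \<subseteq> ?B"
    proof clarify
      fix s i t assume a: "(s, i, t) \<in> ?A"
      show "(s, i, t) \<in> ?B" using *[OF a] inv[OF a] by (intro image_eqI[of _ _ "(s, n - i, t)"]) auto
    qed
  qed (use ** in auto)
qed

lemma linked_msig:
  "linked n V I (msig n V) I (\<lambda>(s, i, t). (s, n - i, t))"
  "linked n (msig n V) I V I (\<lambda>(s, i, t). (s, n - i, t))"
proof -
  have inj: "inj_on (\<lambda>(s, i, t). (s, n - i, t)) (I \<times> {1..n - 1} \<times> I)" by (auto simp: inj_on_def)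
  show "linked n V I (msig n V) I (\<lambda>(s, i, t). (s, n - i, t))"
    by (rule linkedI[where F = "\<lambda>w. w" and G = "\<lambda>w. w", OF inj])
      (simp_all add: msig_bases(1) msig_bases(2)[symmetric])
  show "linked n (msig n V) I V I (\<lambda>(s, i, t). (s, n - i, t))"
    by (rule linkedI[where F = "\<lambda>w. w" and G = "\<lambda>w. w", OF inj])
      (simp_all add: msig_bases(1) msig_bases(3)[symmetric])
qed

lemma weight_basis_mdual:
  assumes fB: "finite (bas V)" "finite I" and u: "dual_pair (bas V) I w u"
    and wb: "weight_basis n V I w"
  shows "weight_basis n (mdual V) I u"
    and "suppg n (mdual V) I u = (\<lambda>(s, i, t). (t, i, s)) ` suppg n V I w"
proof -
  have b: "bas (mdual V) = bas V" by (simp add: mdual_def)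
  have u': "dual_pair (bas (mdual V)) I u w" unfolding b by (rule dual_pair_sym[OF u])
  obtain u2 where u2: "dual_pair (bas V) I w u2"
    and d: "\<forall>i\<in>{1..n-1}. diag_on (bas V) I w u2 (hop V i)"
    using wb weight_basis_iff[OF fB(1)] by blast
  have e: "r \<in> I \<Longrightarrow> u2 r = u r" for r using dual_pair_unique[OF fB u2 u] .
  have m: "mcoef (bas V) u w (\<lambda>a b. - M b a) t s = - mcoef (bas V) w u M s t" for M t s
    unfolding mcoef_def
    by (subst sum.swap) (simp add: sum_negf mult_ac)
  have m2: "t \<in> I \<Longrightarrow> mcoef (bas V) w u2 M t s = mcoef (bas V) w u M t s" for M t s
    using e by (simp add: mcoef_def)
  have "\<forall>i\<in>{1..n-1}. diag_on (bas (mdual V)) I u w (hop (mdual V) i)"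
    using d m2 unfolding b diag_on_def by (simp add: mdual_def m)
  then show "weight_basis n (mdual V) I u" using weight_basis_iff fB u' b by metis
  have fb: "finite (bas (mdual V))" using fB b by simp
  show "suppg n (mdual V) I u = (\<lambda>(s, i, t). (t, i, s)) ` suppg n V I w"
    unfolding suppg_dual_pair[OF fB u] suppg_dual_pair[OF fb fB(2) u'] b
    by (force simp: mdual_def m)
qed

lemma mdual_mdual: "mdual (mdual V) = V"
  by (simp add: mdual_def)

text \<open>Choosing a dual basis serves as the translation in both directions, because duality of
  bases is symmetric and \<open>mdual\<close> is an involution. Edges are reversed because matrices
  are transposed.\<close>

lemma linked_mdual:
  assumes fB: "finite (bas V)"
  shows "linked n V I (mdual V) I (\<lambda>(s, i, t). (t, i, s))"
proof -
  have b: "bas (mdual V) = bas V" by (simp add: mdual_def)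
  define F where "F w = (SOME u. dual_pair (bas V) I w u)" for w
  have fI: "finite I" if "weight_basis n V I w" for w
    using that by (simp add: weight_basis_def vbasis_def)
  have fI': "finite I" if "weight_basis n (mdual V) I w" for w
    using that by (simp add: weight_basis_def vbasis_def)
  have F: "dual_pair (bas V) I w (F w)" if "weight_basis n V I w" for w
    unfolding F_def by (rule someI_ex[OF vbasis_dual_pair[OF fB]]) (use that in \<open>simp add: weight_basis_def\<close>)
  have F': "dual_pair (bas V) I w (F w)" if "weight_basis n (mdual V) I w" for w
    unfolding F_def by (rule someI_ex[OF vbasis_dual_pair[OF fB]]) (use that in \<open>simp add: weight_basis_def b\<close>)
  have "inj_on (\<lambda>(s, i, t). (t, i, s)) (I \<times> {1..n - 1} \<times> I)" by (auto simp: inj_on_def)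
  moreover have "weight_basis n (mdual V) I (F w) \<and>
      suppg n (mdual V) I (F w) = (\<lambda>(s, i, t). (t, i, s)) ` suppg n V I w"
    if "weight_basis n V I w" for w
    using weight_basis_mdual[OF fB fI F] that by blast
  moreover have "weight_basis n V I (F w) \<and>
      suppg n (mdual V) I w = (\<lambda>(s, i, t). (t, i, s)) ` suppg n V I (F w)"
    if w: "weight_basis n (mdual V) I w" for w
  proof -
    have "weight_basis n V I (F w)"
      "suppg n V I (F w) = (\<lambda>(s, i, t). (t, i, s)) ` suppg n (mdual V) I w"
      using weight_basis_mdual[of "mdual V" I w "F w" n] w F'[OF w] fI'[OF w] fB
      by (simp_all add: mdual_mdual b)
    then show ?thesis by force
  qed
  moreover have "proportional_on I w (F v)"
    if "weight_basis n (mdual V) I w" "weight_basis n V I v" "proportional_on I (F w) v" for w v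
    by (rule proportional_dual[OF fB fI dual_pair_sym[OF F'[OF that(1)]] F[OF that(2)] that(3)])
      (rule that(2))
  ultimately show ?thesis by (rule linkedI)
qed

section \<open>Isomorphic modules\<close>

definition submod :: "nat \<Rightarrow> 'b smod \<Rightarrow> ('b \<Rightarrow> complex) set \<Rightarrow> bool" where
  "submod n V U \<longleftrightarrow> U \<subseteq> vecs (bas V) \<and> (\<lambda>_. 0) \<in> U \<and> (\<forall>u\<in>U. \<forall>v\<in>U. (\<lambda>b. u b + v b) \<in> U) \<and>
         (\<forall>u\<in>U. \<forall>c. (\<lambda>b. c * u b) \<in> U) \<and>
         (\<forall>i\<in>{1..n - 1}. \<forall>u\<in>U. mact (xop V i) (bas V) u \<in> U \<and> mact (yop V i) (bas V) u \<in> U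
              \<and> mact (hop V i) (bas V) u \<in> U)"

lemma irreducible_mod_submod:
  "irreducible_mod n V \<longleftrightarrow> finite (bas V) \<and> bas V \<noteq> {} \<and>
    (\<forall>U. submod n V U \<longrightarrow> U = {\<lambda>_. 0} \<or> U = vecs (bas V))"
  unfolding irreducible_mod_def submod_def by (rule refl)

text \<open>The twist by the Chevalley involution (up to signs).\<close>
definition mswap :: "'b smod \<Rightarrow> 'b smod" where
  "mswap V = \<lparr> bas = bas V, xop = yop V, yop = xop V, hop = (\<lambda>i a b. - hop V i a b) \<rparr>"

lemma mswap_mswap: "mswap (mswap V) = V"
  by (simp add: mswap_def)

text \<open>Exchanging x and y permutes the closure conditions, and the sign of h is absorbed by
  scaling, so both modules have the same submodules. The dual module has no such direct comparison,
  which is the reason for introducing \<open>mswap\<close>.\<close>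

lemma irreducible_mswap: "irreducible_mod n (mswap V) \<longleftrightarrow> irreducible_mod n V"
proof -
  have sub: "submod n (mswap V) U" if U: "submod n V U" for V :: "'a smod" and U
  proof -
    have "mact (\<lambda>a b. - hop V i a b) (bas V) u = (\<lambda>b. -1 * mact (hop V i) (bas V) u b)" for i u
      by (auto simp: mact_def sum_negf)
    moreover have "(\<lambda>b. -1 * mact (hop V i) (bas V) u b) \<in> U" if "i \<in> {1..n - 1}" "u \<in> U" for i u
      using U that unfolding submod_def by blast
    ultimately show ?thesis using U by (simp add: submod_def mswap_def)
  qed
  have "submod n (mswap V) U \<longleftrightarrow> submod n V U" for U
    using sub[of V U] sub[of "mswap V" U] by (auto simp: mswap_mswap)
  then show ?thesis unfolding irreducible_mod_submod by (simp add: mswap_def)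
qed

lemma irreducible_msig: "irreducible_mod n (msig n V) \<longleftrightarrow> irreducible_mod n V"
proof -
  have "submod n (msig n V) U \<longleftrightarrow> submod n V U" for U
    unfolding submod_def msig_def smod.simps
      ball_color_flip[of n "\<lambda>i. \<forall>u\<in>U. mact (xop V i) (bas V) u \<in> U \<and> mact (yop V i) (bas V) u \<in> U
              \<and> mact (hop V i) (bas V) u \<in> U"] ..
  then show ?thesis unfolding irreducible_mod_submod by (simp add: msig_def)
qed

section \<open>Column patterns\<close>

text \<open>Steps of 0 or 1 from level to level express that columns are strict; weak decrease in
  \<open>c\<close> expresses that rows increase weakly. The value 0 outside makes equality of
  patterns equality of functions.\<close>

definition colpat :: "nat \<Rightarrow> int set \<Rightarrow> (int \<Rightarrow> int) \<Rightarrow> (int \<Rightarrow> int) \<Rightarrow> (nat \<Rightarrow> int \<Rightarrow> int) set" where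
  "colpat n C a b = {h. (\<forall>i c. n < i \<or> c \<notin> C \<longrightarrow> h i c = 0) \<and>
    (\<forall>c\<in>C. h 0 c = a c \<and> h n c = b c) \<and>
    (\<forall>c\<in>C. \<forall>i<n. h i c \<le> h (Suc i) c \<and> h (Suc i) c \<le> h i c + 1) \<and>
    (\<forall>i\<le>n. \<forall>c\<in>C. \<forall>c'\<in>C. c < c' \<longrightarrow> h i c' \<le> h i c)}"

definition bump :: "nat \<Rightarrow> int \<Rightarrow> (nat \<Rightarrow> int \<Rightarrow> int) \<Rightarrow> nat \<Rightarrow> int \<Rightarrow> int" where
  "bump i c h = (\<lambda>j d. if j = i \<and> d = c then h j d + 1 else h j d)"

text \<open>A presentation of a labelled graph by patterns. The vertices stay abstract, so that the
  same presentation can be given to fillings of a transformed shape and to the vertices of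
  \<open>L\<close> under a poset operation.\<close>

definition cpgraph :: "nat \<Rightarrow> int set \<Rightarrow> (int \<Rightarrow> int) \<Rightarrow> (int \<Rightarrow> int) \<Rightarrow> 'v set \<Rightarrow> ('v \<times> nat \<times> 'v) set
    \<Rightarrow> ('v \<Rightarrow> nat \<Rightarrow> int \<Rightarrow> int) \<Rightarrow> bool" where
  "cpgraph n C a b I E h \<longleftrightarrow> finite C \<and> bij_betw h I (colpat n C a b) \<and>
    E = {(s, i, t). s \<in> I \<and> t \<in> I \<and> 1 \<le> i \<and> i < n \<and> (\<exists>c\<in>C. h t = bump i c (h s))}"

lemma cpgraph_mem: "cpgraph n C a b I E h \<Longrightarrow> s \<in> I \<Longrightarrow> h s \<in> colpat n C a b"
  by (auto simp: cpgraph_def bij_betw_def)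

lemma cpgraph_inj: "cpgraph n C a b I E h \<Longrightarrow> s \<in> I \<Longrightarrow> t \<in> I \<Longrightarrow> h s = h t \<Longrightarrow> s = t"
  by (auto simp: cpgraph_def bij_betw_def inj_on_def)

lemma cpgraph_edges: "cpgraph n C a b I E h \<Longrightarrow> E \<subseteq> I \<times> {1..n - 1} \<times> I"
  by (auto simp: cpgraph_def)

lemma cpgraph_edge_iff: "cpgraph n C a b I E h \<Longrightarrow> (s, i, t) \<in> E \<longleftrightarrow>
    s \<in> I \<and> t \<in> I \<and> 1 \<le> i \<and> i < n \<and> (\<exists>c\<in>C. h t = bump i c (h s))"
  by (simp add: cpgraph_def)

lemma cpgraph_surj:
  assumes "cpgraph n C a b I E h" "x \<in> colpat n C a b"
  shows "\<exists>t\<in>I. h t = x"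
proof -
  have "h ` I = colpat n C a b" using assms(1) by (simp add: cpgraph_def bij_betw_def)
  with assms(2) have "x \<in> h ` I" by simp
  then show ?thesis by (rule imageE) blast
qed

lemma cpgraph_bump_up:
  assumes g: "cpgraph n C a b I E h" and s: "s \<in> I" and i: "1 \<le> i" "i < n" and c: "c \<in> C"
    and b: "bump i c (h s) \<in> colpat n C a b"
  shows "\<exists>t. (s, i, t) \<in> E"
proof -
  obtain t where "t \<in> I" "h t = bump i c (h s)"
    using cpgraph_surj[OF g b] by blast
  then show ?thesis using cpgraph_edge_iff[OF g] s i c by blast
qed

lemma colpat_mono:
  assumes h: "h \<in> colpat n C a b" and c: "c \<in> C" and ij: "i \<le> j" "j \<le> n"
  shows "h i c \<le> h j c \<and> h j c \<le> h i c + int (j - i)"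
  using ij
proof (induction j rule: dec_induct)
  case (step j)
  then have "j < n" by simp
  then have "h j c \<le> h (Suc j) c \<and> h (Suc j) c \<le> h j c + 1" using h c by (auto simp: colpat_def)
  then show ?case using step by (simp add: Suc_diff_le)
qed simp

lemma colpat_anti: "h \<in> colpat n C a b \<Longrightarrow> i \<le> n \<Longrightarrow> c \<in> C \<Longrightarrow> c' \<in> C \<Longrightarrow> c \<le> c' \<Longrightarrow> h i c' \<le> h i c"
  by (cases "c = c'") (auto simp: colpat_def)

lemma colpatI:
  assumes "\<And>i c. n < i \<or> c \<notin> C \<Longrightarrow> h i c = 0"
    "\<And>c. c \<in> C \<Longrightarrow> h 0 c = a c" "\<And>c. c \<in> C \<Longrightarrow> h n c = b c"
    "\<And>i c. c \<in> C \<Longrightarrow> i < n \<Longrightarrow> h i c \<le> h (Suc i) c"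
    "\<And>i c. c \<in> C \<Longrightarrow> i < n \<Longrightarrow> h (Suc i) c \<le> h i c + 1"
    "\<And>i c c'. i \<le> n \<Longrightarrow> c \<in> C \<Longrightarrow> c' \<in> C \<Longrightarrow> c < c' \<Longrightarrow> h i c' \<le> h i c"
  shows "h \<in> colpat n C a b"
  using assms unfolding colpat_def by blast

text \<open>Raising one entry disturbs only the comparisons with its two neighbouring levels and
  with the columns to its left; the last three hypotheses are these comparisons.\<close>

lemma bump_colpat:
  assumes h: "h \<in> colpat n C a b" and i: "1 \<le> i" "i < n" and c: "c \<in> C"
    and up: "h (i + 1) c = h i c + 1" and lo: "h (i - 1) c = h i c"
    and anti: "\<And>d. d \<in> C \<Longrightarrow> d < c \<Longrightarrow> h i c < h i d"
  shows "bump i c h \<in> colpat n C a b"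
proof (rule colpatI)
  fix j d assume a: "d \<in> C" "j < n"
  have "h j d \<le> h (Suc j) d \<and> h (Suc j) d \<le> h j d + 1" using h a by (auto simp: colpat_def)
  then show "bump i c h j d \<le> bump i c h (Suc j) d" "bump i c h (Suc j) d \<le> bump i c h j d + 1"
    using up lo i by (auto simp: bump_def)
next
  fix j d d' assume a: "j \<le> n" "d \<in> C" "d' \<in> C" "d < d'"
  then have "h j d' \<le> h j d" using h by (auto simp: colpat_def)
  then show "bump i c h j d' \<le> bump i c h j d" using anti a by (force simp: bump_def)
next
  fix j d assume "n < j \<or> d \<notin> C"
  then show "bump i c h j d = 0" using h c i by (auto simp: bump_def colpat_def)
qed (use h i in \<open>auto simp: bump_def colpat_def\<close>)

lemma unbump_colpat:
  assumes h: "h \<in> colpat n C a b" and i: "1 \<le> i" "i < n" and c: "c \<in> C"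
    and up: "h (i + 1) c = h i c" and lo: "h i c = h (i - 1) c + 1"
    and anti: "\<And>d. d \<in> C \<Longrightarrow> c < d \<Longrightarrow> h i d < h i c"
  shows "h(i := (h i)(c := h i c - 1)) \<in> colpat n C a b" (is "?h \<in> _")
proof (rule colpatI)
  fix j d assume a: "d \<in> C" "j < n"
  have "h j d \<le> h (Suc j) d \<and> h (Suc j) d \<le> h j d + 1" using h a by (auto simp: colpat_def)
  then show "?h j d \<le> ?h (Suc j) d" "?h (Suc j) d \<le> ?h j d + 1"
    using up lo i by auto
next
  fix j d d' assume a: "j \<le> n" "d \<in> C" "d' \<in> C" "d < d'"
  then have "h j d' \<le> h j d" using h by (auto simp: colpat_def)
  then show "?h j d' \<le> ?h j d" using anti a by force
next
  fix j d assume "n < j \<or> d \<notin> C"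
  then show "?h j d = 0" using h c i by (auto simp: colpat_def)
qed (use h i in \<open>auto simp: colpat_def\<close>)

lemma cpgraph_bump_down:
  assumes g: "cpgraph n C a b I E h" and s: "s \<in> I" and i: "1 \<le> i" "i < n" and c: "c \<in> C"
    and b: "(h s)(i := (h s i)(c := h s i c - 1)) \<in> colpat n C a b"
  shows "\<exists>t. (t, i, s) \<in> E"
proof -
  obtain t where "t \<in> I" "h t = (h s)(i := (h s i)(c := h s i c - 1))"
    using cpgraph_surj[OF g b] by blast
  moreover from this have "h s = bump i c (h t)" by (auto simp: bump_def fun_eq_iff)
  ultimately show ?thesis using cpgraph_edge_iff[OF g] s i c by blast
qed

lemma cpgraph_map:
  assumes g: "cpgraph n C a b I E h" and fin: "finite C'"
    and m: "\<And>x. x \<in> colpat n C a b \<Longrightarrow> \<Phi> x \<in> colpat n C' a' b' \<and> \<Psi> (\<Phi> x) = x"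
    and m': "\<And>x. x \<in> colpat n C' a' b' \<Longrightarrow> \<Psi> x \<in> colpat n C a b \<and> \<Phi> (\<Psi> x) = x"
  shows "cpgraph n C' a' b' I {(s, i, t). s \<in> I \<and> t \<in> I \<and> 1 \<le> i \<and> i < n \<and>
      (\<exists>c\<in>C'. \<Phi> (h t) = bump i c (\<Phi> (h s)))} (\<lambda>s. \<Phi> (h s))"
proof -
  have "bij_betw \<Phi> (colpat n C a b) (colpat n C' a' b')"
    by (rule bij_betw_byWitness[where f' = \<Psi>]) (use m m' in auto)
  with g have "bij_betw (\<Phi> \<circ> h) I (colpat n C' a' b')"
    unfolding cpgraph_def by (blast intro: bij_betw_trans)
  then show ?thesis unfolding cpgraph_def using fin by (simp add: o_def)
qed

text \<open>The complementary column holds n + 1 - x for each x in 1..n missing from the given one.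
  Counting those at most i turns the old height at level n - i into that height plus i. The
  bijection keeps the direction of edges and reverses colors.\<close>

lemma cpgraph_sig:
  assumes g: "cpgraph n C a b I E h"
  defines "\<Phi> \<equiv> (\<lambda>x i c. if i \<le> n \<and> c \<in> C then x (n - i) c + int i else (0::int))"
  shows "cpgraph n C b (\<lambda>c. a c + int n) I {(s, n - i, t) | s i t. (s, i, t) \<in> E} (\<lambda>s. \<Phi> (h s))"
proof -
  define \<Psi> where "\<Psi> = (\<lambda>x i c. if i \<le> n \<and> c \<in> C then x (n - i) c - int (n - i) else (0::int))"
  have fC: "finite C" using g by (simp add: cpgraph_def)
  have a: "\<Phi> x \<in> colpat n C b (\<lambda>c. a c + int n)" if x: "x \<in> colpat n C a b" for x
  proof (rule colpatI)
    fix i c assume c: "c \<in> C" "i < n"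
    then have "x (n - Suc i) c \<le> x (Suc (n - Suc i)) c" "x (Suc (n - Suc i)) c \<le> x (n - Suc i) c + 1"
      using x by (auto simp: colpat_def)
    moreover have "Suc (n - Suc i) = n - i" using c by simp
    ultimately show "\<Phi> x i c \<le> \<Phi> x (Suc i) c" "\<Phi> x (Suc i) c \<le> \<Phi> x i c + 1"
      using c by (simp_all add: \<Phi>_def)
  qed (use x in \<open>auto simp: \<Phi>_def colpat_def\<close>)
  have a': "\<Psi> x \<in> colpat n C a b" if x: "x \<in> colpat n C b (\<lambda>c. a c + int n)" for x
  proof (rule colpatI)
    fix i c assume c: "c \<in> C" "i < n"
    then have "x (n - Suc i) c \<le> x (Suc (n - Suc i)) c" "x (Suc (n - Suc i)) c \<le> x (n - Suc i) c + 1"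
      using x by (auto simp: colpat_def)
    moreover have "Suc (n - Suc i) = n - i" using c by simp
    ultimately show "\<Psi> x i c \<le> \<Psi> x (Suc i) c" "\<Psi> x (Suc i) c \<le> \<Psi> x i c + 1"
      using c by (simp_all add: \<Psi>_def)
  qed (use x in \<open>auto simp: \<Psi>_def colpat_def\<close>)
  have "\<Psi> (\<Phi> x) = x" if "x \<in> colpat n C a b" for x
    using that by (auto simp: fun_eq_iff \<Psi>_def \<Phi>_def colpat_def)
  moreover have "\<Phi> (\<Psi> x) = x" if "x \<in> colpat n C b (\<lambda>c. a c + int n)" for x
    using that by (auto simp: fun_eq_iff \<Psi>_def \<Phi>_def colpat_def)
  ultimately have *: "cpgraph n C b (\<lambda>c. a c + int n) I {(s, i, t). s \<in> I \<and> t \<in> I \<and> 1 \<le> i \<and> i < n \<and>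
      (\<exists>c\<in>C. \<Phi> (h t) = bump i c (\<Phi> (h s)))} (\<lambda>s. \<Phi> (h s))"
    using a a' by (intro cpgraph_map[OF g fC, where \<Psi> = \<Psi>]) auto
  have eq: "\<Phi> x = bump (n - i) c (\<Phi> y) \<longleftrightarrow> x = bump i c y"
    if x: "x \<in> colpat n C a b" "y \<in> colpat n C a b" and i: "1 \<le> i" "i < n" and c: "c \<in> C" for x y i c
  proof
    assume e: "\<Phi> x = bump (n - i) c (\<Phi> y)"
    show "x = bump i c y"
    proof (intro ext)
      fix j d
      show "x j d = bump i c y j d"
      proof (cases "j \<le> n \<and> d \<in> C")
        case True
        then show ?thesis using fun_cong[OF fun_cong[OF e, of "n - j"], of d] i
          by (auto simp: \<Phi>_def bump_def split: if_splits)
      next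
        case False
        then show ?thesis using x c i by (auto simp: bump_def colpat_def)
      qed
    qed
  next
    assume "x = bump i c y"
    then show "\<Phi> x = bump (n - i) c (\<Phi> y)" using i c by (auto simp: \<Phi>_def bump_def fun_eq_iff)
  qed
  have "{(s, i, t). s \<in> I \<and> t \<in> I \<and> 1 \<le> i \<and> i < n \<and> (\<exists>c\<in>C. \<Phi> (h t) = bump i c (\<Phi> (h s)))}
     = {(s, n - i, t) | s i t. (s, i, t) \<in> E}" (is "?A = ?B")
  proof
    show "?B \<subseteq> ?A"
    proof clarify
      fix s i t assume "(s, i, t) \<in> E"
      then obtain c where m: "s \<in> I" "t \<in> I" "1 \<le> i" "i < n" and c: "c \<in> C" "h t = bump i c (h s)"
        using cpgraph_edge_iff[OF g] by blast
      then have "\<Phi> (h t) = bump (n - i) c (\<Phi> (h s))" using eq cpgraph_mem[OF g] by blast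
      then show "s \<in> I \<and> t \<in> I \<and> 1 \<le> n - i \<and> n - i < n \<and> (\<exists>c\<in>C. \<Phi> (h t) = bump (n - i) c (\<Phi> (h s)))"
        using m c by auto
    qed
    show "?A \<subseteq> ?B"
    proof clarify
      fix s i t c assume m: "s \<in> I" "t \<in> I" "1 \<le> i" "i < n" and c: "c \<in> C" "\<Phi> (h t) = bump i c (\<Phi> (h s))"
      have "h t = bump (n - i) c (h s)"
        using eq[of "h t" "h s" "n - i" c] m c cpgraph_mem[OF g] by simp
      then have "(s, n - i, t) \<in> E" using cpgraph_edge_iff[OF g, of s "n - i" t] m c by auto
      then show "\<exists>s' i' t'. (s, i, t) = (s', n - i', t') \<and> (s', i', t') \<in> E"
        using m by (intro exI[of _ s] exI[of _ "n - i"] exI[of _ t]) simp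
    qed
  qed
  with * show ?thesis by simp
qed

text \<open>Rotation puts n + 1 - x in place of x. The new entries at most i are the old ones above
  n - i, in rows \<open>h (n - i) c + 1\<close> to \<open>b c\<close>; negated, the last of these
  rows is \<open>- h (n - i) c - 1\<close>. The same shift by 1 turns the half-open column {a<..b}
  into {-b-1<..-a-1}.\<close>

lemma colpat_rotate:
  assumes x: "x \<in> colpat n C a b"
  shows "(\<lambda>i c. if i \<le> n \<and> - c \<in> C then - x (n - i) (- c) - 1 else 0)
    \<in> colpat n (uminus ` C) (\<lambda>c. - b (- c) - 1) (\<lambda>c. - a (- c) - 1)" (is "?\<Phi> \<in> _")
proof -
  have mC: "c \<in> uminus ` C \<longleftrightarrow> - c \<in> C" for c by force
  show ?thesis
  proof (rule colpatI, unfold mC)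
    fix i c assume c: "- c \<in> C" "i < n"
    then have "x (n - Suc i) (- c) \<le> x (Suc (n - Suc i)) (- c)"
      "x (Suc (n - Suc i)) (- c) \<le> x (n - Suc i) (- c) + 1"
      using x by (auto simp: colpat_def)
    moreover have "Suc (n - Suc i) = n - i" using c by simp
    ultimately show "?\<Phi> i c \<le> ?\<Phi> (Suc i) c" "?\<Phi> (Suc i) c \<le> ?\<Phi> i c + 1"
      using c by simp_all
  next
    fix i c c' assume "i \<le> n" "- c \<in> C" "- c' \<in> C" "c < c'"
    then show "?\<Phi> i c' \<le> ?\<Phi> i c" using colpat_anti[OF x, of "n - i" "- c'" "- c"] by simp
  qed (use x in \<open>auto simp: colpat_def\<close>)
qed

lemma cpgraph_bow:
  assumes g: "cpgraph n C a b I E h"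
  defines "\<Phi> \<equiv> (\<lambda>x i c. if i \<le> n \<and> - c \<in> C then - x (n - i) (- c) - 1 else (0::int))"
  shows "cpgraph n (uminus ` C) (\<lambda>c. - b (- c) - 1) (\<lambda>c. - a (- c) - 1) I
    {(t, n - i, s) | s i t. (s, i, t) \<in> E} (\<lambda>s. \<Phi> (h s))" (is "cpgraph n ?C ?a ?b I _ _")
proof -
  define \<Psi> where "\<Psi> = (\<lambda>x i c. if i \<le> n \<and> c \<in> C then - x (n - i) (- c) - 1 else (0::int))"
  have fC: "finite ?C" using g by (simp add: cpgraph_def)
  have mC: "c \<in> ?C \<longleftrightarrow> - c \<in> C" for c by force
  have a: "\<Phi> x \<in> colpat n ?C ?a ?b" if "x \<in> colpat n C a b" for x
    unfolding \<Phi>_def by (rule colpat_rotate[OF that])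
  \<comment> \<open>Rotating twice restores the column set, so \<open>colpat_rotate\<close> also
    covers the inverse map.\<close>
  have "uminus ` ?C = C" by (simp add: image_image)
  then have a': "\<Psi> x \<in> colpat n C a b" if "x \<in> colpat n ?C ?a ?b" for x
    using colpat_rotate[OF that] by (simp add: \<Psi>_def mC)
  have "\<Psi> (\<Phi> x) = x" if "x \<in> colpat n C a b" for x
    using that by (auto simp: fun_eq_iff \<Psi>_def \<Phi>_def colpat_def)
  moreover have "\<Phi> (\<Psi> x) = x" if "x \<in> colpat n ?C ?a ?b" for x
    using that unfolding colpat_def mC by (auto simp: fun_eq_iff \<Psi>_def \<Phi>_def)
  ultimately have *: "cpgraph n ?C ?a ?b I {(s, i, t). s \<in> I \<and> t \<in> I \<and> 1 \<le> i \<and> i < n \<and>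
      (\<exists>c\<in>?C. \<Phi> (h t) = bump i c (\<Phi> (h s)))} (\<lambda>s. \<Phi> (h s))"
    using a a' by (intro cpgraph_map[OF g fC, where \<Psi> = \<Psi>]) auto
  have eq: "\<Phi> y = bump (n - i) (- c) (\<Phi> x) \<longleftrightarrow> x = bump i c y"
    if x: "x \<in> colpat n C a b" "y \<in> colpat n C a b" and i: "1 \<le> i" "i < n" and c: "c \<in> C" for x y i c
  proof
    assume e: "\<Phi> y = bump (n - i) (- c) (\<Phi> x)"
    show "x = bump i c y"
    proof (intro ext)
      fix j d
      show "x j d = bump i c y j d"
      proof (cases "j \<le> n \<and> d \<in> C")
        case True
        then show ?thesis using fun_cong[OF fun_cong[OF e, of "n - j"], of "- d"] i
          by (auto simp: \<Phi>_def bump_def split: if_splits)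
      next
        case False
        then show ?thesis using x c i by (auto simp: bump_def colpat_def)
      qed
    qed
  next
    assume "x = bump i c y"
    then show "\<Phi> y = bump (n - i) (- c) (\<Phi> x)" using i c by (auto simp: \<Phi>_def bump_def fun_eq_iff)
  qed
  have "{(s, i, t). s \<in> I \<and> t \<in> I \<and> 1 \<le> i \<and> i < n \<and> (\<exists>c\<in>?C. \<Phi> (h t) = bump i c (\<Phi> (h s)))}
     = {(t, n - i, s) | s i t. (s, i, t) \<in> E}" (is "?A = ?B")
  proof
    show "?B \<subseteq> ?A"
    proof clarify
      fix s i t assume "(s, i, t) \<in> E"
      then obtain c where m: "s \<in> I" "t \<in> I" "1 \<le> i" "i < n" and c: "c \<in> C" "h t = bump i c (h s)"
        using cpgraph_edge_iff[OF g] by blast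
      then have "\<Phi> (h s) = bump (n - i) (- c) (\<Phi> (h t))" using eq cpgraph_mem[OF g] by blast
      then show "t \<in> I \<and> s \<in> I \<and> 1 \<le> n - i \<and> n - i < n \<and> (\<exists>c\<in>?C. \<Phi> (h s) = bump (n - i) c (\<Phi> (h t)))"
        using m c by auto
    qed
    show "?A \<subseteq> ?B"
    proof clarify
      fix s i t c assume m: "s \<in> I" "t \<in> I" "1 \<le> i" "i < n" and c: "c \<in> C" "\<Phi> (h t) = bump i (- c) (\<Phi> (h s))"
      have "h s = bump (n - i) c (h t)"
        using eq[of "h s" "h t" "n - i" c] m c cpgraph_mem[OF g] by simp
      then have "(t, n - i, s) \<in> E" using cpgraph_edge_iff[OF g, of t "n - i" s] m c by auto
      then show "\<exists>s' i' t'. (s, i, t) = (t', n - i', s') \<and> (s', i', t') \<in> E"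
        using m by (intro exI[of _ t] exI[of _ "n - i"] exI[of _ s]) simp
    qed
  qed
  with * show ?thesis by simp
qed

text \<open>The data \<open>C\<close>, \<open>a\<close>, \<open>b\<close> determine the labelled
  graph. This is how a poset operation on \<open>L\<close> is matched with the corresponding
  operation on the shape.\<close>

lemma cpgraph_iso:
  assumes g: "cpgraph n C a b I E h" and g': "cpgraph n C a b J F k"
  shows "\<exists>\<phi>. bij_betw \<phi> I J \<and> (\<lambda>(s, i, t). (\<phi> s, i, \<phi> t)) ` E = F \<and> (\<forall>s\<in>I. k (\<phi> s) = h s)"
proof -
  define \<phi> where "\<phi> = the_inv_into J k \<circ> h"
  have k: "bij_betw k J (colpat n C a b)" using g' by (simp add: cpgraph_def)
  have h: "bij_betw h I (colpat n C a b)" using g by (simp add: cpgraph_def)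
  have bij: "bij_betw \<phi> I J" unfolding \<phi>_def
    by (rule bij_betw_trans[OF h bij_betw_the_inv_into[OF k]])
  have e: "k (\<phi> s) = h s" if "s \<in> I" for s
    using k cpgraph_mem[OF g that] by (auto simp: \<phi>_def bij_betw_def f_the_inv_into_f)
  have "(\<lambda>(s, i, t). (\<phi> s, i, \<phi> t)) ` E = F" (is "?A = F")
  proof
    show "?A \<subseteq> F" using bij e
      by (auto simp: cpgraph_edge_iff[OF g] cpgraph_edge_iff[OF g'] bij_betw_def)
    show "F \<subseteq> ?A"
    proof clarify
      fix s i t assume F: "(s, i, t) \<in> F"
      then have "s \<in> J" "t \<in> J" using cpgraph_edge_iff[OF g'] by blast+
      then obtain s' t' where st: "s = \<phi> s'" "t = \<phi> t'" "s' \<in> I" "t' \<in> I"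
        using bij by (auto simp: bij_betw_def)
      have "(s', i, t') \<in> E" using F st e cpgraph_edge_iff[OF g] cpgraph_edge_iff[OF g'] by auto
      then show "(s, i, t) \<in> ?A" using st by (intro image_eqI[of _ _ "(s', i, t')"]) auto
    qed
  qed
  then show ?thesis using bij e by blast
qed

text \<open>Allows one graph to be re-presented with other columns: in the Young case empty columns
  must be dropped without changing the vertex set.\<close>

lemma cpgraph_transport:
  assumes g: "cpgraph n C a b J F k" and bij: "bij_betw \<phi> I J"
    and E: "(\<lambda>(s, i, t). (\<phi> s, i, \<phi> t)) ` E = F" and EI: "E \<subseteq> I \<times> UNIV \<times> I"
  shows "cpgraph n C a b I E (k \<circ> \<phi>)"
proof -
  have k: "bij_betw k J (colpat n C a b)" using g by (simp add: cpgraph_def)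
  have inj: "\<phi> s = \<phi> s' \<longleftrightarrow> s = s'" if "s \<in> I" "s' \<in> I" for s s'
    using bij that by (auto simp: bij_betw_def inj_on_def)
  have m: "\<phi> s \<in> J" if "s \<in> I" for s using bij that by (auto simp: bij_betw_def)
  have "(s, i, t) \<in> E \<longleftrightarrow> s \<in> I \<and> t \<in> I \<and> 1 \<le> i \<and> i < n \<and> (\<exists>c\<in>C. k (\<phi> t) = bump i c (k (\<phi> s)))" for s i t
  proof (cases "s \<in> I \<and> t \<in> I")
    case True
    have "(s, i, t) \<in> E \<longleftrightarrow> (\<phi> s, i, \<phi> t) \<in> F"
    proof
      assume "(s, i, t) \<in> E" then show "(\<phi> s, i, \<phi> t) \<in> F" unfolding E[symmetric] by force
    next
      assume "(\<phi> s, i, \<phi> t) \<in> F"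
      then obtain s' t' where "(s', i, t') \<in> E" "\<phi> s' = \<phi> s" "\<phi> t' = \<phi> t" unfolding E[symmetric] by force
      then show "(s, i, t) \<in> E" using inj True EI by blast
    qed
    then show ?thesis using True m cpgraph_edge_iff[OF g] by blast
  qed (use EI in blast)
  then have "E = {(s, i, t). s \<in> I \<and> t \<in> I \<and> 1 \<le> i \<and> i < n \<and> (\<exists>c\<in>C. (k \<circ> \<phi>) t = bump i c ((k \<circ> \<phi>) s))}"
    by auto
  then show ?thesis using g bij_betw_trans[OF bij k] by (simp add: cpgraph_def)
qed

section \<open>Fillings encoded as column patterns\<close>

lemma int_initial_segment:
  fixes a b :: int and X :: "int set"
  assumes "X \<subseteq> {a<..b}" "\<And>x y. x \<in> X \<Longrightarrow> a < y \<Longrightarrow> y \<le> x \<Longrightarrow> y \<in> X"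
  shows "X = {a<..a + int (card X)}"
proof (cases "X = {}")
  case False
  have fin: "finite X" using assms(1) finite_subset by blast
  have "X = {a<..Max X}"
  proof
    show "X \<subseteq> {a<..Max X}" using assms(1) fin by auto
    show "{a<..Max X} \<subseteq> X" using assms(2)[OF Max_in[OF fin False]] by auto
  qed
  moreover from this have "card X = nat (Max X - a)" by (metis card_greaterThanAtMost_int)
  moreover have "a < Max X" using assms(1) Max_in[OF fin False] by auto
  ultimately show ?thesis by simp
qed simp

definition column_shape :: "int set \<Rightarrow> (int \<Rightarrow> int) \<Rightarrow> (int \<Rightarrow> int) \<Rightarrow> cell set \<Rightarrow> bool" where
  "column_shape C a b D \<longleftrightarrow> finite C \<and> D = {(r, c). c \<in> C \<and> a c < r \<and> r \<le> b c} \<and>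
    (\<forall>c\<in>C. a c \<le> b c) \<and>
    (\<forall>c\<in>C. \<forall>c'\<in>C. c < c' \<longrightarrow> a c' \<le> a c \<and> b c' \<le> b c)"

definition hcol :: "nat \<Rightarrow> int set \<Rightarrow> (int \<Rightarrow> int) \<Rightarrow> cell set \<Rightarrow> filling \<Rightarrow> nat \<Rightarrow> int \<Rightarrow> int" where
  "hcol n C a D T i c = (if i \<le> n \<and> c \<in> C then a c + int (card {r. (r, c) \<in> D \<and> T (r, c) \<le> i}) else 0)"

lemma hcol_segment:
  assumes sh: "column_shape C a b D" and T: "T \<in> lsk_verts n D" and c: "c \<in> C" and i: "i \<le> n"
  shows "{r. (r, c) \<in> D \<and> T (r, c) \<le> i} = {a c<..hcol n C a D T i c}"
proof -
  let ?X = "{r. (r, c) \<in> D \<and> T (r, c) \<le> i}"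
  have "?X = {a c<..a c + int (card ?X)}"
  proof (rule int_initial_segment[where b = "b c"])
    show "?X \<subseteq> {a c<..b c}" using sh by (auto simp: column_shape_def)
    fix x y assume x: "x \<in> ?X" and y: "a c < y" "y \<le> x"
    have "(y, c) \<in> D" using x y sh by (auto simp: column_shape_def)
    moreover have "T (y, c) \<le> T (x, c)"
      using calculation T x y unfolding lsk_verts_def by (cases "x = y") (auto intro: less_imp_le)
    ultimately show "y \<in> ?X" using x by simp
  qed
  then show ?thesis using c i by (simp add: hcol_def)
qed

lemma hcol_bounds:
  assumes sh: "column_shape C a b D" and T: "T \<in> lsk_verts n D" and c: "c \<in> C" and i: "i \<le> n"
  shows "a c \<le> hcol n C a D T i c" "hcol n C a D T i c \<le> b c"
proof -
  show 1: "a c \<le> hcol n C a D T i c" using c i by (simp add: hcol_def)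
  show "hcol n C a D T i c \<le> b c"
  proof (rule ccontr)
    assume a: "\<not> hcol n C a D T i c \<le> b c"
    then have "hcol n C a D T i c \<in> {a c<..hcol n C a D T i c}"
      using sh c by (force simp: column_shape_def)
    then have "(hcol n C a D T i c, c) \<in> D" unfolding hcol_segment[OF sh T c i, symmetric] by blast
    then show False using a sh by (auto simp: column_shape_def)
  qed
qed

text \<open>The dictionary in both directions: levels are read off from entries, and an entry is
  recovered as the least level whose height reaches its row.\<close>

lemma filling_le_iff:
  assumes sh: "column_shape C a b D" and T: "T \<in> lsk_verts n D" and p: "(r, c) \<in> D" and i: "i \<le> n"
  shows "T (r, c) \<le> i \<longleftrightarrow> r \<le> hcol n C a D T i c"
proof -
  have "c \<in> C" "a c < r" using sh p by (auto simp: column_shape_def)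
  then show ?thesis using hcol_segment[OF sh T _ i, of c] p by (auto simp: set_eq_iff)
qed

lemma filling_eqI:
  assumes "\<And>i. i \<le> n \<Longrightarrow> x \<le> i \<longleftrightarrow> y \<le> i" "x \<le> n" "y \<le> (n::nat)"
  shows "x = y"
  using assms(1)[OF assms(2)] assms(1)[OF assms(3)] by simp

lemma hcol_colpat:
  assumes sh: "column_shape C a b D" and T: "T \<in> lsk_verts n D"
  shows "hcol n C a D T \<in> colpat n C a b"
proof (rule colpatI)
  fix i c assume "n < i \<or> c \<notin> C" then show "hcol n C a D T i c = 0" by (auto simp: hcol_def)
next
  fix c assume c: "c \<in> C"
  have "{r. (r, c) \<in> D \<and> T (r, c) = 0} = {}" using T by (force simp: lsk_verts_def)
  then have "card {r. (r, c) \<in> D \<and> T (r, c) = 0} = 0" by (simp only: card.empty)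
  then show "hcol n C a D T 0 c = a c" using c by (simp add: hcol_def)
  have "{r. (r, c) \<in> D \<and> T (r, c) \<le> n} = {a c<..b c}"
    using T sh c by (auto simp: lsk_verts_def column_shape_def)
  moreover have "a c \<le> b c" using sh c by (auto simp: column_shape_def)
  ultimately show "hcol n C a D T n c = b c" using c by (simp add: hcol_def)
next
  fix i c assume c: "c \<in> C" and i: "i < n"
  let ?X = "\<lambda>i. {r. (r, c) \<in> D \<and> T (r, c) \<le> i}"
  have fin: "finite (?X j)" for j
    by (rule finite_subset[of _ "{a c<..b c}"]) (use sh in \<open>auto simp: column_shape_def\<close>)
  have "card (?X i) \<le> card (?X (Suc i))" by (rule card_mono[OF fin]) auto
  then show "hcol n C a D T i c \<le> hcol n C a D T (Suc i) c" using c i by (simp add: hcol_def)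
  show "hcol n C a D T (Suc i) c \<le> hcol n C a D T i c + 1"
  proof (rule ccontr)
    \<comment> \<open>If the height rose by two, the last two cells at level i + 1 would have
      strictly increasing entries, and the upper one would already count at level i.\<close>
    assume a: "\<not> ?thesis"
    define r where "r = hcol n C a D T (Suc i) c"
    have si: "Suc i \<le> n" "i \<le> n" using i by auto
    have "r \<in> {a c<..hcol n C a D T (Suc i) c}" "r - 1 \<in> {a c<..hcol n C a D T (Suc i) c}"
      using a hcol_bounds[OF sh T c si(2)] by (auto simp: r_def)
    then have 1: "(r, c) \<in> D" "T (r, c) \<le> Suc i" "(r - 1, c) \<in> D"
      unfolding hcol_segment[OF sh T c si(1), symmetric] by auto
    then have "T (r - 1, c) < T (r, c)" using T unfolding lsk_verts_def by auto
    then have "T (r - 1, c) \<le> i" using 1 by simp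
    then show False using filling_le_iff[OF sh T 1(3) si(2)] a by (simp add: r_def)
  qed
next
  fix i c c' assume i: "i \<le> n" and c: "c \<in> C" "c' \<in> C" "c < c'"
  show "hcol n C a D T i c' \<le> hcol n C a D T i c"
  proof (rule ccontr)
    assume a: "\<not> ?thesis"
    define r where "r = hcol n C a D T i c'"
    have ab: "a c' \<le> a c" "b c' \<le> b c" using sh c by (auto simp: column_shape_def)
    have "a c < r" "r \<le> b c'" using a hcol_bounds[OF sh T c(1) i] hcol_bounds[OF sh T c(2) i]
      by (auto simp: r_def)
    then have "a c' < r" "r \<le> b c" using ab by linarith+
    then have D: "(r, c) \<in> D" "(r, c') \<in> D"
      using sh c \<open>a c < r\<close> \<open>r \<le> b c'\<close> by (auto simp: column_shape_def)
    then have "T (r, c) \<le> T (r, c')" using T c unfolding lsk_verts_def by blast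
    moreover have "T (r, c') \<le> i" using filling_le_iff[OF sh T D(2) i] by (simp add: r_def)
    ultimately show False using filling_le_iff[OF sh T D(1) i] a by (simp add: r_def)
  qed
qed

lemma lsk_verts_outside: "T \<in> lsk_verts n D \<Longrightarrow> p \<notin> D \<Longrightarrow> T p = 0"
  unfolding lsk_verts_def by blast

lemma hcol_inj:
  assumes sh: "column_shape C a b D" and T: "T \<in> lsk_verts n D" "S \<in> lsk_verts n D"
    and e: "hcol n C a D T = hcol n C a D S"
  shows "T = S"
proof
  fix p :: cell
  obtain r c where p: "p = (r, c)" by force
  show "T p = S p"
  proof (cases "p \<in> D")
    case True
    show ?thesis unfolding p
      by (rule filling_eqI[of n])
        (use True p T e filling_le_iff[OF sh T(1), of r c] filling_le_iff[OF sh T(2), of r c] in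
          \<open>auto simp: lsk_verts_def\<close>)
  qed (use T lsk_verts_outside in metis)
qed

lemma hcol_surj:
  assumes sh: "column_shape C a b D" and h: "h \<in> colpat n C a b"
  shows "\<exists>T\<in>lsk_verts n D. hcol n C a D T = h"
proof -
  \<comment> \<open>The entry in row \<open>r\<close> is the first level whose height reaches
    \<open>r\<close>.\<close>
  define T :: filling where "T = (\<lambda>(r, c). if (r, c) \<in> D then LEAST i. r \<le> h i c else 0)"
  have D: "c \<in> C \<and> a c < r \<and> r \<le> b c" if "(r, c) \<in> D" for r c using sh that by (auto simp: column_shape_def)
  have hn: "h n c = b c" "h 0 c = a c" if "c \<in> C" for c using h that by (auto simp: colpat_def)
  have le: "T (r, c) \<le> i \<longleftrightarrow> r \<le> h i c" if p: "(r, c) \<in> D" and i: "i \<le> n" for r c i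
  proof
    have ex: "r \<le> h n c" using D[OF p] hn by simp
    assume "T (r, c) \<le> i"
    moreover have "r \<le> h (T (r, c)) c" using p LeastI[of "\<lambda>i. r \<le> h i c", OF ex] by (simp add: T_def)
    ultimately show "r \<le> h i c" using colpat_mono[OF h _ _ i, of c "T (r, c)"] D[OF p] by force
  next
    assume "r \<le> h i c" then show "T (r, c) \<le> i" using p by (simp add: T_def Least_le)
  qed
  have Tn: "T (r, c) \<le> n" if "(r, c) \<in> D" for r c using le[OF that, of n] D[OF that] hn by simp
  have T1: "1 \<le> T (r, c)" if "(r, c) \<in> D" for r c using le[OF that, of 0] D[OF that] hn by force
  have TV: "T \<in> lsk_verts n D" unfolding lsk_verts_def
  proof (intro CollectI conjI allI impI ballI)
    fix p assume "p \<notin> D" then show "T p = 0" by (auto simp: T_def split: prod.splits)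
  next
    fix p assume "p \<in> D"
    then show "1 \<le> T p" "T p \<le> n" using T1 Tn by (cases p; simp)+
  next
    fix r c c' assume p: "(r, c) \<in> D" "(r, c') \<in> D" and c: "c < c'"
    have "r \<le> h (T (r, c')) c'" using le[OF p(2) Tn[OF p(2)]] by simp
    also have "\<dots> \<le> h (T (r, c')) c" using colpat_anti[OF h Tn[OF p(2)]] D[OF p(1)] D[OF p(2)] c by simp
    finally show "T (r, c) \<le> T (r, c')" using le[OF p(1) Tn[OF p(2)]] by simp
  next
    fix r r' c assume p: "(r, c) \<in> D" "(r', c) \<in> D" and r: "r < r'"
    define i where "i = T (r', c)"
    have i: "1 \<le> i" "i \<le> n" using T1[OF p(2)] Tn[OF p(2)] by (simp_all add: i_def)
    have "r' \<le> h i c" using le[OF p(2) Tn[OF p(2)]] by (simp add: i_def)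
    moreover have "h i c \<le> h (i - 1) c + 1"
      using colpat_mono[OF h, of c "i - 1" i] D[OF p(1)] i by simp
    ultimately have "T (r, c) \<le> i - 1" using le[OF p(1), of "i - 1"] r i by simp
    then show "T (r, c) < T (r', c)" using i by (simp add: i_def)
  qed
  have "hcol n C a D T i c = h i c" for i c
  proof (cases "i \<le> n \<and> c \<in> C")
    case True
    then have m: "a c \<le> h i c" "h i c \<le> b c"
      using colpat_mono[OF h, of c 0 i] colpat_mono[OF h, of c i n] hn by force+
    have "{r. (r, c) \<in> D \<and> T (r, c) \<le> i} = {a c<..h i c}"
      using le True m sh by (auto simp: column_shape_def)
    then show ?thesis using True m by (simp add: hcol_def)
  next
    case False
    then show ?thesis using h by (auto simp: hcol_def colpat_def)
  qed
  then show ?thesis using TV by blast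
qed

text \<open>Along an edge one entry drops from i + 1 to i, so its cell joins the entries at most i
  and no other level notices. Conversely, raising level i in column c frees exactly one cell for
  this change.\<close>

lemma lsk_cpgraph:
  assumes sh: "column_shape C a b D"
  shows "cpgraph n C a b (lsk_verts n D) (lsk_edges n D) (hcol n C a D)"
proof -
  let ?h = "hcol n C a D"
  have fC: "finite C" using sh by (simp add: column_shape_def)
  have bij: "bij_betw ?h (lsk_verts n D) (colpat n C a b)"
    unfolding bij_betw_def inj_on_def using hcol_inj[OF sh] hcol_colpat[OF sh] hcol_surj[OF sh] by blast
  have fin: "finite {r. (r, c) \<in> D \<and> R r}" for R c
    by (rule finite_subset[of _ "{a c<..b c}"]) (use sh in \<open>auto simp: column_shape_def\<close>)
  have "(S, i, T) \<in> lsk_edges n D \<longleftrightarrow> S \<in> lsk_verts n D \<and> T \<in> lsk_verts n D \<and> 1 \<le> i \<and> i < n \<and>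
    (\<exists>c\<in>C. ?h T = bump i c (?h S))" for S i T
  proof
    assume "(S, i, T) \<in> lsk_edges n D"
    then obtain p where V: "S \<in> lsk_verts n D" "T \<in> lsk_verts n D" "p \<in> D" and
      Sp: "S p = T p + 1" and q: "\<And>q. q \<noteq> p \<Longrightarrow> S q = T q" and i: "i = T p"
      unfolding lsk_edges_def by blast
    obtain r c where p: "p = (r, c)" by force
    have "1 \<le> T p" "S p \<le> n" using V by (auto simp: lsk_verts_def)
    then have i': "1 \<le> i" "i < n" using i Sp by auto
    have c: "c \<in> C" using V(3) p sh by (auto simp: column_shape_def)
    have "?h T j d = bump i c (?h S) j d" for j d
    proof (cases "j = i \<and> d = c")
      case True
      have "{r'. (r', c) \<in> D \<and> T (r', c) \<le> i} = insert r {r'. (r', c) \<in> D \<and> S (r', c) \<le> i}"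
      proof -
        have "T (r', c) \<le> i \<longleftrightarrow> r' = r \<or> S (r', c) \<le> i" for r'
          using q[of "(r', c)"] Sp by (cases "r' = r") (auto simp: p i)
        then show ?thesis using V(3) p by auto
      qed
      moreover have "r \<notin> {r'. (r', c) \<in> D \<and> S (r', c) \<le> i}" using Sp p i by simp
      ultimately have "card {r'. (r', c) \<in> D \<and> T (r', c) \<le> i} = Suc (card {r'. (r', c) \<in> D \<and> S (r', c) \<le> i})"
        using fin by simp
      then show ?thesis using True i' c by (simp add: bump_def hcol_def)
    next
      case False
      have "{r'. (r', d) \<in> D \<and> T (r', d) \<le> j} = {r'. (r', d) \<in> D \<and> S (r', d) \<le> j}"
      proof -
        have "T (r', d) \<le> j \<longleftrightarrow> S (r', d) \<le> j" for r'
        proof (cases "(r', d) = p")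
          case True
          then have "j \<noteq> i" using False p by auto
          then show ?thesis using True Sp i by auto
        qed (use q in auto)
        then show ?thesis by simp
      qed
      then show ?thesis using False by (auto simp: bump_def hcol_def)
    qed
    then show "S \<in> lsk_verts n D \<and> T \<in> lsk_verts n D \<and> 1 \<le> i \<and> i < n \<and>
      (\<exists>c\<in>C. ?h T = bump i c (?h S))" using V i' c by blast
  next
    assume "S \<in> lsk_verts n D \<and> T \<in> lsk_verts n D \<and> 1 \<le> i \<and> i < n \<and> (\<exists>c\<in>C. ?h T = bump i c (?h S))"
    then obtain c where V: "S \<in> lsk_verts n D" "T \<in> lsk_verts n D" and i: "1 \<le> i" "i < n"
      and c: "c \<in> C" and e: "?h T = bump i c (?h S)" by blast
    \<comment> \<open>The last row of level i after raising is the row of the changed cell.\<close>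
    define r where "r = ?h T i c"
    have rS: "r = ?h S i c + 1" using e by (simp add: r_def bump_def)
    have p: "(r, c) \<in> D" using hcol_bounds[OF sh V(1) c, of i] hcol_bounds[OF sh V(2) c, of i] i rS c sh
      by (auto simp: column_shape_def r_def)
    have le: "j \<le> n \<Longrightarrow> q \<in> D \<Longrightarrow> (j = i \<longrightarrow> q \<noteq> (r, c)) \<Longrightarrow> T q \<le> j \<longleftrightarrow> S q \<le> j" for j q
    proof -
      assume j: "j \<le> n" and q: "q \<in> D" "j = i \<longrightarrow> q \<noteq> (r, c)"
      obtain r' d where rd: "q = (r', d)" by force
      show ?thesis using q e filling_le_iff[OF sh V(1) _ j, of r' d] filling_le_iff[OF sh V(2) _ j, of r' d] rS
        unfolding rd by (auto simp: bump_def)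
    qed
    have Ti: "T (r, c) \<le> i" using filling_le_iff[OF sh V(2) p, of i] i by (simp add: r_def)
    have Si: "\<not> S (r, c) \<le> i" using filling_le_iff[OF sh V(1) p, of i] i rS by simp
    \<comment> \<open>Levels i - 1 and i + 1 agree for \<open>S\<close> and \<open>T\<close>, which
      pins the two entries to i + 1 and i.\<close>
    have "S (r, c) \<le> Suc i" using le[of "Suc i" "(r, c)"] p i Ti by simp
    moreover have "\<not> T (r, c) \<le> i - 1" using le[of "i - 1" "(r, c)"] p i Si by simp
    ultimately have v: "S (r, c) = i + 1" "T (r, c) = i" using Ti Si by auto
    have "S q = T q" if "q \<noteq> (r, c)" for q
    proof (cases "q \<in> D")
      case True
      then show ?thesis using le[of _ q] that V
        by (intro filling_eqI[of n]) (auto simp: lsk_verts_def)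
    qed (use V lsk_verts_outside in metis)
    then show "(S, i, T) \<in> lsk_edges n D" unfolding lsk_edges_def using V p v by auto
  qed
  then have "lsk_edges n D = {(S, i, T). S \<in> lsk_verts n D \<and> T \<in> lsk_verts n D \<and> 1 \<le> i \<and> i < n \<and>
    (\<exists>c\<in>C. ?h T = bump i c (?h S))}" by auto
  then show ?thesis using fC bij unfolding cpgraph_def by simp
qed

lemma finite_lsk_verts:
  assumes "finite D"
  shows "finite (lsk_verts n D)"
proof (rule finite_subset)
  show "lsk_verts n D \<subseteq> {T. \<forall>p. (p \<in> D \<longrightarrow> T p \<in> {..n}) \<and> (p \<notin> D \<longrightarrow> T p = 0)}"
    by (auto simp: lsk_verts_def)
qed (rule finite_set_of_finite_funs[OF assms], simp)

lemma colpat_nonempty: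
  assumes "column_shape C a b D" "\<And>c. c \<in> C \<Longrightarrow> b c \<le> a c + int n"
  shows "colpat n C a b \<noteq> {}"
proof -
  \<comment> \<open>The pattern of the filling in which every column reads 1, 2, 3, ...
    downwards.\<close>
  have "(\<lambda>i c. if i \<le> n \<and> c \<in> C then min (b c) (a c + int i) else 0) \<in> colpat n C a b"
    by (rule colpatI) (use assms in \<open>force simp: column_shape_def\<close>)+
  then show ?thesis by blast
qed

section \<open>Weights of colored components\<close>

lemma ipath_single: "ipath E i [x]"
  by (simp add: ipath_def)

lemma ipath_Cons_iff: "ys \<noteq> [] \<Longrightarrow> ipath E i (x # ys) \<longleftrightarrow> (x, i, hd ys) \<in> E \<and> ipath E i ys"
  unfolding ipath_def
proof (intro iffI conjI; elim conjE)
  assume y: "ys \<noteq> []" and a: "\<forall>k. Suc k < length (x # ys) \<longrightarrow> ((x # ys) ! k, i, (x # ys) ! Suc k) \<in> E"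
  show "(x, i, hd ys) \<in> E" using a[rule_format, of 0] y by (simp add: hd_conv_nth)
  show "\<forall>k. Suc k < length ys \<longrightarrow> (ys ! k, i, ys ! Suc k) \<in> E" using a[rule_format, of "Suc _"] by simp
next
  assume y: "ys \<noteq> []" and a: "(x, i, hd ys) \<in> E" "\<forall>k. Suc k < length ys \<longrightarrow> (ys ! k, i, ys ! Suc k) \<in> E"
  show "\<forall>k. Suc k < length (x # ys) \<longrightarrow> ((x # ys) ! k, i, (x # ys) ! Suc k) \<in> E"
    using a y by (auto simp: nth_Cons hd_conv_nth split: nat.split)
qed auto

lemma ipath_snoc:
  assumes "ipath E i xs" "(last xs, i, y) \<in> E"
  shows "ipath E i (xs @ [y])"
  using assms
proof (induction xs)
  case (Cons x xs)
  then show ?case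
    by (cases "xs = []") (auto simp: ipath_Cons_iff ipath_single)
qed (simp add: ipath_def)

text \<open>Here \<open>lo\<close> and \<open>hi\<close> are invariants of the component and \<phi>
  climbs by one along each edge; \<open>up\<close> and \<open>down\<close> say that the extremes are
  attained. Ranks and lengths can then be computed without describing the component itself.\<close>

locale graded_color =
  fixes E :: "('v \<times> nat \<times> 'v) set" and i :: nat and I :: "'v set" and \<phi> lo hi :: "'v \<Rightarrow> int"
  assumes E_I: "(s, i, t) \<in> E \<Longrightarrow> s \<in> I \<and> t \<in> I"
    and grade: "(s, i, t) \<in> E \<Longrightarrow> \<phi> t = \<phi> s + 1 \<and> lo t = lo s \<and> hi t = hi s"
    and bounds: "s \<in> I \<Longrightarrow> lo s \<le> \<phi> s \<and> \<phi> s \<le> hi s"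
    and up: "s \<in> I \<Longrightarrow> \<phi> s < hi s \<Longrightarrow> \<exists>t. (s, i, t) \<in> E"
    and down: "s \<in> I \<Longrightarrow> lo s < \<phi> s \<Longrightarrow> \<exists>t. (t, i, s) \<in> E"
begin

lemma ipath_graded:
  "ipath E i xs \<Longrightarrow> \<phi> (last xs) = \<phi> (hd xs) + int (length xs) - 1 \<and> lo (last xs) = lo (hd xs) \<and>
    hi (last xs) = hi (hd xs) \<and> (hd xs \<in> I \<longleftrightarrow> last xs \<in> I)"
proof (induction xs)
  case (Cons x xs)
  show ?case
  proof (cases "xs = []")
    case False
    then have "(x, i, hd xs) \<in> E" "ipath E i xs" using ipath_Cons_iff[OF False, of E i x] Cons.prems by simp_all
    then show ?thesis using Cons.IH grade[of x "hd xs"] E_I[of x "hd xs"] False by auto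
  qed simp
qed (simp add: ipath_def)

lemma ipath_to:
  "t \<in> I \<Longrightarrow> \<exists>xs. ipath E i xs \<and> last xs = t \<and> \<phi> (hd xs) = lo t"
proof (induction "nat (\<phi> t - lo t)" arbitrary: t)
  case 0
  then show ?case using bounds[of t] by (intro exI[of _ "[t]"]) (auto simp: ipath_single)
next
  case (Suc k)
  then have "lo t < \<phi> t" by linarith
  then obtain s where s: "(s, i, t) \<in> E" using down Suc.prems by blast
  then have "k = nat (\<phi> s - lo s)" "s \<in> I" using Suc.hyps(2) grade[OF s] E_I[OF s] by auto
  then obtain xs where xs: "ipath E i xs" "last xs = s" "\<phi> (hd xs) = lo s" using Suc.hyps(1) by blast
  then have "xs \<noteq> []" by (auto simp: ipath_def)
  then show ?case using xs s grade[OF s] ipath_snoc[of E i xs t]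
    by (intro exI[of _ "xs @ [t]"]) auto
qed

lemma ipath_from:
  "t \<in> I \<Longrightarrow> \<exists>xs. ipath E i xs \<and> hd xs = t \<and> \<phi> (last xs) = hi t"
proof (induction "nat (hi t - \<phi> t)" arbitrary: t)
  case 0
  then show ?case using bounds[of t] by (intro exI[of _ "[t]"]) (auto simp: ipath_single)
next
  case (Suc k)
  then have "\<phi> t < hi t" by linarith
  then obtain s where s: "(t, i, s) \<in> E" using up Suc.prems by blast
  then have "k = nat (hi s - \<phi> s)" "s \<in> I" using Suc.hyps(2) grade[OF s] E_I[OF s] by auto
  then obtain xs where xs: "ipath E i xs" "hd xs = s" "\<phi> (last xs) = hi s" using Suc.hyps(1) by blast
  then have "xs \<noteq> []" by (auto simp: ipath_def)
  then show ?case using xs s grade[OF s]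
    by (intro exI[of _ "t # xs"]) (auto simp: ipath_Cons_iff)
qed

lemma irank_eq:
  assumes t: "t \<in> I"
  shows "irank E i t = \<phi> t - lo t"
  unfolding irank_def
proof (rule Max_eqI)
  have *: "int (length xs) - 1 = \<phi> t - \<phi> (hd xs) \<and> lo t \<le> \<phi> (hd xs)"
    if "ipath E i xs" "last xs = t" for xs
    using ipath_graded[OF that(1)] bounds[of "hd xs"] t that(2) by auto
  have **: "0 \<le> int (length xs) - 1" if "ipath E i xs" for xs
    using that by (cases xs) (auto simp: ipath_def)
  \<comment> \<open>The inclusion in an interval supplies the finiteness without which
    \<open>Max\<close> has no meaning.\<close>
  have "{int (length xs) - 1 |xs. ipath E i xs \<and> last xs = t} \<subseteq> {0..\<phi> t - lo t}"
  proof
    fix y assume "y \<in> {int (length xs) - 1 |xs. ipath E i xs \<and> last xs = t}"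
    then obtain xs where "y = int (length xs) - 1" "ipath E i xs" "last xs = t" by blast
    then show "y \<in> {0..\<phi> t - lo t}" using *[of xs] **[of xs] by simp
  qed
  then show "finite {int (length xs) - 1 |xs. ipath E i xs \<and> last xs = t}" "\<And>y. y \<in> {int (length xs) - 1 |xs. ipath E i xs \<and> last xs = t} \<Longrightarrow> y \<le> \<phi> t - lo t"
    by (auto intro: finite_subset)
  obtain xs where "ipath E i xs" "last xs = t" "\<phi> (hd xs) = lo t" using ipath_to[OF t] by blast
  then show "\<phi> t - lo t \<in> {int (length xs) - 1 |xs. ipath E i xs \<and> last xs = t}"
    using * by (intro CollectI exI[of _ xs]) simp
qed

lemma icomp_invariant:
  assumes t: "t \<in> I" and u: "u \<in> icomp E i t"
  shows "u \<in> I \<and> lo u = lo t \<and> hi u = hi t"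
proof -
  have "(t, u) \<in> ({(a, b). (a, i, b) \<in> E} \<union> {(b, a). (a, i, b) \<in> E})\<^sup>*"
    using u by (simp add: icomp_def)
  then show ?thesis
  proof (induction rule: rtrancl_induct)
    case (step y z)
    then have "(y, i, z) \<in> E \<or> (z, i, y) \<in> E" by auto
    then show ?case using step.IH grade[of y z] grade[of z y] E_I[of y z] E_I[of z y] by auto
  qed (use t in simp)
qed

lemma ipath_icomp: "ipath E i xs \<Longrightarrow> hd xs \<in> icomp E i (last xs)"
proof (induction xs)
  case (Cons x xs)
  show ?case
  proof (cases "xs = []")
    case False
    then have "(x, i, hd xs) \<in> E" "hd xs \<in> icomp E i (last xs)"
      using ipath_Cons_iff[OF False, of E i x] Cons by simp_all
    then show ?thesis using False by (auto simp: icomp_def intro: rtrancl_into_rtrancl)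
  qed (simp add: icomp_def)
qed (simp add: ipath_def)

text \<open>A longest path arises by first descending from \<open>t\<close> to the bottom of its
  component and then climbing from there to the top; since \<open>lo\<close> and \<open>hi\<close>
  are constant on the component, no other path is longer.\<close>

lemma ilen_eq:
  assumes t: "t \<in> I"
  shows "ilen E i t = hi t - lo t"
  unfolding ilen_def
proof (rule Max_eqI)
  have *: "int (length xs) - 1 \<le> hi t - lo t"
    if "ipath E i xs" "hd xs \<in> icomp E i t" for xs
    using ipath_graded[OF that(1)] icomp_invariant[OF t that(2)] bounds[of "hd xs"] bounds[of "last xs"]
    by auto
  have **: "0 \<le> int (length xs) - 1" if "ipath E i xs" for xs
    using that by (cases xs) (auto simp: ipath_def)
  have "{int (length xs) - 1 |xs. ipath E i xs \<and> hd xs \<in> icomp E i t} \<subseteq> {0..hi t - lo t}"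
  proof
    fix y assume "y \<in> {int (length xs) - 1 |xs. ipath E i xs \<and> hd xs \<in> icomp E i t}"
    then obtain xs where "y = int (length xs) - 1" "ipath E i xs" "hd xs \<in> icomp E i t" by blast
    then show "y \<in> {0..hi t - lo t}" using *[of xs] **[of xs] by simp
  qed
  then show "finite {int (length xs) - 1 |xs. ipath E i xs \<and> hd xs \<in> icomp E i t}" "\<And>y. y \<in> {int (length xs) - 1 |xs. ipath E i xs \<and> hd xs \<in> icomp E i t} \<Longrightarrow> y \<le> hi t - lo t"
    by (auto intro: finite_subset)
  obtain xs where xs: "ipath E i xs" "last xs = t" "\<phi> (hd xs) = lo t" using ipath_to[OF t] by blast
  define u where "u = hd xs"
  have u: "u \<in> icomp E i t" using ipath_icomp[OF xs(1)] xs(2) by (simp add: u_def)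
  have uI: "u \<in> I" "hi u = hi t" using icomp_invariant[OF t u] by auto
  obtain ys where ys: "ipath E i ys" "hd ys = u" "\<phi> (last ys) = hi u" using ipath_from[OF uI(1)] by blast
  have "int (length ys) - 1 = hi t - lo t" using ipath_graded[OF ys(1)] ys uI xs by (simp add: u_def)
  then show "hi t - lo t \<in> {int (length xs) - 1 |xs. ipath E i xs \<and> hd xs \<in> icomp E i t}"
    using ys u by (intro CollectI exI[of _ ys]) simp
qed

lemma mval_eq: "t \<in> I \<Longrightarrow> mval E i t = 2 * \<phi> t - lo t - hi t"
  by (simp add: mval_def irank_eq ilen_eq)

end

definition rowsum :: "int set \<Rightarrow> (nat \<Rightarrow> int \<Rightarrow> int) \<Rightarrow> nat \<Rightarrow> int" where
  "rowsum C h i = (\<Sum>c\<in>C. h i c)"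

lemma rowsum_bump: "finite C \<Longrightarrow> c \<in> C \<Longrightarrow> rowsum C (bump i c h) j = rowsum C h j + (if j = i then 1 else 0)"
proof -
  assume a: "finite C" "c \<in> C"
  have "rowsum C (bump i c h) j = (\<Sum>d\<in>C. h j d + (if d = c then (if j = i then 1 else 0) else 0))"
    unfolding rowsum_def by (rule sum.cong) (auto simp: bump_def)
  then show ?thesis using a by (simp add: rowsum_def sum.distrib)
qed

text \<open>An \<open>i\<close>-coloured component fixes the levels \<open>i - 1\<close> and \<open>i + 1\<close>, and level \<open>i\<close> then
  ranges between the two extreme patterns summed up in \<open>lo\<close> and \<open>hi\<close>.\<close>
lemma mval_cpgraph:
  assumes g: "cpgraph n C a b I E h" and t: "t \<in> I" and i: "1 \<le> i" "i < n"
  shows "mval E i t = 2 * rowsum C (h t) i - rowsum C (h t) (i - 1) - rowsum C (h t) (i + 1)"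
proof -
  define hi where "hi s = (\<Sum>c\<in>C. min (h s (i - 1) c + 1) (h s (i + 1) c))" for s
  define lo where "lo s = (\<Sum>c\<in>C. max (h s (i - 1) c) (h s (i + 1) c - 1))" for s
  have fC: "finite C" using g by (simp add: cpgraph_def)
  note mem = cpgraph_mem[OF g]
  have b1: "h s (i - 1) c \<le> h s i c \<and> h s i c \<le> h s (i - 1) c + 1" if "s \<in> I" "c \<in> C" for s c
    using colpat_mono[OF mem[OF that(1)] that(2), of "i - 1" i] i by auto
  have b2: "h s i c \<le> h s (i + 1) c \<and> h s (i + 1) c \<le> h s i c + 1" if "s \<in> I" "c \<in> C" for s c
    using colpat_mono[OF mem[OF that(1)] that(2), of i "i + 1"] i by auto
  interpret graded_color E i I "\<lambda>s. rowsum C (h s) i" lo hi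
  proof
    fix s t assume e: "(s, i, t) \<in> E"
    then show "s \<in> I \<and> t \<in> I" using cpgraph_edge_iff[OF g] by blast
    obtain c where c: "c \<in> C" "h t = bump i c (h s)" using e cpgraph_edge_iff[OF g] by blast
    show "rowsum C (h t) i = rowsum C (h s) i + 1 \<and> lo t = lo s \<and> hi t = hi s"
      unfolding c(2) rowsum_bump[OF fC c(1)] lo_def hi_def using i by (auto simp: bump_def intro!: sum.cong)
  next
    fix s assume s: "s \<in> I"
    show "lo s \<le> rowsum C (h s) i \<and> rowsum C (h s) i \<le> hi s"
      unfolding lo_def hi_def rowsum_def using b1[OF s] b2[OF s]
      by (intro conjI sum_mono) (force simp: min_def max_def)+
  next
    fix s assume s: "s \<in> I" and l: "rowsum C (h s) i < hi s"
    let ?m = "\<lambda>c. min (h s (i - 1) c + 1) (h s (i + 1) c)"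
    \<comment> \<open>The columns whose own entries leave room at level i. The leftmost of them can
      be raised: each column to its left already attains a bound that is at least as large.\<close>
    define B where "B = {c \<in> C. h s i c < ?m c}"
    have "B \<noteq> {}"
    proof
      assume "B = {}"
      then have "hi s \<le> rowsum C (h s) i" unfolding hi_def rowsum_def
        by (intro sum_mono) (force simp: B_def)
      then show False using l by simp
    qed
    moreover have fB: "finite B" using fC by (simp add: B_def)
    ultimately have cB: "Min B \<in> B" by (intro Min_in)
    define c where "c = Min B"
    have c: "c \<in> C" "h s i c < ?m c" using cB by (auto simp: B_def c_def)
    have "bump i c (h s) \<in> colpat n C a b"
    proof (rule bump_colpat[OF mem[OF s] i c(1)])
      show "h s (i + 1) c = h s i c + 1" "h s (i - 1) c = h s i c" using b1[OF s c(1)] b2[OF s c(1)] c by auto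
      fix d assume d: "d \<in> C" "d < c"
      then have "d \<notin> B" using Min_le[OF fB, of d] by (auto simp: c_def)
      then have "?m d \<le> h s i d" using d by (auto simp: B_def)
      moreover have "h s (i - 1) c \<le> h s (i - 1) d" "h s (i + 1) c \<le> h s (i + 1) d"
        using colpat_anti[OF mem[OF s], of _ d c] d c i by auto
      ultimately show "h s i c < h s i d" using c(2) by linarith
    qed
    then show "\<exists>t. (s, i, t) \<in> E" using cpgraph_bump_up[OF g s i c(1)] by blast
  next
    fix s assume s: "s \<in> I" and l: "lo s < rowsum C (h s) i"
    let ?m = "\<lambda>c. max (h s (i - 1) c) (h s (i + 1) c - 1)"
    define B where "B = {c \<in> C. ?m c < h s i c}"
    have "B \<noteq> {}"
    proof
      assume "B = {}"
      then have "rowsum C (h s) i \<le> lo s" unfolding lo_def rowsum_def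
        by (intro sum_mono) (force simp: B_def)
      then show False using l by simp
    qed
    moreover have fB: "finite B" using fC by (simp add: B_def)
    ultimately have cB: "Max B \<in> B" by (intro Max_in)
    define c where "c = Max B"
    have c: "c \<in> C" "?m c < h s i c" using cB by (auto simp: B_def c_def)
    have "(h s)(i := (h s i)(c := h s i c - 1)) \<in> colpat n C a b"
    proof (rule unbump_colpat[OF mem[OF s] i c(1)])
      show "h s (i + 1) c = h s i c" "h s i c = h s (i - 1) c + 1" using b1[OF s c(1)] b2[OF s c(1)] c by auto
      fix d assume d: "d \<in> C" "c < d"
      then have "d \<notin> B" using Max_ge[OF fB, of d] by (auto simp: c_def)
      then have "h s i d \<le> ?m d" using d by (auto simp: B_def)
      moreover have "h s (i - 1) d \<le> h s (i - 1) c" "h s (i + 1) d \<le> h s (i + 1) c"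
        using colpat_anti[OF mem[OF s], of _ c d] d c i by auto
      ultimately show "h s i d < h s i c" using c(2) by linarith
    qed
    then show "\<exists>t. (t, i, s) \<in> E" using cpgraph_bump_down[OF g s i c(1)] by blast
  qed
  \<comment> \<open>Columnwise this is min (x + 1) y + max x (y - 1) = x + y.\<close>
  have "lo t + hi t = rowsum C (h t) (i - 1) + rowsum C (h t) (i + 1)"
    unfolding lo_def hi_def rowsum_def sum.distrib[symmetric] by (rule sum.cong) auto
  then show ?thesis using mval_eq[OF t] by simp
qed

section \<open>The Gelfand-Tsetlin norm\<close>

text \<open>For a diagonal intertwiner each condition reduces to an identity between single matrix
  entries.\<close>

lemma miso_diagonal:
  assumes fin: "finite (bas V)" and b: "bas W = bas V" and nz: "\<And>a. a \<in> bas V \<Longrightarrow> \<tau> a \<noteq> 0"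
    and x: "\<And>i a b. i \<in> {1..n - 1} \<Longrightarrow> a \<in> bas V \<Longrightarrow> b \<in> bas V \<Longrightarrow> \<tau> b * xop V i b a = xop W i b a * \<tau> a"
    and y: "\<And>i a b. i \<in> {1..n - 1} \<Longrightarrow> a \<in> bas V \<Longrightarrow> b \<in> bas V \<Longrightarrow> \<tau> b * yop V i b a = yop W i b a * \<tau> a"
    and h: "\<And>i a b. i \<in> {1..n - 1} \<Longrightarrow> a \<in> bas V \<Longrightarrow> b \<in> bas V \<Longrightarrow> \<tau> b * hop V i b a = hop W i b a * \<tau> a"
  shows "miso n V W"
proof -
  define T where "T b a = (if b = a then \<tau> a else 0)" for a b
  define S where "S b a = (if b = a then inverse (\<tau> a) else 0)" for a b
  have *: "intertw (bas V) (bas V) M N T"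
    if "\<And>a b. a \<in> bas V \<Longrightarrow> b \<in> bas V \<Longrightarrow> \<tau> b * M b a = N b a * \<tau> a" for M N
    unfolding intertw_def
  proof (intro ballI)
    fix b a assume ab: "b \<in> bas V" "a \<in> bas V"
    have "(\<Sum>a'\<in>bas V. T b a' * M a' a) = (\<Sum>a'\<in>bas V. (if b = a' then 1 else 0) * (\<tau> a' * M a' a))"
      by (intro sum.cong) (auto simp: T_def)
    also have "\<dots> = \<tau> b * M b a" by (rule sum_indicator(1)[OF fin ab(1)])
    also have "\<dots> = N b a * \<tau> a" by (rule that[OF ab(2,1)])
    also have "\<dots> = (\<Sum>b'\<in>bas V. (N b b' * \<tau> b') * (if b' = a then 1 else 0))"
      by (rule sum_indicator(4)[OF fin ab(2), symmetric])
    also have "\<dots> = (\<Sum>b'\<in>bas V. N b b' * T b' a)" by (intro sum.cong) (auto simp: T_def)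
    finally show "(\<Sum>a'\<in>bas V. T b a' * M a' a) = (\<Sum>b'\<in>bas V. N b b' * T b' a)" .
  qed
  have inv: "(\<Sum>a\<in>bas V. F b a * G a b') = (if b = b' then 1 else 0)"
    if "b \<in> bas V" "b' \<in> bas V" and FG: "\<And>a. a \<in> bas V \<Longrightarrow> F b a * G a b' = (if b = a then 1 else 0) * (if a = b' then 1 else (0::complex))"
    for b b' F G
  proof -
    have "(\<Sum>a\<in>bas V. F b a * G a b') = (\<Sum>a\<in>bas V. (if b = a then 1 else 0) * (if a = b' then 1 else (0::complex)))"
      by (intro sum.cong FG) auto
    also have "\<dots> = (if b = b' then 1 else 0)" by (rule sum_indicator(1)[OF fin that(1)])
    finally show ?thesis .
  qed
  show ?thesis unfolding miso_def b
    by (intro exI[of _ T] exI[of _ S] conjI ballI inv * x y h) (auto simp: T_def S_def nz)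
qed

text \<open>Passes from the index k in which the scalars are written to the row r = s + 1 - k of the
  shape.\<close>

lemma prod_int_interval_flip:
  fixes f :: "int \<Rightarrow> complex"
  shows "(\<Prod>k\<in>{s - int m + 1..s}. f k) = (\<Prod>r\<in>{1..int m}. f (s + 1 - r))"
  by (rule prod.reindex_bij_witness[where i = "\<lambda>r. s + 1 - r" and j = "\<lambda>k. s + 1 - k"]) auto

lemma prod_int_interval_flip_minus:
  fixes f :: "int \<Rightarrow> complex"
  shows "(\<Prod>k\<in>{s - int m + 1..s} - {s + 1 - r0}. f k) = (\<Prod>r\<in>{1..int m} - {r0}. f (s + 1 - r))"
  by (rule prod.reindex_bij_witness[where i = "\<lambda>r. s + 1 - r" and j = "\<lambda>k. s + 1 - k"]) auto

text \<open>A nowhere vanishing function on the integers with \<open>\<Phi> z = z * \<Phi> (z - 1)\<close> for \<open>z \<noteq> 0\<close>: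
  the factorial, continued to negative arguments across the pole.\<close>
definition int_fact :: "int \<Rightarrow> complex" where
  "int_fact z = (if 0 \<le> z then fact (nat z) else (-1) ^ nat (- z) / fact (nat (- z - 1)))"

lemma int_fact_nonzero: "int_fact z \<noteq> 0"
  by (simp add: int_fact_def)

lemma int_fact_rec:
  assumes "z \<noteq> 0"
  shows "int_fact z = of_int z * int_fact (z - 1)"
proof (cases "0 < z")
  case True
  then obtain k where "z = int (Suc k)" using zero_less_imp_eq_int[of z] by (metis gr0_implies_Suc of_nat_0_less_iff)
  then have "nat z = Suc k" "nat (z - 1) = k" by auto
  then show ?thesis using \<open>z = int (Suc k)\<close> by (simp add: int_fact_def)
next
  case False
  then obtain k where k: "z = - int (Suc k)" using assms zero_less_imp_eq_int[of "- z"]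
    by (metis (no_types, opaque_lifting) add.inverse_inverse gr0_implies_Suc neg_0_less_iff_less of_nat_0_less_iff linorder_neqE_linordered_idom)
  then have "nat (- z) = Suc k" "nat (- z - 1) = k" "nat (- (z - 1)) = Suc (Suc k)" "nat (- (z - 1) - 1) = Suc k"
    "\<not> 0 \<le> z" "\<not> 0 \<le> z - 1"
    by auto
  then have "int_fact z = (-1) ^ Suc k / fact k" "int_fact (z - 1) = (-1) ^ Suc (Suc k) / fact (Suc k)"
    unfolding int_fact_def by presburger+
  moreover have "complex_of_int z = - of_nat (Suc k)" by (simp add: k)
  moreover have "fact (Suc k) = of_nat (Suc k) * (fact k :: complex)" by simp
  moreover have "of_nat (Suc k) \<noteq> (0 :: complex)" by (rule of_nat_neq_0)
  ultimately show ?thesis by (simp del: of_nat_Suc fact_Suc)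
qed

lemma int_fact_pred: "z \<noteq> 0 \<Longrightarrow> int_fact (z - 1) = int_fact z * inverse (of_int z)"
  using int_fact_rec[of z] by simp

definition parity_sign :: "int \<Rightarrow> complex" where
  "parity_sign z = (if even z then 1 else -1)"

text \<open>Chosen so that rescaling by \<open>gt_norm\<close> turns \<open>Y\<close> into the negative transpose of \<open>X\<close>; up to signs
  \<open>gt_norm\<close> is the squared norm of the Gelfand-Tsetlin basis vector with shifted entries \<open>A\<close>.\<close>
definition gt_factor :: "(int \<Rightarrow> int \<Rightarrow> int) \<Rightarrow> int \<times> int \<times> int \<Rightarrow> complex" where
  "gt_factor A = (\<lambda>(j, p, q). int_fact (A j p - A (j - 1) q) * parity_sign (A j p) *
     (if p < q then inverse (of_int (A j p - A j q)) else 1))"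

definition gt_norm :: "nat \<Rightarrow> nat \<Rightarrow> (int \<Rightarrow> int \<Rightarrow> int) \<Rightarrow> complex" where
  "gt_norm n m A = (\<Prod>x\<in>{1..int n} \<times> {1..int m} \<times> {1..int m}. gt_factor A x)"

text \<open>The correction factors of \<open>gt_norm\<close> under an edge are 1 off a single slice
  of the index set, so their triple product is a product over one row index.\<close>

lemma prod_triple_first:
  fixes f :: "int \<Rightarrow> complex"
  assumes "finite J" "finite R" "i \<in> J" "r \<in> R"
  shows "(\<Prod>(j, p, q)\<in>J \<times> R \<times> R. if j = i \<and> p = r then f q else 1) = (\<Prod>q\<in>R. f q)"
proof -
  have "(\<Prod>(j, p, q)\<in>J \<times> R \<times> R. if j = i \<and> p = r then f q else 1)
    = (\<Prod>j\<in>J. \<Prod>p\<in>R. \<Prod>q\<in>R. if j = i \<and> p = r then f q else 1)"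
    by (simp add: prod.cartesian_product)
  also have "\<dots> = (\<Prod>j\<in>J. if j = i then (\<Prod>p\<in>R. if p = r then (\<Prod>q\<in>R. f q) else 1) else 1)"
    by (intro prod.cong refl) (auto intro!: prod.cong)
  also have "\<dots> = (\<Prod>q\<in>R. f q)" using assms by simp
  finally show ?thesis .
qed

lemma prod_triple_second:
  fixes f :: "int \<Rightarrow> complex"
  assumes "finite J" "finite R" "i \<in> J" "r \<in> R"
  shows "(\<Prod>(j, p, q)\<in>J \<times> R \<times> R. if j = i \<and> q = r then f p else 1) = (\<Prod>q\<in>R. f q)"
proof -
  have "(\<Prod>(j, p, q)\<in>J \<times> R \<times> R. if j = i \<and> q = r then f p else 1)
    = (\<Prod>j\<in>J. \<Prod>p\<in>R. \<Prod>q\<in>R. if j = i \<and> q = r then f p else 1)"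
    by (simp add: prod.cartesian_product)
  also have "\<dots> = (\<Prod>j\<in>J. if j = i then (\<Prod>p\<in>R. \<Prod>q\<in>R. if q = r then f p else 1) else 1)"
    by (intro prod.cong refl) auto
  also have "\<dots> = (\<Prod>q\<in>R. f q)" using assms by simp
  finally show ?thesis .
qed

lemma inverse_cancel: "a \<noteq> 0 \<Longrightarrow> inverse b = inverse a * (a / (b::complex))"
  by (simp add: field_simps)

text \<open>Raising the entry (i, r) changes three groups of factors: the factorials of level i with
  p = r, whose argument grows by one; those of level i + 1 with q = r, whose argument drops by one;
  and the inverse differences inside level i that involve r on either side. \<open>lo\<close> and
  \<open>up\<close> keep the factorial recursion away from 0, and \<open>dA\<close> does the same
  for the differences.\<close>

lemma gt_norm_step:
  fixes A B :: "int \<Rightarrow> int \<Rightarrow> int"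
  assumes i: "1 \<le> i" "i < int n" and r: "1 \<le> r" "r \<le> int m"
    and B: "\<And>j p. B j p = A j p + (if j = i \<and> p = r then 1 else 0)"
    and lo: "\<And>q. 1 \<le> q \<Longrightarrow> q \<le> int m \<Longrightarrow> B i r \<noteq> B (i - 1) q"
    and up: "\<And>q. 1 \<le> q \<Longrightarrow> q \<le> int m \<Longrightarrow> B i r - 1 \<noteq> B (i + 1) q"
    and dA: "\<And>p q. 1 \<le> p \<Longrightarrow> p < q \<Longrightarrow> q \<le> int m \<Longrightarrow> A i p \<noteq> A i q"
  shows "gt_norm n m B = gt_norm n m A *
    ((\<Prod>q\<in>{1..int m}. of_int (B i r - B (i - 1) q)) / (\<Prod>q\<in>{1..int m}. of_int (B i r - B (i + 1) q - 1))) *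
    (\<Prod>q\<in>{1..int m} - {r}. of_int (B i r - B i q - 1) / of_int (B i r - B i q))"
proof -
  let ?R = "{1..int m}"
  let ?J = "{1..int n}"
  \<comment> \<open>The sign is contributed by \<open>parity_sign\<close>. It cancels against
    \<open>f2\<close>, whose denominator is the negative of the one in the claim.\<close>
  define f1 where "f1 q = - complex_of_int (B i r - B (i - 1) q)" for q
  define f2 where "f2 p = inverse (complex_of_int (B (i + 1) p - B i r + 1))" for p
  define e where "e q = complex_of_int (B i r - B i q - 1) / of_int (B i r - B i q)" for q
  define f3 where "f3 q = (if r < q then e q else 1)" for q
  define f4 where "f4 q = (if q < r then e q else 1)" for q
  let ?g1 = "\<lambda>(j, p, q). if j = i \<and> p = r then f1 q else 1"
  let ?g2 = "\<lambda>(j, p, q). if j = i + 1 \<and> q = r then f2 p else 1"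
  let ?g3 = "\<lambda>(j, p, q). if j = i \<and> p = r then f3 q else 1"
  let ?g4 = "\<lambda>(j, p, q). if j = i \<and> q = r then f4 p else 1"
  have step: "gt_factor B x = gt_factor A x * (?g1 x * ?g2 x * ?g3 x * ?g4 x)" if x: "x \<in> ?J \<times> ?R \<times> ?R" for x
  proof -
    obtain j p q where jpq: "x = (j, p, q)" by (cases x) auto
    have m: "1 \<le> p" "p \<le> int m" "1 \<le> q" "q \<le> int m" using x jpq by auto
    consider "j = i" "p = r" | "j = i" "q = r" "p \<noteq> r" | "j = i + 1" "q = r"
      | "\<not> (j = i \<and> (p = r \<or> q = r))" "\<not> (j = i + 1 \<and> q = r)" by blast
    then show ?thesis
    proof cases
      case 1
      have a: "int_fact (B i r - B (i - 1) q) = of_int (B i r - B (i - 1) q) * int_fact (B i r - B (i - 1) q - 1)"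
        using lo m by (intro int_fact_rec) auto
      have s: "parity_sign (A i r + 1) = - parity_sign (A i r)" by (simp add: parity_sign_def)
      have d: "inverse (complex_of_int (B i r - B i q)) =
        inverse (of_int (A i r - A i q)) * e q" if "r < q"
      proof -
        have "B i r - B i q - 1 = A i r - A i q" using B[of i r] B[of i q] that by simp
        moreover have "A i r - A i q \<noteq> 0" using dA[of r q] that m r by auto
        ultimately show ?thesis unfolding e_def by (simp only: inverse_cancel of_int_eq_0_iff not_False_eq_True)
      qed
      have A1: "B (i - 1) q = A (i - 1) q" "B i r = A i r + 1"
        using B[of i r] B[of "i - 1" q] by auto
      show ?thesis
      proof (cases "r < q")
        case True
        then show ?thesis unfolding jpq using 1 a d
          by (simp add: gt_factor_def f1_def f3_def f4_def A1 s del: of_int_diff)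
      next
        case False
        then show ?thesis unfolding jpq using 1 a
          by (simp add: gt_factor_def f1_def f3_def f4_def A1 s del: of_int_diff)
      qed
    next
      case 2
      have A1: "B i p = A i p" "B (i - 1) r = A (i - 1) r" using B 2 by auto
      have d: "inverse (complex_of_int (B i p - B i r)) =
        inverse (of_int (A i p - A i r)) * e p" if "p < r"
      proof -
        have a: "A i p - A i r = - (B i r - B i p - 1)" "B i p - B i r = - (B i r - B i p)"
          using B[of i r] B[of i p] that by simp_all
        moreover have "A i p - A i r \<noteq> 0" using dA[of p r] that m r by auto
        ultimately have "B i r - B i p - 1 \<noteq> 0" by linarith
        then have "inverse (complex_of_int (B i r - B i p)) =
            inverse (of_int (B i r - B i p - 1)) * e p" unfolding e_def by (intro inverse_cancel) (simp only: of_int_eq_0_iff not_False_eq_True)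
        then show ?thesis unfolding a of_int_minus inverse_minus_eq by simp
      qed
      show ?thesis
      proof (cases "p < r")
        case True
        then show ?thesis unfolding jpq using 2 d A1
          by (simp add: gt_factor_def f3_def f4_def del: of_int_diff)
      next
        case False
        then show ?thesis unfolding jpq using 2 A1
          by (simp add: gt_factor_def f3_def f4_def del: of_int_diff)
      qed
    next
      case 3
      have A1: "B (i + 1) p' = A (i + 1) p'" "B i r = A i r + 1" for p' using B by auto
      have "f2 p = inverse (of_int (A (i + 1) p - A i r))"
        "A (i + 1) p - (A i r + 1) = A (i + 1) p - A i r - 1"
        unfolding f2_def using A1 by simp_all
      moreover have "A (i + 1) p - A i r \<noteq> 0" using up[OF m(1,2)] A1 by auto
      ultimately have "int_fact (A (i + 1) p - (A i r + 1)) = int_fact (A (i + 1) p - A i r) * f2 p"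
        by (simp only: int_fact_pred not_False_eq_True)
      then show ?thesis unfolding jpq using 3
        by (simp add: gt_factor_def A1 del: of_int_diff)
    next
      case 4
      then have "B j p = A j p" "B j q = A j q" "B (j - 1) q = A (j - 1) q" using B by auto
      then show ?thesis unfolding jpq using 4 by (auto simp: gt_factor_def)
    qed
  qed
  have mem: "i \<in> ?J" "i + 1 \<in> ?J" "r \<in> ?R" using i r by auto
  have "gt_norm n m B = gt_norm n m A * ((\<Prod>x\<in>?J \<times> ?R \<times> ?R. ?g1 x) * (\<Prod>x\<in>?J \<times> ?R \<times> ?R. ?g2 x) *
    (\<Prod>x\<in>?J \<times> ?R \<times> ?R. ?g3 x) * (\<Prod>x\<in>?J \<times> ?R \<times> ?R. ?g4 x))"
    unfolding gt_norm_def prod.distrib[symmetric] by (rule prod.cong[OF refl step])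
  also have "\<dots> = gt_norm n m A * ((\<Prod>q\<in>?R. f1 q) * (\<Prod>q\<in>?R. f2 q) * (\<Prod>q\<in>?R. f3 q) * (\<Prod>q\<in>?R. f4 q))"
    using mem by (simp only: prod_triple_first prod_triple_second finite_atLeastAtMost_int)
  also have "(\<Prod>q\<in>?R. f3 q) * (\<Prod>q\<in>?R. f4 q) = (\<Prod>q\<in>?R - {r}. e q)" (is "?l = ?r")
  proof -
    have "?l = (\<Prod>q\<in>?R. f3 q * f4 q)" by (simp add: prod.distrib)
    also have "\<dots> = f3 r * f4 r * (\<Prod>q\<in>?R - {r}. f3 q * f4 q)" using mem by (intro prod.remove) auto
    also have "\<dots> = ?r" by (auto simp: f3_def f4_def split: if_splits intro!: prod.cong)
    finally show ?thesis .
  qed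
  then have "(\<Prod>q\<in>?R. f1 q) * (\<Prod>q\<in>?R. f2 q) * (\<Prod>q\<in>?R. f3 q) * (\<Prod>q\<in>?R. f4 q)
    = (\<Prod>q\<in>?R. f1 q) * (\<Prod>q\<in>?R. f2 q) * (\<Prod>q\<in>?R - {r}. e q)" by (simp add: mult.assoc)
  also have "(\<Prod>q\<in>?R. f1 q) * (\<Prod>q\<in>?R. f2 q)
    = (\<Prod>q\<in>?R. of_int (B i r - B (i - 1) q) / of_int (B i r - B (i + 1) q - 1))" (is "?l = ?r")
  proof -
    have "f1 q * f2 q = of_int (B i r - B (i - 1) q) / of_int (B i r - B (i + 1) q - 1)" for q
    proof -
      have "B (i + 1) q - B i r + 1 = - (B i r - B (i + 1) q - 1)" by simp
      then have "f2 q = inverse (- complex_of_int (B i r - B (i + 1) q - 1))"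
        unfolding f2_def by (simp only: of_int_minus)
      then show ?thesis unfolding f1_def
        by (simp only: inverse_minus_eq minus_mult_minus divide_inverse)
    qed
    then show ?thesis by (simp add: prod.distrib[symmetric])
  qed
  finally show ?thesis by (simp add: e_def prod_dividef mult.assoc)
qed

lemma gt_norm_nonzero:
  assumes "\<And>j p q. 1 \<le> j \<Longrightarrow> j \<le> int n \<Longrightarrow> 1 \<le> p \<Longrightarrow> p < q \<Longrightarrow> q \<le> int m \<Longrightarrow> A j p \<noteq> A j q"
  shows "gt_norm n m A \<noteq> 0"
  unfolding gt_norm_def using assms
  by (auto simp: gt_factor_def int_fact_nonzero parity_sign_def)

section \<open>Edge scalars of skew-tabular lattices\<close>

locale skew_shape =
  fixes n m :: nat and P Q :: "nat \<Rightarrow> nat"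
  assumes P_anti: "1 \<le> r \<Longrightarrow> r \<le> r' \<Longrightarrow> r' \<le> m \<Longrightarrow> P r' \<le> P r"
    and Q_anti: "1 \<le> r \<Longrightarrow> r \<le> r' \<Longrightarrow> r' \<le> m \<Longrightarrow> Q r' \<le> Q r"
    and col_card: "card {r. (r, c) \<in> skewD m P Q} \<le> n"
begin

abbreviation "D \<equiv> skewD m P Q"

abbreviation "L \<equiv> Lskew n m P Q"

text \<open>The pattern entry g with index (i, i + 1 - r), addressed by its row: the last column of
  row r with entry at most i, or Q r if there is none.\<close>

definition grow :: "filling \<Rightarrow> int \<Rightarrow> int \<Rightarrow> int" where
  "grow T i r = int (Q (nat r)) + int (card {c. (r, c) \<in> D \<and> int (T (r, c)) \<le> i})"

lemma D_iff: "(r, c) \<in> D \<longleftrightarrow> 1 \<le> r \<and> r \<le> int m \<and> int (Q (nat r)) < c \<and> c \<le> int (P (nat r))"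
  by (simp add: skewD_def)

lemma gfun_grow: "gfun m P Q T i (i + 1 - r) = (if 1 \<le> r \<and> r \<le> int m then grow T i r else 0)"
  by (simp add: gfun_def grow_def Let_def)

lemma finite_row: "finite {c. (r, c) \<in> D \<and> R c}"
  by (rule finite_subset[of _ "{int (Q (nat r))<..int (P (nat r))}"]) (auto simp: D_iff)

lemma grow_mono: "i \<le> j \<Longrightarrow> grow T i r \<le> grow T j r"
  unfolding grow_def by (auto intro!: card_mono finite_row)

lemma grow_row:
  assumes T: "T \<in> lsk_verts n D"
  shows "{c. (r, c) \<in> D \<and> int (T (r, c)) \<le> i} = {int (Q (nat r))<..grow T i r}" (is "?X = _")
proof -
  have "?X = {int (Q (nat r))<..int (Q (nat r)) + int (card ?X)}"
  proof (rule int_initial_segment[where b = "int (P (nat r))"])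
    show "?X \<subseteq> {int (Q (nat r))<..int (P (nat r))}" by (auto simp: D_iff)
    fix x y assume x: "x \<in> ?X" and y: "int (Q (nat r)) < y" "y \<le> x"
    have D: "(r, y) \<in> D" "(r, x) \<in> D" using x y by (auto simp: D_iff)
    have "T (r, y) \<le> T (r, x)"
    proof (cases "y = x")
      case False
      then show ?thesis using T D y unfolding lsk_verts_def by simp
    qed simp
    then show "y \<in> ?X" using x D by simp
  qed
  then show ?thesis by (simp add: grow_def)
qed

lemma grow_le_iff:
  assumes T: "T \<in> lsk_verts n D" and p: "(r, c) \<in> D"
  shows "int (T (r, c)) \<le> i \<longleftrightarrow> c \<le> grow T i r"
proof -
  have "int (Q (nat r)) < c" using p by (simp add: D_iff)
  then show ?thesis using grow_row[OF T, of r i] p by (auto simp: set_eq_iff)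
qed

text \<open>If row r + 1 at level i + 1 extended beyond row r at level i, then the cell above its
  last cell would still lie in the shape and carry a smaller entry, hence one at most i.\<close>

lemma grow_interlace:
  assumes T: "T \<in> lsk_verts n D" and r: "1 \<le> r" "r + 1 \<le> int m"
  shows "grow T (i + 1) (r + 1) \<le> grow T i r"
proof (rule ccontr)
  assume a: "\<not> ?thesis"
  define c where "c = grow T (i + 1) (r + 1)"
  have "int (Q (nat r)) \<le> grow T i r" by (simp add: grow_def)
  then have cQ: "int (Q (nat r)) < c" using a by (simp add: c_def)
  have "Q (nat (r + 1)) \<le> Q (nat r)" using r by (intro Q_anti) auto
  then have "c \<in> {int (Q (nat (r + 1)))<..grow T (i + 1) (r + 1)}" using cQ by (simp add: c_def)
  then have c: "(r + 1, c) \<in> D" "int (T (r + 1, c)) \<le> i + 1" unfolding grow_row[OF T, symmetric] by auto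
  have "P (nat (r + 1)) \<le> P (nat r)" using r by (intro P_anti) auto
  then have D: "(r, c) \<in> D" using c cQ r by (simp add: D_iff)
  then have "T (r, c) < T (r + 1, c)" using T c(1) unfolding lsk_verts_def by simp
  then have "int (T (r, c)) \<le> i" using c by simp
  then show False using grow_le_iff[OF T D] a by (simp add: c_def)
qed

lemma grow_anti:
  assumes T: "T \<in> lsk_verts n D" and r: "1 \<le> p" "p \<le> q" "q \<le> int m"
  shows "grow T i q \<le> grow T i p"
  using r(2,1,3)
proof (induction q rule: int_ge_induct)
  case (step q)
  have "grow T i (q + 1) \<le> grow T (i + 1) (q + 1)" by (rule grow_mono) simp
  also have "\<dots> \<le> grow T i q" using step by (intro grow_interlace[OF T]) auto
  finally show ?case using step by simp
qed simp

lemma grow_interlace':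
  assumes T: "T \<in> lsk_verts n D" and r: "1 \<le> p" "p < q" "q \<le> int m"
  shows "grow T (i + 1) q \<le> grow T i p"
proof -
  have "grow T (i + 1) q \<le> grow T i (q - 1)" using grow_interlace[OF T, of "q - 1" i] r by simp
  also have "\<dots> \<le> grow T i p" using r by (intro grow_anti[OF T]) auto
  finally show ?thesis .
qed

text \<open>Subtracting the row index makes each level strictly decreasing, like adding the Weyl
  vector to a partition. All factors in X and Y are differences of such values, up to a shift by
  1.\<close>

definition gpart :: "filling \<Rightarrow> int \<Rightarrow> int \<Rightarrow> int" where
  "gpart T i r = grow T i r - r"

lemma gpart_strict:
  assumes "T \<in> lsk_verts n D" "1 \<le> p" "p < q" "q \<le> int m"
  shows "gpart T i q < gpart T i p" "gpart T (i + 1) q < gpart T i p"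
  using grow_anti[OF assms(1,2) less_imp_le[OF assms(3)] assms(4), of i]
    grow_interlace'[OF assms, of i] assms(3) by (simp_all add: gpart_def)

lemma edge_gpart:
  assumes e: "(S, i, T) \<in> lsk_edges n D"
  obtains r where "1 \<le> r" "r \<le> int m" "1 \<le> i" "i < n" "S \<in> lsk_verts n D" "T \<in> lsk_verts n D"
    "\<And>j p. grow T j p = grow S j p + (if j = int i \<and> p = r then 1 else 0)"
proof -
  obtain x where V: "S \<in> lsk_verts n D" "T \<in> lsk_verts n D" "x \<in> D" and
    Sp: "S x = T x + 1" and q: "\<And>q. q \<noteq> x \<Longrightarrow> S q = T q" and i: "i = T x"
    using e unfolding lsk_edges_def by blast
  obtain r c where x: "x = (r, c)" by force
  have "1 \<le> T x" "S x \<le> n" using V by (auto simp: lsk_verts_def)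
  then have i': "1 \<le> i" "i < n" using i Sp by auto
  have "grow T j p = grow S j p + (if j = int i \<and> p = r then 1 else 0)" for j p
  proof (cases "j = int i \<and> p = r")
    case True
    have "{c. (r, c) \<in> D \<and> int (T (r, c)) \<le> int i} = insert c {c. (r, c) \<in> D \<and> int (S (r, c)) \<le> int i}"
    proof -
      have "int (T (r, c')) \<le> int i \<longleftrightarrow> c' = c \<or> int (S (r, c')) \<le> int i" for c'
        using q[of "(r, c')"] Sp by (cases "c' = c") (auto simp: x i)
      then show ?thesis using V(3) x by auto
    qed
    moreover have "c \<notin> {c. (r, c) \<in> D \<and> int (S (r, c)) \<le> int i}" using Sp x i by simp
    ultimately have "card {c. (r, c) \<in> D \<and> int (T (r, c)) \<le> int i}
      = Suc (card {c. (r, c) \<in> D \<and> int (S (r, c)) \<le> int i})"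
      using finite_row by simp
    then show ?thesis using True by (simp add: grow_def)
  next
    case False
    have "int (T (p, c')) \<le> j \<longleftrightarrow> int (S (p, c')) \<le> j" for c'
    proof (cases "(p, c') = x")
      case True
      then have "j \<noteq> int i" using False x by auto
      then show ?thesis using True Sp i by auto
    qed (use q in auto)
    then show ?thesis using False by (simp add: grow_def)
  qed
  moreover have "1 \<le> r" "r \<le> int m" using V(3) x by (auto simp: D_iff)
  ultimately show thesis using that i' V by blast
qed

text \<open>Off the rows 1..m \<open>gfun\<close> is constantly 0 and cannot increase, so the
  position is unique among all pairs of integers.\<close>

lemma gpos_edge:
  assumes r: "1 \<le> r" "r \<le> int m"
    and g: "\<And>j p. grow T j p = grow S j p + (if j = int i \<and> p = r then 1 else 0)"
  shows "gpos m P Q S T = (int i, int i + 1 - r)"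
  unfolding gpos_def
proof (rule the_equality)
  show "gfun m P Q T (fst (int i, int i + 1 - r)) (snd (int i, int i + 1 - r))
    = gfun m P Q S (fst (int i, int i + 1 - r)) (snd (int i, int i + 1 - r)) + 1"
    using r g[of "int i" r] gfun_grow[of T "int i" r] gfun_grow[of S "int i" r] by simp
next
  fix ij assume a: "gfun m P Q T (fst ij) (snd ij) = gfun m P Q S (fst ij) (snd ij) + 1"
  define p where "p = fst ij + 1 - snd ij"
  have s: "snd ij = fst ij + 1 - p" by (simp add: p_def)
  have "fst ij = int i \<and> p = r"
    using a unfolding s gfun_grow using g[of "fst ij" p] by (auto split: if_splits)
  then show "ij = (int i, int i + 1 - r)" using s by (cases ij) auto
qed

section \<open>Nonvanishing and rescaling of the scalars on one edge\<close>

context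
  fixes S T :: filling and i :: nat and r :: int
  assumes r: "1 \<le> r" "r \<le> int m" and i: "1 \<le> i" "i < n"
    and V: "S \<in> lsk_verts n D" "T \<in> lsk_verts n D"
    and g: "\<And>j p. grow T j p = grow S j p + (if j = int i \<and> p = r then 1 else 0)"
begin

lemma gpart_step: "gpart T j p = gpart S j p + (if j = int i \<and> p = r then 1 else 0)"
  using g by (simp add: gpart_def)

lemma Xval_gpart:
  "Xval m P Q T S = - (\<Prod>q\<in>{1..int m}. of_int (gpart T (int i) r - gpart T (int i + 1) q - 1))
     / (\<Prod>q\<in>{1..int m} - {r}. of_int (gpart T (int i) r - gpart T (int i) q - 1))"
proof -
  have a: "(\<Prod>q\<in>{1..int m}. complex_of_int (gfun m P Q T (int i) (int i + 1 - r) - gfun m P Q T (int i + 1) (int i + 1 + 1 - q)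
      + (int i + 1 - r) - (int i + 1 + 1 - q)))
    = (\<Prod>q\<in>{1..int m}. of_int (gpart T (int i) r - gpart T (int i + 1) q - 1))"
  proof (rule prod.cong)
    fix q assume "q \<in> {1..int m}"
    then show "complex_of_int (gfun m P Q T (int i) (int i + 1 - r) - gfun m P Q T (int i + 1) (int i + 1 + 1 - q)
      + (int i + 1 - r) - (int i + 1 + 1 - q)) = of_int (gpart T (int i) r - gpart T (int i + 1) q - 1)"
      unfolding gfun_grow using r by (simp add: gpart_def)
  qed simp
  have b: "(\<Prod>q\<in>{1..int m} - {r}. complex_of_int (gfun m P Q T (int i) (int i + 1 - r) - gfun m P Q T (int i) (int i + 1 - q)
      + (int i + 1 - r) - (int i + 1 - q) - 1))
    = (\<Prod>q\<in>{1..int m} - {r}. of_int (gpart T (int i) r - gpart T (int i) q - 1))"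
    by (rule prod.cong) (use r in \<open>auto simp: gfun_grow gpart_def\<close>)
  show ?thesis
    unfolding Xval_def gpos_edge[OF r g] Let_def fst_conv snd_conv
    unfolding prod_int_interval_flip prod_int_interval_flip_minus a b ..
qed

lemma Yval_gpart:
  "Yval m P Q S T = (\<Prod>q\<in>{1..int m}. of_int (gpart T (int i) r - gpart T (int i - 1) q))
     / (\<Prod>q\<in>{1..int m} - {r}. of_int (gpart T (int i) r - gpart T (int i) q))"
proof -
  have a: "(\<Prod>q\<in>{1..int m}. complex_of_int (gfun m P Q T (int i) (int i + 1 - r) - gfun m P Q T (int i - 1) (int i - 1 + 1 - q)
      + (int i + 1 - r) - (int i - 1 + 1 - q) - 1))
    = (\<Prod>q\<in>{1..int m}. of_int (gpart T (int i) r - gpart T (int i - 1) q))"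
  proof (rule prod.cong)
    fix q assume "q \<in> {1..int m}"
    then show "complex_of_int (gfun m P Q T (int i) (int i + 1 - r) - gfun m P Q T (int i - 1) (int i - 1 + 1 - q)
      + (int i + 1 - r) - (int i - 1 + 1 - q) - 1) = of_int (gpart T (int i) r - gpart T (int i - 1) q)"
      unfolding gfun_grow using r by (simp add: gpart_def)
  qed simp
  have b: "(\<Prod>q\<in>{1..int m} - {r}. complex_of_int (gfun m P Q T (int i) (int i + 1 - r) - gfun m P Q T (int i) (int i + 1 - q)
      + (int i + 1 - r) - (int i + 1 - q)))
    = (\<Prod>q\<in>{1..int m} - {r}. of_int (gpart T (int i) r - gpart T (int i) q))"
    by (rule prod.cong) (use r in \<open>auto simp: gfun_grow gpart_def\<close>)
  show ?thesis
    unfolding Yval_def gpos_edge[OF r g] Let_def fst_conv snd_conv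
    unfolding prod_int_interval_flip prod_int_interval_flip_minus a b ..
qed

text \<open>For rows above \<open>r\<close> interlacing in \<open>T\<close> separates the two
  values. For the others the comparison passes through \<open>S\<close>, whose entry at (i, r) is
  one smaller. This keeps the numerator of Y away from 0; the next two lemmas treat the numerator of
  X and the denominators.\<close>

lemma gpart_lower_neq:
  assumes q: "1 \<le> q" "q \<le> int m"
  shows "gpart T (int i) r \<noteq> gpart T (int i - 1) q"
proof (cases "q < r")
  case True
  then show ?thesis using gpart_strict(2)[OF V(2) q(1) True r(2), of "int i - 1"] by simp
next
  case False
  have "gpart T (int i - 1) q \<le> gpart S (int i) q"
    using gpart_step[of "int i - 1" q] grow_mono[of "int i - 1" "int i" S q] by (simp add: gpart_def)
  also have "\<dots> \<le> gpart S (int i) r"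
    using gpart_strict(1)[OF V(1) r(1) _ q(2), of "int i"] False by (cases "q = r") auto
  also have "\<dots> < gpart T (int i) r" using gpart_step[of "int i" r] by simp
  finally show ?thesis by simp
qed

lemma gpart_upper_neq:
  assumes q: "1 \<le> q" "q \<le> int m"
  shows "gpart T (int i) r - 1 \<noteq> gpart T (int i + 1) q"
proof (cases "r < q")
  case True
  have "gpart T (int i + 1) q = gpart S (int i + 1) q" using gpart_step[of "int i + 1" q] by simp
  also have "\<dots> < gpart S (int i) r" by (rule gpart_strict(2)[OF V(1) r(1) True q(2)])
  finally show ?thesis using gpart_step[of "int i" r] by simp
next
  case False
  have "gpart T (int i) r \<le> gpart T (int i) q"
    using gpart_strict(1)[OF V(2) q(1) _ r(2), of "int i"] False by (cases "q = r") auto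
  also have "\<dots> \<le> gpart T (int i + 1) q" using grow_mono[of "int i" "int i + 1" T q] by (simp add: gpart_def)
  finally show ?thesis by simp
qed

lemma gpart_same_neq:
  assumes q: "1 \<le> q" "q \<le> int m" "q \<noteq> r"
  shows "gpart T (int i) r \<noteq> gpart T (int i) q" "gpart T (int i) r - 1 \<noteq> gpart T (int i) q"
proof -
  have *: "gpart U j r \<noteq> gpart U j q" if "U \<in> lsk_verts n D" for U j
    using gpart_strict(1)[OF that, of r q j] gpart_strict(1)[OF that, of q r j] q r by (cases "q < r") auto
  show "gpart T (int i) r \<noteq> gpart T (int i) q" using *[OF V(2)] .
  show "gpart T (int i) r - 1 \<noteq> gpart T (int i) q"
    using *[OF V(1), of "int i"] gpart_step[of "int i" r] gpart_step[of "int i" q] q by simp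
qed

text \<open>With X = - b / c and Y = a / d, the step formula gives a c / (b d) as the ratio of the
  norms of \<open>T\<close> and \<open>S\<close>, which is - Y / X.\<close>

lemma step_XY:
  "Xval m P Q T S \<noteq> 0" "Yval m P Q S T \<noteq> 0"
  "gt_norm n m (gpart S) * Yval m P Q S T = - Xval m P Q T S * gt_norm n m (gpart T)"
proof -
  define a where "a = (\<Prod>q\<in>{1..int m}. complex_of_int (gpart T (int i) r - gpart T (int i - 1) q))"
  define b where "b = (\<Prod>q\<in>{1..int m}. complex_of_int (gpart T (int i) r - gpart T (int i + 1) q - 1))"
  define c where "c = (\<Prod>q\<in>{1..int m} - {r}. complex_of_int (gpart T (int i) r - gpart T (int i) q - 1))"
  define d where "d = (\<Prod>q\<in>{1..int m} - {r}. complex_of_int (gpart T (int i) r - gpart T (int i) q))"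
  have a: "a \<noteq> 0" unfolding a_def using gpart_lower_neq by (simp del: of_int_diff)
  have nb: "complex_of_int (gpart T (int i) r - gpart T (int i + 1) q - 1) \<noteq> 0" if "1 \<le> q" "q \<le> int m" for q
    unfolding of_int_eq_0_iff using gpart_upper_neq[OF that] by linarith
  have b: "b \<noteq> 0" unfolding b_def using nb by (simp del: of_int_diff)
  have nc: "complex_of_int (gpart T (int i) r - gpart T (int i) q - 1) \<noteq> 0" if "1 \<le> q" "q \<le> int m" "q \<noteq> r" for q
    unfolding of_int_eq_0_iff using gpart_same_neq(2)[OF that] by linarith
  have c: "c \<noteq> 0" unfolding c_def using nc by (simp del: of_int_diff)
  have d: "d \<noteq> 0" unfolding d_def using gpart_same_neq(1) by (simp del: of_int_diff)
  have X: "Xval m P Q T S = - b / c" unfolding Xval_gpart b_def c_def ..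
  have Y: "Yval m P Q S T = a / d" unfolding Yval_gpart a_def d_def ..
  show "Xval m P Q T S \<noteq> 0" "Yval m P Q S T \<noteq> 0" unfolding X Y using a b c d by auto
  have "gt_norm n m (gpart T) = gt_norm n m (gpart S) *
    ((\<Prod>q\<in>{1..int m}. of_int (gpart T (int i) r - gpart T (int i - 1) q)) /
     (\<Prod>q\<in>{1..int m}. of_int (gpart T (int i) r - gpart T (int i + 1) q - 1))) *
    (\<Prod>q\<in>{1..int m} - {r}. of_int (gpart T (int i) r - gpart T (int i) q - 1) /
      of_int (gpart T (int i) r - gpart T (int i) q))"
  proof (rule gt_norm_step[OF _ _ r gpart_step gpart_lower_neq gpart_upper_neq])
    show "1 \<le> int i" "int i < int n" using i by auto
    show "gpart S (int i) p \<noteq> gpart S (int i) q" if "1 \<le> p" "p < q" "q \<le> int m" for p q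
      using gpart_strict(1)[OF V(1) that, of "int i"] by auto
  qed
  then have "gt_norm n m (gpart T) = gt_norm n m (gpart S) * (a / b) * (c / d)"
    unfolding a_def b_def c_def d_def prod_dividef .
  then show "gt_norm n m (gpart S) * Yval m P Q S T = - Xval m P Q T S * gt_norm n m (gpart T)"
    unfolding X Y using a b c d by (simp add: field_simps)
qed

end

lemma edge_XY:
  assumes e: "(S, i, T) \<in> lsk_edges n D"
  shows "Xval m P Q T S \<noteq> 0" "Yval m P Q S T \<noteq> 0"
    "gt_norm n m (gpart S) * Yval m P Q S T = - Xval m P Q T S * gt_norm n m (gpart T)"
proof -
  obtain r where "1 \<le> r" "r \<le> int m" "1 \<le> i" "i < n" "S \<in> lsk_verts n D" "T \<in> lsk_verts n D"
    "\<And>j p. grow T j p = grow S j p + (if j = int i \<and> p = r then 1 else 0)"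
    using edge_gpart[OF e] by blast
  note * = step_XY[OF this]
  show "Xval m P Q T S \<noteq> 0" "Yval m P Q S T \<noteq> 0"
    "gt_norm n m (gpart S) * Yval m P Q S T = - Xval m P Q T S * gt_norm n m (gpart T)"
    using * by blast+
qed

lemma gt_norm_gpart_nonzero: "T \<in> lsk_verts n D \<Longrightarrow> gt_norm n m (gpart T) \<noteq> 0"
  by (rule gt_norm_nonzero) (metis gpart_strict(1) less_irrefl)

section \<open>Columns of the skew shape: conjugate partitions and column complement\<close>

definition col_top :: "(nat \<Rightarrow> nat) \<Rightarrow> int \<Rightarrow> int" where
  "col_top F c = int (card {r. 1 \<le> r \<and> r \<le> int m \<and> c \<le> int (F (nat r))})"

lemma col_top_iff:
  assumes F: "\<And>r r'. 1 \<le> r \<Longrightarrow> r \<le> r' \<Longrightarrow> r' \<le> m \<Longrightarrow> F r' \<le> F r" and r: "1 \<le> r" "r \<le> int m"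
  shows "c \<le> int (F (nat r)) \<longleftrightarrow> r \<le> col_top F c"
proof -
  let ?X = "{r. 1 \<le> r \<and> r \<le> int m \<and> c \<le> int (F (nat r))}"
  have "?X = {0<..0 + int (card ?X)}"
  proof (rule int_initial_segment[where b = "int m"])
    fix x y :: int assume x: "x \<in> ?X" "0 < y" "y \<le> x"
    then have "F (nat x) \<le> F (nat y)" by (intro F) auto
    then show "y \<in> ?X" using x by auto
  qed auto
  then have "r \<in> ?X \<longleftrightarrow> r \<in> {0<..col_top F c}" unfolding col_top_def by simp
  then show ?thesis using r by auto
qed

lemma col_top_le: "col_top F c \<le> int m"
proof -
  have "card {r. 1 \<le> r \<and> r \<le> int m \<and> c \<le> int (F (nat r))} \<le> card {1..int m}"
    by (rule card_mono) auto
  then show ?thesis by (simp add: col_top_def)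
qed

lemma col_top_anti: "c \<le> c' \<Longrightarrow> col_top F c' \<le> col_top F c"
proof -
  assume "c \<le> c'"
  then have "card {r. 1 \<le> r \<and> r \<le> int m \<and> c' \<le> int (F (nat r))} \<le>
    card {r. 1 \<le> r \<and> r \<le> int m \<and> c \<le> int (F (nat r))}"
    by (intro card_mono) (auto intro: finite_subset[of _ "{1..int m}"])
  then show ?thesis by (simp add: col_top_def)
qed

definition cols :: "int set" where "cols = snd ` D"

lemma D_column: "(r, c) \<in> D \<longleftrightarrow> col_top Q c < r \<and> r \<le> col_top P c"
proof (cases "1 \<le> r \<and> r \<le> int m")
  case True
  then show ?thesis using col_top_iff[of P r c] col_top_iff[of Q r c] P_anti Q_anti
    by (auto simp: D_iff not_le[symmetric])
next
  case False
  have "0 \<le> col_top Q c" by (simp add: col_top_def)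
  then show ?thesis using False col_top_le[of P c] by (auto simp: D_iff)
qed

lemma column_set: "{r. (r, c) \<in> D} = {col_top Q c<..col_top P c}"
  by (auto simp: D_column)

lemma cols_iff: "c \<in> cols \<longleftrightarrow> col_top Q c < col_top P c"
proof
  assume "col_top Q c < col_top P c"
  then have "(col_top P c, c) \<in> D" by (simp add: D_column)
  then show "c \<in> cols" unfolding cols_def by force
qed (auto simp: cols_def D_column)

lemma finite_D: "finite D"
proof -
  have "D \<subseteq> (\<Union>r\<in>{1..int m}. {r} \<times> {int (Q (nat r))<..int (P (nat r))})" by (auto simp: D_iff)
  moreover have "finite \<dots>" by simp
  ultimately show ?thesis by (rule finite_subset)
qed

lemma finite_cols: "finite cols" by (simp add: cols_def finite_D)

lemma col_len: "col_top P c \<le> col_top Q c + int n"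
  using col_card[of c] unfolding column_set by simp

lemma shape_D: "column_shape cols (col_top Q) (col_top P) D"
proof -
  have "D = {(r, c). c \<in> cols \<and> col_top Q c < r \<and> r \<le> col_top P c}"
  proof (intro set_eqI)
    fix x show "x \<in> D \<longleftrightarrow> x \<in> {(r, c). c \<in> cols \<and> col_top Q c < r \<and> r \<le> col_top P c}"
      by (cases x) (auto simp: D_column cols_iff)
  qed
  then show ?thesis unfolding column_shape_def using finite_cols cols_iff col_top_anti
    by (auto simp: less_imp_le)
qed

lemma sigD_D: "sigD n D = {(r, c). c \<in> cols \<and> col_top P c < r \<and> r \<le> col_top Q c + int n}"
proof -
  have "(r, c) \<in> sigD n D \<longleftrightarrow> c \<in> cols \<and> col_top P c < r \<and> r \<le> col_top Q c + int n" for r c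
  proof (cases "c \<in> cols")
    case True
    then have l: "col_top Q c < col_top P c" by (simp add: cols_iff)
    \<comment> \<open>Hence the offset in \<open>sigD\<close> is \<open>col_top Q c\<close> and the
      old column ends in row \<open>col_top P c\<close>.\<close>
    then have "Min {col_top Q c<..col_top P c} = col_top Q c + 1" by (intro Min_eqI) auto
    then show ?thesis unfolding sigD_def column_set using True l by (force simp: Let_def D_column)
  next
    case False
    then show ?thesis unfolding sigD_def by (force simp: cols_def)
  qed
  then show ?thesis by auto
qed

lemma shape_sigD: "column_shape cols (col_top P) (\<lambda>c. col_top Q c + int n) (sigD n D)"
  unfolding column_shape_def sigD_D using finite_cols col_len col_top_anti by (auto simp: less_imp_le)

end

lemma shape_rotD:
  assumes "column_shape C a b D"
  shows "column_shape (uminus ` C) (\<lambda>c. - b (- c) - 1) (\<lambda>c. - a (- c) - 1) (rotD D)"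
proof -
  have D: "D = {(r, c). c \<in> C \<and> a c < r \<and> r \<le> b c}" and fC: "finite C" using assms by (auto simp: column_shape_def)
  have "(r, c) \<in> rotD D \<longleftrightarrow> (- r, - c) \<in> D" for r c by (force simp: rotD_def)
  then have "rotD D = {(r, c). c \<in> uminus ` C \<and> - b (- c) - 1 < r \<and> r \<le> - a (- c) - 1}"
    unfolding D by force
  moreover have "a c \<le> b c" "c < c' \<Longrightarrow> c' \<in> C \<Longrightarrow> a c' \<le> a c \<and> b c' \<le> b c" if "c \<in> C" for c c'
    using assms that unfolding column_shape_def by blast+
  ultimately show ?thesis unfolding column_shape_def using fC by fastforce
qed

section \<open>Gelfand-Tsetlin modules\<close>

lemma suppg_proportional:
  assumes fB: "finite (bas V)" and w: "weight_basis n V I w" and v: "weight_basis n V I v"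
    and p: "proportional_on I w v"
  shows "suppg n V I w = suppg n V I v"
proof -
  obtain u where fI: "finite I" and u: "dual_pair (bas V) I w u"
    using w weight_basis_iff[OF fB] by blast
  obtain u' where u': "dual_pair (bas V) I v u'"
    using v weight_basis_iff[OF fB] by blast
  obtain a where a: "\<And>r. r \<in> I \<Longrightarrow> a r \<noteq> 0 \<and> w r = (\<lambda>b. a r * v r b)"
    using p by (auto simp: proportional_on_def)
  obtain a' where a': "\<And>r. r \<in> I \<Longrightarrow> a' r \<noteq> 0 \<and> u r = (\<lambda>b. a' r * u' r b)"
    using proportional_dual[OF fB fI u u' p] by (auto simp: proportional_on_def)
  have "mcoef (bas V) w u M t s = a' t * a s * mcoef (bas V) v u' M t s" if "t \<in> I" "s \<in> I" for M t s
    using a[OF that(2)] a'[OF that(1)] by (simp add: mcoef_def sum_distrib_left mult_ac)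
  then have "mcoef (bas V) w u M t s \<noteq> 0 \<longleftrightarrow> mcoef (bas V) v u' M t s \<noteq> 0" if "t \<in> I" "s \<in> I" for M t s
    using that a a' by simp
  then show ?thesis unfolding suppg_dual_pair[OF fB fI u] suppg_dual_pair[OF fB fI u'] by blast
qed

text \<open>Records where the coefficients of x and y vanish but not their values, so the notion is
  stable under transposition and change of sign.\<close>

definition supported_on :: "nat \<Rightarrow> 'v smod \<Rightarrow> 'v set \<Rightarrow> ('v \<times> nat \<times> 'v) set \<Rightarrow> bool" where
  "supported_on n V I E \<longleftrightarrow> bas V = I \<and> (\<forall>i\<in>{1..n - 1}. \<forall>a\<in>I. \<forall>b\<in>I.
    (xop V i b a \<noteq> 0 \<longleftrightarrow> (a, i, b) \<in> E) \<and> (yop V i a b \<noteq> 0 \<longleftrightarrow> (a, i, b) \<in> E) \<and>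
    hop V i a b = (if a = b then of_int (mval E i a) else 0))"

text \<open>The constant lower bound \<alpha> is the Young condition: all columns begin in row
  \<alpha> + 1.\<close>

locale gt_module =
  fixes n :: nat and C :: "int set" and \<alpha> :: int and \<beta> :: "int \<Rightarrow> int"
    and V :: "'v smod" and I :: "'v set" and E :: "('v \<times> nat \<times> 'v) set"
    and h :: "'v \<Rightarrow> nat \<Rightarrow> int \<Rightarrow> int"
  assumes graph: "cpgraph n C (\<lambda>_. \<alpha>) \<beta> I E h"
    and finite_I: "finite I" and I_nonempty: "I \<noteq> {}"
    and supported: "supported_on n V I E"
    and n_pos: "1 \<le> n"
begin

definition jmax :: "nat \<Rightarrow> 'v \<Rightarrow> bool" where
  "jmax k s \<longleftrightarrow> (\<forall>i u. i \<le> k \<longrightarrow> (s, i, u) \<notin> E)"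

text \<open>Edges of color at most k stay inside such a class, and each class has exactly one
  k-maximal element (\<open>jmax_exists\<close>, \<open>jmax_unique\<close>); the classes are
  therefore the components for the colors 1..k.\<close>

definition above :: "nat \<Rightarrow> 'v \<Rightarrow> 'v \<Rightarrow> bool" where
  "above k s t \<longleftrightarrow> (\<forall>i>k. h s i = h t i)"

lemma above_trans: "above k s t \<Longrightarrow> above k t u \<Longrightarrow> above k s u"
  by (simp add: above_def)

lemma above_sym: "above k s t \<Longrightarrow> above k t s"
  by (simp add: above_def)

lemma above_refl: "above k s s"
  by (simp add: above_def)

lemma above_mono: "above k s t \<Longrightarrow> k \<le> l \<Longrightarrow> above l s t"
  by (simp add: above_def)

lemma finite_C: "finite C"
  using graph by (simp add: cpgraph_def)

lemmas mem = cpgraph_mem[OF graph]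
lemmas edge_iff = cpgraph_edge_iff[OF graph]
lemmas h_inj = cpgraph_inj[OF graph]

lemma h_outside: "s \<in> I \<Longrightarrow> n < i \<or> c \<notin> C \<Longrightarrow> h s i c = 0"
  using mem[of s] by (auto simp: colpat_def)

lemma h_ends: "s \<in> I \<Longrightarrow> c \<in> C \<Longrightarrow> h s 0 c = \<alpha>" "s \<in> I \<Longrightarrow> c \<in> C \<Longrightarrow> h s n c = \<beta> c"
  using mem[of s] by (auto simp: colpat_def)

lemma h_mono: "s \<in> I \<Longrightarrow> c \<in> C \<Longrightarrow> i \<le> j \<Longrightarrow> j \<le> n \<Longrightarrow> h s i c \<le> h s j c"
  using colpat_mono[OF mem[of s]] by blast

lemma h_step: "s \<in> I \<Longrightarrow> c \<in> C \<Longrightarrow> i < n \<Longrightarrow> h s (Suc i) c \<le> h s i c + 1"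
  using mem[of s] by (auto simp: colpat_def)

lemma h_upper: "s \<in> I \<Longrightarrow> c \<in> C \<Longrightarrow> i \<le> n \<Longrightarrow> h s i c \<le> \<alpha> + int i"
  using colpat_mono[OF mem[of s], of c 0 i] h_ends(1)[of s c] by simp

lemma h_lower: "s \<in> I \<Longrightarrow> c \<in> C \<Longrightarrow> i \<le> n \<Longrightarrow> \<alpha> \<le> h s i c"
  using h_mono[of s c 0 i] h_ends(1)[of s c] by simp

lemma h_anti: "s \<in> I \<Longrightarrow> i \<le> n \<Longrightarrow> c \<in> C \<Longrightarrow> c' \<in> C \<Longrightarrow> c \<le> c' \<Longrightarrow> h s i c' \<le> h s i c"
  using colpat_anti[OF mem] by blast

lemma edge_above: "(s, i, u) \<in> E \<Longrightarrow> i \<le> k \<Longrightarrow> above k s u"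
  unfolding above_def edge_iff by (auto simp: bump_def fun_eq_iff)

lemma jmax_zero: "jmax 0 s"
  unfolding jmax_def edge_iff by auto

lemma above_top: "s \<in> I \<Longrightarrow> t \<in> I \<Longrightarrow> above (n - 1) s t"
  unfolding above_def
proof (intro allI impI ext)
  fix i c assume st: "s \<in> I" "t \<in> I" and i: "n - 1 < i"
  show "h s i c = h t i c"
  proof (cases "i = n \<and> c \<in> C")
    case False
    then have "n < i \<or> c \<notin> C" using i n_pos by linarith
    then show ?thesis using h_outside st by metis
  qed (use h_ends st in auto)
qed

lemma above_zero: "s \<in> I \<Longrightarrow> t \<in> I \<Longrightarrow> above 0 s t \<Longrightarrow> s = t"
proof (rule h_inj)
  assume st: "s \<in> I" "t \<in> I" "above 0 s t"
  show "h s = h t"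
  proof
    fix i show "h s i = h t i"
    proof (cases "i = 0")
      case True
      have "h s 0 c = h t 0 c" for c using h_ends(1) h_outside st by (cases "c \<in> C") auto
      then show ?thesis using True by auto
    qed (use st in \<open>auto simp: above_def\<close>)
  qed
qed

text \<open>In a \<open>k\<close>-maximal pattern no entry at a level \<open>i \<le> k\<close> can be raised; checking this at the
  lowest level and then at the leftmost column where an entry is too small forces every entry to
  its upper bound.\<close>
lemma jmax_step:
  assumes s: "s \<in> I" and j: "jmax k s" and k: "k < n"
  shows "1 \<le> i \<Longrightarrow> i \<le> k \<Longrightarrow> c \<in> C \<Longrightarrow> h s i c = min (\<alpha> + int i) (h s (i + 1) c)"
proof (induction i arbitrary: c rule: less_induct)
  case (less i)
  let ?m = "\<lambda>c. min (\<alpha> + int i) (h s (i + 1) c)"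
  define B where "B = {c \<in> C. h s i c < ?m c}"
  have fB: "finite B" using finite_C by (simp add: B_def)
  have i: "1 \<le> i" "i < n" "i \<le> n" "i + 1 \<le> n" using less.prems k by auto
  have le: "h s i d \<le> ?m d" if "d \<in> C" for d
    using h_upper[OF s that i(3)] h_mono[OF s that, of i "i + 1"] i by simp
  have "B = {}"
  proof (rule ccontr)
    assume "B \<noteq> {}"
    define c where "c = Min B"
    have "c \<in> B" using Min_in[OF fB \<open>B \<noteq> {}\<close>] by (simp add: c_def)
    then have c: "c \<in> C" "h s i c < ?m c" by (auto simp: B_def)
    have "bump i c (h s) \<in> colpat n C (\<lambda>_. \<alpha>) \<beta>"
    proof (rule bump_colpat[OF mem[OF s] i(1,2) c(1)])
      show "h s (i + 1) c = h s i c + 1" using h_step[OF s c(1) i(2)] c(2) by simp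
      show "h s (i - 1) c = h s i c"
      proof (cases "i = 1")
        case True
        then show ?thesis using h_ends(1)[OF s c(1)] h_lower[OF s c(1) i(3)] c(2) by simp
      next
        case False
        \<comment> \<open>The minimum at level i - 1 is attained by the second term, because the
          entry at level i is below its ceiling \<alpha> + i.\<close>
        then have "h s (i - 1) c = min (\<alpha> + int (i - 1)) (h s (i - 1 + 1) c)"
          using less.prems c(1) by (intro less.IH) auto
        then show ?thesis using c(2) i by simp
      qed
      fix d assume d: "d \<in> C" "d < c"
      then have "d \<notin> B" using Min_le[OF fB, of d] by (auto simp: c_def)
      then have "?m d \<le> h s i d" using d by (auto simp: B_def)
      moreover have "h s (i + 1) c \<le> h s (i + 1) d" using h_anti[OF s i(4)] d c(1) by simp
      ultimately show "h s i c < h s i d" using c(2) by linarith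
    qed
    then obtain u where "(s, i, u) \<in> E" using cpgraph_bump_up[OF graph s i(1,2) c(1)] by blast
    then show False using j less.prems by (auto simp: jmax_def)
  qed
  then have "\<not> h s i c < ?m c" using less.prems by (auto simp: B_def)
  then show ?case using le less.prems by force
qed

lemma jmax_form:
  assumes s: "s \<in> I" and j: "jmax k s" and k: "k < n" and i: "i \<le> k" and c: "c \<in> C"
  shows "h s i c = min (\<alpha> + int i) (h s (k + 1) c)"
proof -
  have *: "h s i c = min (\<alpha> + int i) (h s (i + 1) c)" if "i \<le> k" for i
  proof (cases "i = 0")
    case True
    then show ?thesis using h_ends(1)[OF s c] h_lower[OF s c, of 1] n_pos by simp
  qed (use jmax_step[OF s j k _ that c] in simp)
  from i show ?thesis
  proof (induction i rule: inc_induct)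
    case base
    then show ?case using * by simp
  next
    case (step i)
    then show ?case using *[of i] by simp
  qed
qed

lemma jmax_unique:
  assumes s: "s \<in> I" "jmax k s" and t: "t \<in> I" "jmax k t" and k: "k < n" and a: "above k s t"
  shows "s = t"
proof (rule h_inj[OF s(1) t(1)], intro ext)
  fix i c
  show "h s i c = h t i c"
  proof (cases "k < i")
    case False
    show ?thesis
    proof (cases "c \<in> C")
      case True
      have "h s (k + 1) = h t (k + 1)" using a by (simp add: above_def)
      then show ?thesis using jmax_form[OF s k _ True, of i] jmax_form[OF t k _ True, of i] False by simp
    qed (use h_outside s t in simp)
  qed (use a in \<open>simp add: above_def\<close>)
qed

definition height :: "'v \<Rightarrow> int" where
  "height s = (\<Sum>i\<le>n. rowsum C (h s) i)"

lemma edge_rowsum: "(s, i, t) \<in> E \<Longrightarrow> rowsum C (h t) j = rowsum C (h s) j + (if j = i then 1 else 0)"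
  unfolding edge_iff using rowsum_bump[OF finite_C] by auto

lemma edge_height: "(s, i, t) \<in> E \<Longrightarrow> height t = height s + 1"
proof -
  assume e: "(s, i, t) \<in> E"
  then have "i \<le> n" unfolding edge_iff by simp
  have "height t = (\<Sum>j\<le>n. rowsum C (h s) j + (if j = i then 1 else 0))"
    unfolding height_def by (rule sum.cong) (simp_all add: edge_rowsum[OF e])
  then show ?thesis using \<open>i \<le> n\<close> by (simp add: sum.distrib height_def)
qed

lemma jmax_exists:
  assumes s: "s \<in> I"
  obtains t where "t \<in> I" "jmax k t" "above k t s"
proof -
  let ?A = "{t \<in> I. above k t s}"
  have "finite (height ` ?A)" "height ` ?A \<noteq> {}" using finite_I s above_refl by auto
  then have "Max (height ` ?A) \<in> height ` ?A" by (rule Max_in)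
  then obtain t where t: "t \<in> ?A" "height t = Max (height ` ?A)" by force
  have "jmax k t" unfolding jmax_def
  proof (intro allI impI notI)
    fix i u assume i: "i \<le> k" and e: "(t, i, u) \<in> E"
    have "above k u s" using above_trans[OF above_sym[OF edge_above[OF e i]]] t by blast
    then have "u \<in> ?A" using e unfolding edge_iff by blast
    then have "height u \<le> height t" unfolding t(2) using finite_I by (intro Max_ge) auto
    then show False using edge_height[OF e] by simp
  qed
  then show thesis using that t by blast
qed

text \<open>Suppose the edges raise different columns c and c'. Level k - 1 of \<open>u\<close> is
  computed by \<open>jmax_form\<close> from \<open>s\<close> and from \<open>s'\<close>, and the two
  results agree only if u has height \<alpha> + k at level k in both columns. Then one of
  \<open>s\<close>, \<open>s'\<close> increases from the left column to the right one.\<close>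

lemma jmax_edge_unique:
  assumes e: "(s, k, u) \<in> E" "(s', k, u) \<in> E" and j: "jmax (k - 1) s" "jmax (k - 1) s'"
  shows "s = s'"
proof -
  obtain c where s: "s \<in> I" "1 \<le> k" "k < n" and c: "c \<in> C" "h u = bump k c (h s)"
    using e(1) unfolding edge_iff by blast
  obtain c' where s': "s' \<in> I" and c': "c' \<in> C" "h u = bump k c' (h s')"
    using e(2) unfolding edge_iff by blast
  have u: "u \<in> I" using e unfolding edge_iff by blast
  have hs: "h s i d = h u i d - (if i = k \<and> d = c then 1 else 0)" for i d
    using c(2) by (simp add: bump_def)
  have hs': "h s' i d = h u i d - (if i = k \<and> d = c' then 1 else 0)" for i d
    using c'(2) by (simp add: bump_def)
  have k: "k - 1 < n" "k - 1 + 1 = k" "k - 1 \<noteq> k" "k \<le> n" using s by auto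
  have f: "h u (k - 1) d = min (\<alpha> + int (k - 1)) (h s k d)" if "d \<in> C" for d
    using jmax_form[OF s(1) j(1) k(1) order_refl that] hs[of "k - 1" d] k by simp
  have f': "h u (k - 1) d = min (\<alpha> + int (k - 1)) (h s' k d)" if "d \<in> C" for d
    using jmax_form[OF s' j(2) k(1) order_refl that] hs'[of "k - 1" d] k by simp
  show ?thesis
  proof (cases "c = c'")
    case True
    then have "h s = h s'" using hs hs' by (auto simp: fun_eq_iff)
    then show ?thesis using h_inj s(1) s' by blast
  next
    case False
    have 1: "h u k c = \<alpha> + int k"
      using f[OF c(1)] f'[OF c(1)] hs[of k c] hs'[of k c] False h_upper[OF u c(1) k(4)] s(2)
      by (auto simp: min_def split: if_splits)
    have 2: "h u k c' = \<alpha> + int k"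
      using f[OF c'(1)] f'[OF c'(1)] hs[of k c'] hs'[of k c'] False h_upper[OF u c'(1) k(4)] s(2)
      by (auto simp: min_def split: if_splits)
    have "c < c' \<Longrightarrow> False" using h_anti[OF s(1) k(4) c(1) c'(1)] hs[of k c] hs[of k c'] 1 2 by simp
    moreover have "c' < c \<Longrightarrow> False" using h_anti[OF s' k(4) c'(1) c(1)] hs'[of k c] hs'[of k c'] 1 2 by simp
    ultimately show ?thesis using False by force
  qed
qed

text \<open>The order in which the basis vectors of a \<open>k\<close>-component are generated from its maximal one.\<close>
definition \<nu> :: "nat \<Rightarrow> 'v \<Rightarrow> int" where
  "\<nu> k s = (\<Sum>c\<in>C. h s k c + min (\<alpha> + int k - 1) (h s k c))"

lemma \<nu>_above: "above (k - 1) s t \<Longrightarrow> 1 \<le> k \<Longrightarrow> \<nu> k s = \<nu> k t"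
  by (simp add: \<nu>_def above_def)

lemma \<nu>_edge:
  assumes e: "(s, k, u) \<in> E"
  shows "\<nu> k s < \<nu> k u"
proof -
  obtain c where c: "c \<in> C" "h u = bump k c (h s)" using e unfolding edge_iff by blast
  show ?thesis unfolding \<nu>_def
    by (rule sum_strict_mono_ex1[OF finite_C]) (use c in \<open>auto simp: bump_def min_def\<close>)
qed

text \<open>To get from s to s', column c' is lowered and column c raised. As s is (k - 1)-maximal,
  c' must stand at its ceiling \<alpha> + k, while c lies at least two below the ceiling. The term
  with the minimum in \<open>\<nu>\<close> counts the last unit below the ceiling only once, so the
  move is a net gain.\<close>

lemma \<nu>_sibling:
  assumes e: "(s, k, u) \<in> E" "(s', k, u) \<in> E" and j: "jmax (k - 1) s" and ne: "s' \<noteq> s"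
  shows "\<nu> k s < \<nu> k s'"
proof -
  obtain c where s: "s \<in> I" "1 \<le> k" "k < n" and c: "c \<in> C" "h u = bump k c (h s)"
    using e(1) unfolding edge_iff by blast
  obtain c' where s': "s' \<in> I" and c': "c' \<in> C" "h u = bump k c' (h s')"
    using e(2) unfolding edge_iff by blast
  have u: "u \<in> I" using e unfolding edge_iff by blast
  have cc: "c \<noteq> c'"
  proof
    assume "c = c'"
    have "h s' i d = h s i d" for i d
      using fun_cong[OF fun_cong[OF c(2)], of i d] fun_cong[OF fun_cong[OF c'(2)], of i d] \<open>c = c'\<close>
      by (auto simp: bump_def split: if_splits)
    then show False using h_inj[OF s' s(1)] ne by blast
  qed
  have hs': "h s' i d = h s i d + (if i = k \<and> d = c then 1 else 0) - (if i = k \<and> d = c' then 1 else 0)" for i d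
    using fun_cong[OF fun_cong[OF c(2)], of i d] fun_cong[OF fun_cong[OF c'(2)], of i d]
    by (auto simp: bump_def split: if_splits)
  have k: "k - 1 < n" "k - 1 + 1 = k" "k - 1 \<noteq> k" "k \<le> n" using s by auto
  have f: "h s (k - 1) c' = min (\<alpha> + int (k - 1)) (h s k c')"
    using jmax_form[OF s(1) j k(1) order_refl c'(1)] k by simp
  have "h s' (k - 1) c' \<le> h s' k c'" by (rule h_mono[OF s' c'(1)]) (use k in auto)
  then have 1: "h s k c' = \<alpha> + int k"
    using f hs'[of "k - 1" c'] hs'[of k c'] cc k h_upper[OF s(1) c'(1) k(4)] s(2)
    by (auto simp: min_def split: if_splits)
  have "h u k c \<le> \<alpha> + int k" by (rule h_upper[OF u c(1) k(4)])
  then have 2: "h s k c \<le> \<alpha> + int k - 1" using c(2) by (simp add: bump_def)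
  have 3: "h s k c \<noteq> \<alpha> + int k - 1"
  proof
    assume a: "h s k c = \<alpha> + int k - 1"
    then have "c' < c" using h_anti[OF s(1) k(4) c(1) c'(1)] 1 cc by force
    then show False using h_anti[OF s' k(4) c'(1) c(1)] hs'[of k c] hs'[of k c'] a 1 cc by simp
  qed
  \<comment> \<open>A column contributes 2 per unit up to \<alpha> + k - 1 and 1 for the last unit,
    so c gains 2 and c' loses 1.\<close>
  have "h s' k d + min (\<alpha> + int k - 1) (h s' k d) =
    (h s k d + min (\<alpha> + int k - 1) (h s k d)) + ((if d = c then 2 else 0) + (if d = c' then - 1 else 0))" for d
    using hs'[of k d] 1 2 3 cc by (auto simp: min_def)
  then have "\<nu> k s' = \<nu> k s + 1"
    unfolding \<nu>_def using finite_C c(1) c'(1) by (simp add: sum.distrib)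
  then show ?thesis by simp
qed

lemma mval_rowsum: "t \<in> I \<Longrightarrow> 1 \<le> i \<Longrightarrow> i < n \<Longrightarrow>
    mval E i t = 2 * rowsum C (h t) i - rowsum C (h t) (i - 1) - rowsum C (h t) (i + 1)"
  by (rule mval_cpgraph[OF graph])

definition cartan :: "nat \<Rightarrow> nat \<Rightarrow> int" where
  "cartan j i = (if j = i then 2 else if j = i + 1 \<or> i = j + 1 then - 1 else 0)"

lemma mval_edge:
  assumes e: "(s, i, t) \<in> E" and j: "1 \<le> j" "j < n"
  shows "mval E j t = mval E j s + cartan j i"
proof -
  have st: "s \<in> I" "t \<in> I" "1 \<le> i" using e unfolding edge_iff by auto
  show ?thesis unfolding mval_rowsum[OF st(1) j] mval_rowsum[OF st(2) j] edge_rowsum[OF e]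
    using j st by (auto simp: cartan_def)
qed

text \<open>Weights are second differences of the row sums, and the row sums at levels 0 and n are
  fixed. The difference of two candidates is thus linear in the level and zero at both ends.\<close>

lemma rowsum_eq:
  assumes s: "s \<in> I" and t: "t \<in> I" and m: "\<And>i. i \<in> {1..n - 1} \<Longrightarrow> mval E i s = mval E i t" and i: "i \<le> n"
  shows "rowsum C (h s) i = rowsum C (h t) i"
proof -
  define d where "d i = rowsum C (h s) i - rowsum C (h t) i" for i
  have d0: "d 0 = 0" "d n = 0" using h_ends s t by (simp_all add: d_def rowsum_def)
  have "d i = int i * d 1 \<and> (i < n \<longrightarrow> d (Suc i) = int (Suc i) * d 1)" if "i \<le> n" for i
    using that
  proof (induction i)
    case 0
    then show ?case using d0 by simp
  next
    case (Suc i)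
    have "d (Suc (Suc i)) = int (Suc (Suc i)) * d 1" if l: "Suc i < n"
    proof -
      have "mval E (Suc i) s = mval E (Suc i) t" using l by (intro m) auto
      then have "2 * d (Suc i) = d i + d (Suc (Suc i))"
        using mval_rowsum[OF s, of "Suc i"] mval_rowsum[OF t, of "Suc i"] l by (simp add: d_def)
      then show ?thesis using Suc l by (simp add: algebra_simps)
    qed
    then show ?case using Suc by auto
  qed
  note * = this
  have "d 1 = 0" using *[of n] d0 n_pos by simp
  then have "d i = 0" using *[OF i] by simp
  then show ?thesis by (simp add: d_def)
qed

text \<open>For a (k - 1)-maximal pattern, consecutive row sums differ by the number of columns
  whose level-k height is at least \<alpha> + i. These columns form an initial segment of
  \<open>C\<close>, so their number determines them: the weight yields the conjugate of level k,
  hence level k, hence the pattern.\<close>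

lemma jmax_weight_unique:
  assumes s: "s \<in> I" "jmax (k - 1) s" and t: "t \<in> I" "jmax (k - 1) t" and k: "1 \<le> k" "k \<le> n"
    and a: "above k s t" and m: "\<And>i. i \<in> {1..n - 1} \<Longrightarrow> mval E i s = mval E i t"
  shows "s = t"
proof -
  have k': "k - 1 < n" "k - 1 + 1 = k" using k by auto
  have rs: "rowsum C (h r) i = (\<Sum>c\<in>C. min (\<alpha> + int i) (h r k c))"
    if r: "r \<in> I" "jmax (k - 1) r" and i: "i \<le> k" for r i
    unfolding rowsum_def
  proof (rule sum.cong)
    fix c assume c: "c \<in> C"
    show "h r i c = min (\<alpha> + int i) (h r k c)"
    proof (cases "i = k")
      case True
      then show ?thesis using h_upper[OF r(1) c k(2)] by simp
    next
      case False
      then show ?thesis using jmax_form[OF r k'(1) _ c, of i] i k by simp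
    qed
  qed simp
  define lev where "lev r i = {c \<in> C. \<alpha> + int i \<le> h r k c}" for r i
  have card_lev: "int (card (lev r i)) = rowsum C (h r) i - rowsum C (h r) (i - 1)"
    if r: "r \<in> I" "jmax (k - 1) r" and i: "1 \<le> i" "i \<le> k" for r i
  proof -
    have "rowsum C (h r) i - rowsum C (h r) (i - 1) = (\<Sum>c\<in>C. if \<alpha> + int i \<le> h r k c then 1 else 0)"
      unfolding rs[OF r i(2)] rs[OF r, of "i - 1", OF le_trans[OF diff_le_self i(2)]] sum_subtractf[symmetric]
      by (rule sum.cong) (use i in auto)
    also have "\<dots> = int (card (lev r i))" using finite_C by (simp add: lev_def sum.If_cases Int_def conj_commute)
    finally show ?thesis by simp
  qed
  have fl: "finite (lev r i)" for r i using finite_C by (simp add: lev_def)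
  have down: "c \<in> lev r i" if "r \<in> I" "c' \<in> lev r i" "c \<in> C" "c \<le> c'" for r i c c'
    using h_anti[OF that(1) k(2) that(3), of c'] that(2-4) by (auto simp: lev_def)
  have "lev s i = lev t i" if i: "1 \<le> i" "i \<le> k" for i
  proof -
    have c: "card (lev s i) = card (lev t i)"
      using card_lev[OF s i] card_lev[OF t i] rowsum_eq[OF s(1) t(1) m] i k by simp
    have "lev s i \<subseteq> lev t i \<or> lev t i \<subseteq> lev s i"
    proof (rule ccontr)
      assume "\<not> ?thesis"
      then obtain x y where "x \<in> lev s i" "x \<notin> lev t i" "y \<in> lev t i" "y \<notin> lev s i" by blast
      moreover have "x \<in> C" "y \<in> C" using calculation by (auto simp: lev_def)
      ultimately show False using down[OF s(1), of x i y] down[OF t(1), of y i x] by force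
    qed
    then show ?thesis using card_subset_eq[OF fl _ c] card_subset_eq[OF fl _ c[symmetric]] by auto
  qed
  then have lev: "\<alpha> + int i \<le> h s k c \<longleftrightarrow> \<alpha> + int i \<le> h t k c" if "1 \<le> i" "i \<le> k" "c \<in> C" for i c
    using that by (auto simp: lev_def set_eq_iff)
  have hk: "h s k c = h t k c" if c: "c \<in> C" for c
  proof -
    have b: "\<alpha> \<le> h s k c" "h s k c \<le> \<alpha> + int k" "\<alpha> \<le> h t k c" "h t k c \<le> \<alpha> + int k"
      using h_lower h_upper s(1) t(1) c k(2) by blast+
    show ?thesis
    proof (rule ccontr)
      assume "h s k c \<noteq> h t k c"
      then consider "h s k c < h t k c" | "h t k c < h s k c" by linarith
      then show False
      proof cases
        case 1
        then have "1 \<le> nat (h t k c - \<alpha>)" "nat (h t k c - \<alpha>) \<le> k" "\<alpha> + int (nat (h t k c - \<alpha>)) = h t k c"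
          using b by linarith+
        then show False using lev[of "nat (h t k c - \<alpha>)" c] c \<open>h s k c < h t k c\<close> by simp
      next
        case 2
        then have "1 \<le> nat (h s k c - \<alpha>)" "nat (h s k c - \<alpha>) \<le> k" "\<alpha> + int (nat (h s k c - \<alpha>)) = h s k c"
          using b by linarith+
        then show False using lev[of "nat (h s k c - \<alpha>)" c] c \<open>h t k c < h s k c\<close> by simp
      qed
    qed
  qed
  have "above (k - 1) s t" unfolding above_def
  proof (intro allI impI)
    fix i assume i: "k - 1 < i"
    show "h s i = h t i"
    proof (cases "i = k")
      case True
      have "h s k c = h t k c" for c using hk h_outside s(1) t(1) by (cases "c \<in> C") auto
      then show ?thesis using True by auto
    next
      case False
      then show ?thesis using a i by (auto simp: above_def)
    qed
  qed
  then show ?thesis using jmax_unique[OF s t k'(1)] by blast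
qed

section \<open>Highest weight vectors, generation and irreducibility\<close>

definition ev :: "'v \<Rightarrow> 'v \<Rightarrow> complex" where
  "ev s = (\<lambda>b. if b = s then 1 else 0)"

lemma ev_vecs: "s \<in> I \<Longrightarrow> ev s \<in> vecs I"
  by (auto simp: ev_def vecs_def)

lemma bas_V: "bas V = I"
  using supported by (simp add: supported_on_def)

lemma xop_V: "i \<in> {1..n - 1} \<Longrightarrow> s \<in> I \<Longrightarrow> t \<in> I \<Longrightarrow> xop V i t s \<noteq> 0 \<longleftrightarrow> (s, i, t) \<in> E"
  and yop_V: "i \<in> {1..n - 1} \<Longrightarrow> s \<in> I \<Longrightarrow> t \<in> I \<Longrightarrow> yop V i s t \<noteq> 0 \<longleftrightarrow> (s, i, t) \<in> E"
  and hop_V: "i \<in> {1..n - 1} \<Longrightarrow> s \<in> I \<Longrightarrow> t \<in> I \<Longrightarrow> hop V i s t = (if s = t then of_int (mval E i t) else 0)"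
  using supported by (auto simp: supported_on_def)

lemma mact_ev: "u \<in> I \<Longrightarrow> mact M I (ev u) = (\<lambda>b. if b \<in> I then M b u else 0)"
  unfolding mact_def ev_def using finite_I by (auto simp: sum_indicator)

lemma kernel_support:
  assumes v: "v \<in> vecs I" and k: "k < n" and z: "\<And>i. i \<in> {1..k} \<Longrightarrow> mact (xop V i) I v = (\<lambda>_. 0)"
    and s: "v s \<noteq> 0"
  shows "jmax k s"
  using k z s
proof (induction k arbitrary: s)
  case 0
  show ?case by (rule jmax_zero)
next
  case (Suc k)
  have IH: "jmax k r" if "v r \<noteq> 0" for r using Suc.IH[OF _ _ that] Suc.prems(1,2) by simp
  show ?case
  proof (rule ccontr)
    assume "\<not> jmax (Suc k) s"
    then obtain i u where i: "i \<le> Suc k" and e: "(s, i, u) \<in> E" by (auto simp: jmax_def)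
    have "\<not> i \<le> k" using IH[OF Suc.prems(3)] e by (auto simp: jmax_def)
    then have e: "(s, Suc k, u) \<in> E" using i e by (cases "i = Suc k") auto
    then have sI: "s \<in> I" "u \<in> I" unfolding edge_iff by auto
    have k: "Suc k \<in> {1..n - 1}" using Suc.prems(1) by auto
    \<comment> \<open>Any other source s' of an edge into u fails to be k-maximal, and by induction
      lies outside the support of v; one summand survives.\<close>
    have *: "xop V (Suc k) u s' * v s' = (if s = s' then 1 else 0) * (xop V (Suc k) u s * v s)"
      if s': "s' \<in> I" for s'
    proof (cases "s' = s \<or> v s' = 0")
      case False
      then have "(s', Suc k, u) \<notin> E" using jmax_edge_unique[OF e, of s'] IH[OF Suc.prems(3)] IH[of s'] by auto
      then show ?thesis using xop_V[OF k s' sI(2)] False by simp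
    qed auto
    have "mact (xop V (Suc k)) I v u = (\<Sum>s'\<in>I. xop V (Suc k) u s' * v s')"
      using sI by (simp add: mact_def)
    also have "\<dots> = (\<Sum>s'\<in>I. (if s = s' then 1 else 0) * (xop V (Suc k) u s * v s))"
      by (rule sum.cong[OF refl *])
    also have "\<dots> = xop V (Suc k) u s * v s" using sI finite_I by (simp only: sum_indicator)
    finally have "mact (xop V (Suc k)) I v u \<noteq> 0" using xop_V[OF k sI] e Suc.prems(3) by simp
    then show False using Suc.prems(2)[of "Suc k"] by simp
  qed
qed

lemma subspace_sum:
  assumes "(\<lambda>_. 0) \<in> U" "\<And>u v. u \<in> U \<Longrightarrow> v \<in> U \<Longrightarrow> (\<lambda>b. u b + v b) \<in> U"
    "\<And>u c. u \<in> U \<Longrightarrow> (\<lambda>b. c * u b) \<in> U" "\<And>s. s \<in> A \<Longrightarrow> c s \<noteq> 0 \<Longrightarrow> f s \<in> U"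
  shows "(\<lambda>b. \<Sum>s\<in>A. c s * f s b) \<in> (U :: ('v \<Rightarrow> complex) set)"
  using assms(4)
proof (induction A rule: infinite_finite_induct)
  case (insert x A)
  have "(\<lambda>b. c x * f x b) \<in> U" using insert.prems[of x] assms(1,3) by (cases "c x = 0") auto
  moreover have "(\<lambda>b. \<Sum>s\<in>A. c s * f s b) \<in> U" using insert by simp
  ultimately show ?case using assms(2) insert.hyps by simp
qed (use assms(1) in auto)

text \<open>The inner induction runs through the k-maximal elements of the class from the largest
  value of \<open>\<nu>\<close> downwards. For an edge r -> u of color k + 1, applying y to the
  vector of u gives a nonzero multiple of the vector of r plus siblings of r. The vertex u and those
  siblings have larger \<open>\<nu>\<close>, which depends only on level k + 1 and hence is shared
  with their k-maximal representatives; those are already in U. U need only be stable under the y of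
  color at most k, so that spans of basis vectors qualify.\<close>

lemma generated_by_max:
  fixes U :: "('v \<Rightarrow> complex) set"
  assumes U0: "(\<lambda>_. 0) \<in> U" and add: "\<And>u v. u \<in> U \<Longrightarrow> v \<in> U \<Longrightarrow> (\<lambda>b. u b + v b) \<in> U"
    and scale: "\<And>u c. u \<in> U \<Longrightarrow> (\<lambda>b. c * u b) \<in> U"
  shows "k < n \<Longrightarrow> (\<And>i u. i \<in> {1..k} \<Longrightarrow> u \<in> U \<Longrightarrow> mact (yop V i) I u \<in> U) \<Longrightarrow>
    t \<in> I \<Longrightarrow> jmax k t \<Longrightarrow> ev t \<in> U \<Longrightarrow> s \<in> I \<Longrightarrow> above k s t \<Longrightarrow> ev s \<in> U"
proof (induction k arbitrary: s t)
  case 0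
  then show ?case using above_zero by blast
next
  case (Suc k)
  let ?k = "Suc k"
  have kn: "?k \<in> {1..n - 1}" using Suc.prems(1) by auto
  have lower: "ev r \<in> U" if "q \<in> I" "jmax k q" "ev q \<in> U" "r \<in> I" "above k q r" for q r
    using Suc.IH[OF _ _ that(1-4) above_sym[OF that(5)]] Suc.prems(1,2) by auto
  define N where "N = Max (\<nu> ?k ` I)"
  have N: "\<nu> ?k r \<le> N" if "r \<in> I" for r unfolding N_def using finite_I that by auto
  have main: "ev r \<in> U" if "r \<in> I" "jmax k r" "above ?k r t" for r
    using that
  proof (induction "nat (N - \<nu> ?k r)" arbitrary: r rule: less_induct)
    case less
    have larger: "ev q \<in> U" if q: "q \<in> I" "above ?k q t" "\<nu> ?k r < \<nu> ?k q" for q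
    proof -
      obtain q' where q': "q' \<in> I" "jmax k q'" "above k q' q" using jmax_exists[OF q(1)] by blast
      have "\<nu> ?k q' = \<nu> ?k q" using \<nu>_above[of ?k q' q] q'(3) by simp
      then have "nat (N - \<nu> ?k q') < nat (N - \<nu> ?k r)" using q(3) N[OF q(1)] by simp
      moreover have "above ?k q' t" using above_trans[OF above_mono[OF q'(3)] q(2)] by simp
      ultimately have "ev q' \<in> U" using less.hyps q' by blast
      then show ?thesis using lower[OF q'(1,2) _ q(1) q'(3)] by blast
    qed
    show ?case
    proof (cases "jmax ?k r")
      case True
      then have "r = t" using jmax_unique[OF less.prems(1) True Suc.prems(3,4,1) less.prems(3)] by simp
      then show ?thesis using Suc.prems by simp
    next
      case False
      then obtain i u where i: "i \<le> ?k" and e: "(r, i, u) \<in> E" by (auto simp: jmax_def)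
      have "\<not> i \<le> k" using less.prems(2) e by (auto simp: jmax_def)
      then have e: "(r, ?k, u) \<in> E" using i e by (cases "i = ?k") auto
      then have uI: "u \<in> I" unfolding edge_iff by blast
      have au: "above ?k q t" if "(q, ?k, u) \<in> E" for q
        using above_trans[OF edge_above[OF that order_refl]] above_trans[OF above_sym[OF edge_above[OF e order_refl]] less.prems(3)]
        by blast
      have "above ?k u t" using above_trans[OF above_sym[OF edge_above[OF e order_refl]] less.prems(3)] .
      then have "ev u \<in> U" using larger uI \<nu>_edge[OF e] by blast
      then have yu: "mact (yop V ?k) I (ev u) \<in> U" using Suc.prems(2)[of ?k] by simp
      define A where "A = I - {r}"
      define rest where "rest = (\<lambda>b. \<Sum>q\<in>A. yop V ?k q u * ev q b)"
      have "rest \<in> U" unfolding rest_def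
      proof (rule subspace_sum[OF U0 add scale])
        fix q assume q: "q \<in> A" "yop V ?k q u \<noteq> 0"
        then have "q \<in> I" "q \<noteq> r" by (auto simp: A_def)
        then have eq: "(q, ?k, u) \<in> E" "q \<noteq> r" "q \<in> I" using yop_V[OF kn _ uI] q(2) by blast+
        then have "\<nu> ?k r < \<nu> ?k q" using \<nu>_sibling[OF e eq(1)] less.prems(2) by simp
        then show "ev q \<in> U" using larger eq au by blast
      qed
      then have "(\<lambda>b. -1 * rest b) \<in> U" by (rule scale)
      then have "(\<lambda>b. mact (yop V ?k) I (ev u) b + -1 * rest b) \<in> U" by (rule add[OF yu])
      moreover have "(\<lambda>b. mact (yop V ?k) I (ev u) b + -1 * rest b) = (\<lambda>b. yop V ?k r u * ev r b)"
      proof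
        fix b
        have "rest b = (\<Sum>q\<in>A. (if b = q then 1 else 0) * yop V ?k q u)"
          unfolding rest_def ev_def by (simp add: mult.commute)
        also have "\<dots> = (if b \<in> A then yop V ?k b u else 0)"
        proof (cases "b \<in> A")
          case True
          then show ?thesis using sum_indicator(1)[of A b] finite_I by (simp add: A_def)
        next
          case False
          then show ?thesis by (auto intro!: sum.neutral)
        qed
        finally show "mact (yop V ?k) I (ev u) b + -1 * rest b = yop V ?k r u * ev r b"
          unfolding mact_ev[OF uI] using less.prems(1) by (auto simp: A_def ev_def)
      qed
      ultimately have "(\<lambda>b. yop V ?k r u * ev r b) \<in> U" by simp
      then have "(\<lambda>b. inverse (yop V ?k r u) * (yop V ?k r u * ev r b)) \<in> U" by (rule scale)
      then show ?thesis using yop_V[OF kn less.prems(1) uI] e by (simp add: mult.assoc[symmetric])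
    qed
  qed
  obtain s' where s': "s' \<in> I" "jmax k s'" "above k s' s" using jmax_exists[OF Suc.prems(6)] by blast
  have "above ?k s' t" using above_trans[OF above_mono[OF s'(3)] Suc.prems(7)] by simp
  then have "ev s' \<in> U" using main s' by blast
  then show ?case using lower[OF s'(1,2) _ Suc.prems(6) s'(3)] by blast
qed

lemma ev_expand: "v \<in> vecs I \<Longrightarrow> v = (\<lambda>b. \<Sum>s\<in>I. v s * ev s b)"
proof
  fix b assume v: "v \<in> vecs I"
  show "v b = (\<Sum>s\<in>I. v s * ev s b)"
  proof (cases "b \<in> I")
    case True
    then show ?thesis using sum_indicator(3)[OF finite_I True, of v] by (simp add: ev_def)
  next
    case False
    then have "v s * ev s b = 0" if "s \<in> I" for s using that by (auto simp: ev_def)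
    then have "(\<Sum>s\<in>I. v s * ev s b) = 0" by (simp add: sum.neutral)
    then show ?thesis using v False by (simp add: vecs_def)
  qed
qed

lemma max_unique:
  assumes "s \<in> I" "jmax (n - 1) s" "t \<in> I" "jmax (n - 1) t"
  shows "s = t"
  using jmax_unique[OF assms _ above_top[OF assms(1,3)]] n_pos by simp

lemma irreducible: "irreducible_mod n V"
proof -
  have "U = vecs I" if U: "submod n V U" and ne: "U \<noteq> {\<lambda>_. 0}" for U
  proof -
    have U0: "(\<lambda>_. 0) \<in> U" and add: "\<And>u v. u \<in> U \<Longrightarrow> v \<in> U \<Longrightarrow> (\<lambda>b. u b + v b) \<in> U"
      and scale: "\<And>u c. u \<in> U \<Longrightarrow> (\<lambda>b. c * u b) \<in> U" and UI: "U \<subseteq> vecs I"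
      and x: "\<And>i u. i \<in> {1..n - 1} \<Longrightarrow> u \<in> U \<Longrightarrow> mact (xop V i) I u \<in> U"
      and y: "\<And>i u. i \<in> {1..n - 1} \<Longrightarrow> u \<in> U \<Longrightarrow> mact (yop V i) I u \<in> U"
      using U unfolding submod_def bas_V by blast+
    have "\<exists>v\<in>U. v \<noteq> (\<lambda>_. 0) \<and> (\<forall>i\<in>{1..n - 1}. mact (xop V i) I v = (\<lambda>_. 0))"
    proof (rule ccontr)
      assume no: "\<not> ?thesis"
      obtain lb where lb: "\<And>s. s \<in> I \<Longrightarrow> lb \<le> height s"
        using finite_I by (intro that[of "Min (height ` I)"]) auto
      \<comment> \<open>Each x raises the height of every support point by one, so a submodule
        without a highest weight vector would contain nonzero vectors supported at arbitrarily large
        heights.\<close>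
      have "\<exists>v\<in>U. v \<noteq> (\<lambda>_. 0) \<and> (\<forall>s. v s \<noteq> 0 \<longrightarrow> lb + int j \<le> height s)" for j
      proof (induction j)
        case 0
        obtain v where "v \<in> U" "v \<noteq> (\<lambda>_. 0)" using ne U0 by blast
        then show ?case using lb UI unfolding vecs_def by (intro bexI[of _ v]) auto
      next
        case (Suc j)
        then obtain v where v: "v \<in> U" "v \<noteq> (\<lambda>_. 0)" "\<And>s. v s \<noteq> 0 \<Longrightarrow> lb + int j \<le> height s" by blast
        obtain i where i: "i \<in> {1..n - 1}" "mact (xop V i) I v \<noteq> (\<lambda>_. 0)" using no v by blast
        have "lb + int (Suc j) \<le> height s" if nz: "mact (xop V i) I v s \<noteq> 0" for s
        proof -
          have "(\<Sum>b\<in>I. xop V i s b * v b) \<noteq> 0" using nz by (auto simp: mact_def split: if_splits)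
          then obtain b where b: "b \<in> I" "xop V i s b * v b \<noteq> 0" by (meson sum.neutral)
          have "s \<in> I" using nz by (auto simp: mact_def split: if_splits)
          then have "(b, i, s) \<in> E" "v b \<noteq> 0" using xop_V[OF i(1) b(1)] b(2) by auto
          then show ?thesis using edge_height v(3)[of b] by fastforce
        qed
        then show ?case using x[OF i(1) v(1)] i(2) by blast
      qed
      moreover obtain ub where ub: "\<And>s. s \<in> I \<Longrightarrow> height s \<le> ub"
        using finite_I by (intro that[of "Max (height ` I)"]) auto
      ultimately obtain v where v: "v \<in> U" "v \<noteq> (\<lambda>_. 0)"
        "\<And>s. v s \<noteq> 0 \<Longrightarrow> lb + int (nat (ub - lb + 1)) \<le> height s" by blast
      then obtain s where s: "v s \<noteq> 0" by (auto simp: fun_eq_iff)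
      then have "s \<in> I" using v(1) UI by (auto simp: vecs_def)
      then show False using ub[of s] v(3)[OF s] by linarith
    qed
    then obtain v where v: "v \<in> U" "v \<noteq> (\<lambda>_. 0)" "\<And>i. i \<in> {1..n - 1} \<Longrightarrow> mact (xop V i) I v = (\<lambda>_. 0)"
      by blast
    then obtain t where t: "v t \<noteq> 0" by (auto simp: fun_eq_iff)
    have vI: "v \<in> vecs I" using v(1) UI by blast
    have tI: "t \<in> I" using t vI by (auto simp: vecs_def)
    have jm: "jmax (n - 1) s" if "v s \<noteq> 0" for s
      by (rule kernel_support[OF vI _ v(3) that]) (use n_pos in auto)
    have vt: "s = t" if "v s \<noteq> 0" for s
    proof -
      have "s \<in> I" using that vI by (auto simp: vecs_def)
      then show ?thesis using max_unique jm that t tI by blast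
    qed
    have "(\<lambda>b. inverse (v t) * v b) \<in> U" by (rule scale[OF v(1)])
    moreover have "(\<lambda>b. inverse (v t) * v b) = ev t"
    proof
      fix b show "inverse (v t) * v b = ev t b" using vt[of b] t by (cases "b = t") (auto simp: ev_def)
    qed
    ultimately have et: "ev t \<in> U" by simp
    have es: "ev s \<in> U" if "s \<in> I" for s
      by (rule generated_by_max[OF U0 add scale _ y tI jm[OF t] et that above_top[OF that tI]])
        (use n_pos in auto)
    have "w \<in> U" if "w \<in> vecs I" for w
      by (subst ev_expand[OF that]) (rule subspace_sum[OF U0 add scale es])
    then show ?thesis using UI by blast
  qed
  then show ?thesis unfolding irreducible_mod_submod bas_V using finite_I I_nonempty by blast
qed

lemma ev_dual: "dual_pair I I ev ev"
  unfolding dual_pair_def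
proof (intro conjI ballI)
  fix r r' assume r: "r \<in> I" "r' \<in> I"
  have "(\<Sum>b\<in>I. ev r b * ev r' b) = (\<Sum>b\<in>I. (if b = r then 1 else 0) * ev r' b)"
    by (simp add: ev_def)
  then show "(\<Sum>b\<in>I. ev r b * ev r' b) = (if r = r' then 1 else 0)"
    using sum_indicator(2)[OF finite_I r(1), of "ev r'"] by (simp add: ev_def)
  have "(\<Sum>s\<in>I. ev s r * ev s r') = (\<Sum>s\<in>I. (if r = s then 1 else 0) * ev s r')"
    by (simp add: ev_def)
  then show "(\<Sum>s\<in>I. ev s r * ev s r') = (if r = r' then 1 else 0)"
    using sum_indicator(1)[OF finite_I r(1), of "\<lambda>s. ev s r'"] by (auto simp: ev_def)
qed (simp_all add: ev_vecs)

lemma mcoef_ev: "t \<in> I \<Longrightarrow> s \<in> I \<Longrightarrow> mcoef I ev ev M t s = M t s"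
proof -
  assume ts: "t \<in> I" "s \<in> I"
  have "mcoef I ev ev M t s = (\<Sum>b\<in>I. (if b = t then 1 else 0) * (\<Sum>b'\<in>I. M b b' * (if b' = s then 1 else 0)))"
    unfolding mcoef_def ev_def by (simp add: sum_distrib_left mult.assoc)
  also have "\<dots> = (\<Sum>b'\<in>I. M t b' * (if b' = s then 1 else 0))" by (rule sum_indicator(2)[OF finite_I ts(1)])
  also have "\<dots> = M t s" by (rule sum_indicator(4)[OF finite_I ts(2)])
  finally show ?thesis .
qed

lemma finite_bas_V: "finite (bas V)"
  by (simp add: bas_V finite_I)

lemma ev_weight_basis: "weight_basis n V I ev"
  unfolding weight_basis_iff[OF finite_bas_V] bas_V
  using finite_I ev_dual by (auto simp: diag_on_def mcoef_ev hop_V)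

lemma ev_suppg: "suppg n V I ev = E"
proof -
  have "suppg n V I ev = {(s, i, t) |s i t. s \<in> I \<and> t \<in> I \<and> i \<in> {1..n - 1} \<and>
      (xop V i t s \<noteq> 0 \<or> yop V i s t \<noteq> 0)}"
    using suppg_dual_pair[of V I ev ev n] finite_I ev_dual unfolding bas_V by (auto simp: mcoef_ev)
  also have "\<dots> = E"
    using xop_V yop_V cpgraph_edges[OF graph] by blast
  finally show ?thesis .
qed

text \<open>All coordinates of d w_r - c w_r vanish, hence so does the vector. It is stated for any
  dual pair so that exchanging \<open>w\<close> and \<open>u\<close> yields the same for the dual
  basis.\<close>

lemma eigen_support:
  assumes dual: "dual_pair I I w u" and r: "r \<in> I" and nz: "w r s \<noteq> 0"
    and e: "\<And>t. t \<in> I \<Longrightarrow> (\<Sum>b\<in>I. u t b * d b * w r b) = (if t = r then c else 0)"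
  shows "d s = c"
proof -
  define z where "z b = d b * w r b - c * w r b" for b
  have "z \<in> vecs I" using dual r by (auto simp: z_def vecs_def dual_pair_def)
  then have "z = (\<lambda>b. \<Sum>t\<in>I. (\<Sum>b'\<in>I. u t b' * z b') * w t b)"
    by (rule dual_pair_expand[OF finite_I finite_I dual])
  moreover have "(\<Sum>b'\<in>I. u t b' * z b') = 0" if t: "t \<in> I" for t
  proof -
    have "(\<Sum>b'\<in>I. u t b' * z b') = (\<Sum>b\<in>I. u t b * d b * w r b) - c * (\<Sum>b'\<in>I. u t b' * w r b')"
      unfolding z_def by (simp add: sum_subtractf sum_distrib_left algebra_simps)
    then show ?thesis using e[OF t] dual t r by (simp add: dual_pair_def)
  qed
  ultimately have "z s = 0" by (simp add: fun_eq_iff)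
  then show ?thesis using nz by (simp add: z_def left_diff_distrib[symmetric])
qed

section \<open>Weight bases whose supporting graph lies in \<open>E\<close>\<close>

context
  fixes w u :: "'v \<Rightarrow> 'v \<Rightarrow> complex"
  assumes dual: "dual_pair I I w u"
    and diag: "\<And>i. i \<in> {1..n - 1} \<Longrightarrow> diag_on I I w u (hop V i)"
    and sub: "suppg n V I w \<subseteq> E"
begin

lemma coef_edge: "i \<in> {1..n - 1} \<Longrightarrow> s \<in> I \<Longrightarrow> t \<in> I \<Longrightarrow>
    mcoef I w u (xop V i) t s \<noteq> 0 \<or> mcoef I w u (yop V i) s t \<noteq> 0 \<Longrightarrow> (s, i, t) \<in> E"
proof -
  assume a: "i \<in> {1..n - 1}" "s \<in> I" "t \<in> I" "mcoef I w u (xop V i) t s \<noteq> 0 \<or> mcoef I w u (yop V i) s t \<noteq> 0"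
  have "dual_pair (bas V) I w u" using dual by (simp add: bas_V)
  from suppg_dual_pair[OF finite_bas_V finite_I this, of n]
  have "(s, i, t) \<in> suppg n V I w" unfolding bas_V using a by simp
  then show ?thesis using sub by blast
qed

lemma xcoef_edge: "i \<in> {1..n - 1} \<Longrightarrow> s \<in> I \<Longrightarrow> t \<in> I \<Longrightarrow> mcoef I w u (xop V i) t s \<noteq> 0 \<Longrightarrow> (s, i, t) \<in> E"
  using coef_edge by blast

lemma ycoef_edge: "i \<in> {1..n - 1} \<Longrightarrow> s \<in> I \<Longrightarrow> t \<in> I \<Longrightarrow> mcoef I w u (yop V i) s t \<noteq> 0 \<Longrightarrow> (s, i, t) \<in> E"
  using coef_edge by blast

lemma w_vecs: "r \<in> I \<Longrightarrow> w r \<in> vecs I" and u_vecs: "r \<in> I \<Longrightarrow> u r \<in> vecs I"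
  using dual by (auto simp: dual_pair_def)

lemma uw: "r \<in> I \<Longrightarrow> r' \<in> I \<Longrightarrow> (\<Sum>b\<in>I. u r b * w r' b) = (if r = r' then 1 else 0)"
  using dual by (simp add: dual_pair_def)

lemma mcoef_hop: "i \<in> {1..n - 1} \<Longrightarrow> mcoef I w u (hop V i) t r = (\<Sum>b\<in>I. u t b * of_int (mval E i b) * w r b)"
proof -
  assume i: "i \<in> {1..n - 1}"
  have "(\<Sum>b'\<in>I. u t b * hop V i b b' * w r b') = u t b * of_int (mval E i b) * w r b" if b: "b \<in> I" for b
  proof -
    have "(\<Sum>b'\<in>I. u t b * hop V i b b' * w r b') = (\<Sum>b'\<in>I. (if b = b' then 1 else 0) * (u t b * of_int (mval E i b) * w r b'))"
      by (rule sum.cong) (use hop_V[OF i b] in auto)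
    then show ?thesis using sum_indicator(1)[OF finite_I b] by simp
  qed
  then show ?thesis unfolding mcoef_def by simp
qed

definition wt :: "nat \<Rightarrow> 'v \<Rightarrow> complex" where
  "wt i r = mcoef I w u (hop V i) r r"

lemma mcoef_hop_wt: "i \<in> {1..n - 1} \<Longrightarrow> t \<in> I \<Longrightarrow> r \<in> I \<Longrightarrow>
    mcoef I w u (hop V i) t r = (if t = r then wt i r else 0)"
  using diag[of i] by (auto simp: diag_on_def wt_def)

lemma w_weight:
  assumes i: "i \<in> {1..n - 1}" and r: "r \<in> I" and nz: "w r s \<noteq> 0"
  shows "of_int (mval E i s) = wt i r"
proof (rule eigen_support[OF dual r nz])
  show "(\<Sum>b\<in>I. u t b * of_int (mval E i b) * w r b) = (if t = r then wt i r else 0)" if "t \<in> I" for t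
    using mcoef_hop_wt[OF i that r] unfolding mcoef_hop[OF i] .
qed

lemma u_weight:
  assumes i: "i \<in> {1..n - 1}" and r: "r \<in> I" and nz: "u r s \<noteq> 0"
  shows "of_int (mval E i s) = wt i r"
proof (rule eigen_support[OF dual_pair_sym[OF dual] r nz])
  fix t assume t: "t \<in> I"
  have "(\<Sum>b\<in>I. w t b * of_int (mval E i b) * u r b) = mcoef I w u (hop V i) r t"
    unfolding mcoef_hop[OF i] by (simp add: mult_ac)
  then show "(\<Sum>b\<in>I. w t b * of_int (mval E i b) * u r b) = (if t = r then wt i r else 0)"
    using mcoef_hop_wt[OF i r t] by auto
qed

text \<open>A nonzero coefficient has a nonzero summand, hence an edge of \<open>E\<close> from the
  support of u_t to the support of w_r; along it the weight changes by the j-th simple root.\<close>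

lemma ycoef_weight:
  assumes j: "j \<in> {1..n - 1}" and r: "r \<in> I" and t: "t \<in> I" and nz: "mcoef I w u (yop V j) t r \<noteq> 0"
    and i: "i \<in> {1..n - 1}"
  shows "wt i r = wt i t + of_int (cartan i j)"
proof -
  obtain b where b: "b \<in> I" "(\<Sum>b'\<in>I. u t b * yop V j b b' * w r b') \<noteq> 0"
    using nz unfolding mcoef_def by (meson sum.neutral)
  then obtain b' where b': "b' \<in> I" "u t b * yop V j b b' * w r b' \<noteq> 0" by (meson sum.neutral)
  then have e: "(b, j, b') \<in> E" "u t b \<noteq> 0" "w r b' \<noteq> 0" using yop_V[OF j b(1) b'(1)] by auto
  have "mval E i b' = mval E i b + cartan i j" by (rule mval_edge[OF e(1)]) (use i in auto)
  then show ?thesis using u_weight[OF i t e(2)] w_weight[OF i r e(3)] by simp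
qed

lemma w_nonzero: "r \<in> I \<Longrightarrow> \<exists>s. w r s \<noteq> 0"
proof (rule ccontr)
  assume r: "r \<in> I" and "\<nexists>s. w r s \<noteq> 0"
  then show False using uw[OF r r] by simp
qed

text \<open>No edge of \<open>E\<close> of color at most k leaves \<open>t\<close>, so
  \<open>x\<^sub>1, \<dots>, x\<^sub>k\<close> kill w_t and \<open>kernel_support\<close>
  applies.\<close>

lemma w_support_jmax:
  assumes t: "t \<in> I" "jmax k t" and k: "k < n" and nz: "w t s \<noteq> 0"
  shows "jmax k s"
proof (rule kernel_support[OF w_vecs[OF t(1)] k _ nz])
  fix i assume i: "i \<in> {1..k}"
  have "mcoef I w u (xop V i) r t = 0" if "r \<in> I" for r
  proof -
    have "(t, i, r) \<notin> E" "i \<in> {1..n - 1}" using t(2) i k by (auto simp: jmax_def)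
    then show ?thesis using xcoef_edge t(1) that by blast
  qed
  then show "mact (xop V i) I (w t) = (\<lambda>_. 0)"
    unfolding mact_expand[OF finite_I finite_I dual] by simp
qed

text \<open>A set of indices that no \<open>y\<^sub>j\<close> with \<open>j \<le> k\<close> leaves spans a space stable under these \<open>y\<^sub>j\<close>.\<close>
lemma coordinate_span_generated:
  assumes t: "t \<in> I" "jmax k t" "w t t \<noteq> 0" "\<And>s. w t s \<noteq> 0 \<Longrightarrow> s = t" and k: "k < n"
    and K: "t \<in> K" "\<And>j r q. j \<in> {1..k} \<Longrightarrow> r \<in> K \<Longrightarrow> r \<in> I \<Longrightarrow> q \<in> I \<Longrightarrow>
        mcoef I w u (yop V j) q r \<noteq> 0 \<Longrightarrow> q \<in> K"
    and s: "s \<in> I" "above k s t" and r: "r \<in> I" "r \<notin> K"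
  shows "u r s = 0"
proof -
  \<comment> \<open>The span of the w_r with r in \<open>K\<close>, described by vanishing dual
    coordinates. On a standard vector \<open>ev s\<close> these coordinates are the values
    \<open>u r s\<close>, so the goal is that \<open>ev s\<close> lies in \<open>U\<close>.\<close>
  define U where "U = {v \<in> vecs I. \<forall>r\<in>I. r \<notin> K \<longrightarrow> (\<Sum>b\<in>I. u r b * v b) = 0}"
  have ur: "(\<Sum>b\<in>I. u q b * ev p b) = u q p" if "p \<in> I" for p q
    using sum_indicator(4)[OF finite_I that, of "u q"] by (simp add: ev_def)
  have "ev s \<in> U"
  proof (rule generated_by_max[OF _ _ _ k _ t(1,2) _ s])
    show "(\<lambda>_. 0) \<in> U" by (auto simp: U_def vecs_def)
    show "(\<lambda>b. x b + y b) \<in> U" if "x \<in> U" "y \<in> U" for x y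
      using that by (auto simp: U_def vecs_def distrib_left sum.distrib)
    show "(\<lambda>b. c * x b) \<in> U" if "x \<in> U" for x c
    proof -
      have "(\<Sum>b\<in>I. u r b * (c * x b)) = c * (\<Sum>b\<in>I. u r b * x b)" for r
        by (simp add: sum_distrib_left mult_ac)
      then show ?thesis using that by (auto simp: U_def vecs_def)
    qed
    show "ev t \<in> U"
    proof -
      have "u q t = 0" if q: "q \<in> I" "q \<notin> K" for q
      proof -
        have "(\<Sum>b\<in>I. u q b * w t b) = (\<Sum>b\<in>I. (u q b * w t b) * (if b = t then 1 else 0))"
          using t(4) by (intro sum.cong) auto
        also have "\<dots> = u q t * w t t" by (rule sum_indicator(4)[OF finite_I t(1)])
        finally have "u q t * w t t = 0" using uw[OF q(1) t(1)] q(2) K(1) by (metis (full_types))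
        then show ?thesis using t(3) by simp
      qed
      then show ?thesis using ev_vecs[OF t(1)] ur[OF t(1)] by (simp add: U_def)
    qed
    show "mact (yop V j) I x \<in> U" if j: "j \<in> {1..k}" and x: "x \<in> U" for j x
    proof -
      have "(\<Sum>b\<in>I. u q b * mact (yop V j) I x b) = 0" if q: "q \<in> I" "q \<notin> K" for q
      proof -
        define A where "A p = (\<Sum>b'\<in>I. u p b' * x b')" for p
        have xe: "x b = (\<Sum>p\<in>I. A p * w p b)" for b
          using fun_cong[OF dual_pair_expand[OF finite_I finite_I dual, of x], of b] x
          by (simp add: U_def A_def)
        have "(\<Sum>b\<in>I. u q b * mact (yop V j) I x b) = (\<Sum>b\<in>I. \<Sum>b'\<in>I. u q b * yop V j b b' * x b')"
          by (intro sum.cong) (auto simp: mact_def sum_distrib_left mult.assoc)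
        also have "\<dots> = (\<Sum>b\<in>I. \<Sum>b'\<in>I. \<Sum>p\<in>I. A p * (u q b * yop V j b b' * w p b'))"
          by (intro sum.cong refl) (simp add: xe sum_distrib_left mult_ac)
        also have "\<dots> = (\<Sum>b\<in>I. \<Sum>p\<in>I. \<Sum>b'\<in>I. A p * (u q b * yop V j b b' * w p b'))"
          by (intro sum.cong refl sum.swap)
        also have "\<dots> = (\<Sum>p\<in>I. \<Sum>b\<in>I. \<Sum>b'\<in>I. A p * (u q b * yop V j b b' * w p b'))"
          by (rule sum.swap)
        also have "\<dots> = (\<Sum>p\<in>I. A p * mcoef I w u (yop V j) q p)"
          by (simp only: mcoef_def sum_distrib_left)
        also have "\<dots> = 0"
        proof (rule sum.neutral, rule ballI)
          fix p assume p: "p \<in> I"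
          show "A p * mcoef I w u (yop V j) q p = 0"
            using K(2)[OF j _ p q(1)] q p x by (cases "p \<in> K") (auto simp: U_def A_def)
        qed
        finally show ?thesis .
      qed
      then show ?thesis by (simp add: U_def mact_vecs)
    qed
  qed
  then show ?thesis using r ur[OF s(1)] by (simp add: U_def)
qed

lemma w_max:
  assumes t: "t \<in> I" "jmax (n - 1) t" and nz: "w t s \<noteq> 0"
  shows "s = t"
proof -
  have "s \<in> I" using w_vecs[OF t(1)] nz by (auto simp: vecs_def)
  then show ?thesis using max_unique w_support_jmax[OF t _ nz] t n_pos by simp
qed

text \<open>The index of w_r is only a label, so its weight might differ from that of the vertex r.
  Agreement holds at the maximum and persists along every y, where both sides change by the same
  simple root. The indices of agreement thus span the module, and an index outside would have zero
  dual vector.\<close>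

lemma wt_eq:
  assumes i: "i \<in> {1..n - 1}" and r: "r \<in> I"
  shows "wt i r = of_int (mval E i r)"
proof -
  define K where "K = {r. \<forall>i\<in>{1..n - 1}. wt i r = of_int (mval E i r)}"
  obtain t where t: "t \<in> I" "jmax (n - 1) t" using jmax_exists[OF r] by blast
  have wtt: "w t t \<noteq> 0" using w_nonzero[OF t(1)] w_max[OF t] by blast
  have "r \<in> K"
  proof (rule ccontr)
    assume "r \<notin> K"
    have "u r s = 0" if s: "s \<in> I" for s
    proof (rule coordinate_span_generated[OF t wtt w_max[OF t] _ _ _ s above_top[OF s t(1)] r \<open>r \<notin> K\<close>])
      show "n - 1 < n" using n_pos by simp
      show "t \<in> K" using w_weight[OF _ t(1) wtt] by (simp add: K_def)
      fix j p q assume j: "j \<in> {1..n - 1}" and p: "p \<in> K" "p \<in> I" and q: "q \<in> I"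
        and nz: "mcoef I w u (yop V j) q p \<noteq> 0"
      have e: "(q, j, p) \<in> E" by (rule ycoef_edge[OF j q p(2) nz])
      show "q \<in> K" unfolding K_def
      proof (intro CollectI ballI)
        fix i assume i: "i \<in> {1..n - 1}"
        have "mval E i p = mval E i q + cartan i j" by (rule mval_edge[OF e]) (use i in auto)
        then show "wt i q = of_int (mval E i q)"
          using ycoef_weight[OF j p(2) q nz i] p(1) i by (simp add: K_def)
      qed
    qed
    then show False using uw[OF r r] by simp
  qed
  then show ?thesis using i by (simp add: K_def)
qed

text \<open>The inverse of a block diagonal matrix is block diagonal. Concretely, the part
  \<open>y\<close> of w_t in the class of \<open>s\<close> has only zero dual coordinates if t lies
  in another class.\<close>

lemma block_triangular:
  assumes t: "t \<in> I" and cl: "\<And>r s. r \<in> I \<Longrightarrow> s \<in> I \<Longrightarrow> u r s \<noteq> 0 \<Longrightarrow> above k r s" and nz: "w t s \<noteq> 0"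
  shows "above k t s"
proof (rule ccontr)
  assume no: "\<not> above k t s"
  have s: "s \<in> I" using w_vecs[OF t] nz by (auto simp: vecs_def)
  define y where "y b = (if b \<in> I \<and> above k b s then w t b else 0)" for b
  have "y \<in> vecs I" by (auto simp: y_def vecs_def)
  then have "y = (\<lambda>b. \<Sum>r\<in>I. (\<Sum>b'\<in>I. u r b' * y b') * w r b)"
    by (rule dual_pair_expand[OF finite_I finite_I dual])
  moreover have "(\<Sum>b'\<in>I. u r b' * y b') = 0" if r: "r \<in> I" for r
  proof (cases "above k r s")
    case True
    have "(\<Sum>b'\<in>I. u r b' * y b') = (\<Sum>b'\<in>I. u r b' * w t b')"
    proof (rule sum.cong)
      fix b assume b: "b \<in> I"
      show "u r b * y b = u r b * w t b"
      proof (cases "u r b = 0")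
        case False
        then have "above k b s" using above_trans[OF above_sym[OF cl[OF r b]] True] by blast
        then show ?thesis using b by (simp add: y_def)
      qed simp
    qed simp
    moreover have "r \<noteq> t" using True no by blast
    ultimately show ?thesis using uw[OF r t] by simp
  next
    case False
    have "u r b * y b = 0" if b: "b \<in> I" for b
      using cl[OF r b] above_trans[of k r b s] False by (auto simp: y_def)
    then show ?thesis by (simp add: sum.neutral)
  qed
  ultimately have "y s = 0" by (simp add: fun_eq_iff)
  then show False using nz s above_refl by (simp add: y_def)
qed

lemma w_diagonal_jmax:
  "k < n \<Longrightarrow> t \<in> I \<Longrightarrow> jmax k t \<Longrightarrow> w t s \<noteq> 0 \<Longrightarrow> s = t"
proof (induction "n - 1 - k" arbitrary: k t s)
  case 0
  then have "k = n - 1" by simp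
  then show ?case using w_max 0 by blast
next
  case (Suc d)
  then have d: "d = n - 1 - (k + 1)" "k + 1 < n" by auto
  have IH: "q = p" if "p \<in> I" "jmax (k + 1) p" "w p q \<noteq> 0" for p q
    using Suc.hyps(1)[OF d that] .
  have "above (k + 1) r q" if r: "r \<in> I" and q: "q \<in> I" and nz: "u r q \<noteq> 0" for r q
  proof (rule ccontr)
    assume no: "\<not> above (k + 1) r q"
    obtain p where p: "p \<in> I" "jmax (k + 1) p" "above (k + 1) p q" using jmax_exists[OF q] by blast
    have wp: "w p p \<noteq> 0" using w_nonzero[OF p(1)] IH[OF p(1,2)] by blast
    \<comment> \<open>By the induction hypothesis w_p is a multiple of the standard vector of p, the
      maximum of the class of q. This class is closed under the y of color at most k + 1, so it can
      serve as K.\<close>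
    have "u r q = 0"
    proof (rule coordinate_span_generated[OF p(1,2) wp IH[OF p(1,2)] d(2) _ _ q above_sym[OF p(3)] r])
      show "p \<in> {b. above (k + 1) b q}" using p(3) by simp
      show "r \<notin> {b. above (k + 1) b q}" using no by simp
      fix j a b assume j: "j \<in> {1..k + 1}" and a: "a \<in> {b. above (k + 1) b q}" "a \<in> I" and b: "b \<in> I"
        and nz: "mcoef I w u (yop V j) b a \<noteq> 0"
      have "(b, j, a) \<in> E" by (rule ycoef_edge[OF _ b a(2) nz]) (use j d in auto)
      then have "above (k + 1) b a" using edge_above j by simp
      then show "b \<in> {b. above (k + 1) b q}" using above_trans a by blast
    qed
    then show False using nz by blast
  qed
  \<comment> \<open>The dual basis respects the classes, hence so does w_t. Its support points are
    then k-maximal, in the class of t and of the same weight as t, which leaves only t.\<close>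
  then have a: "above (k + 1) t s" using block_triangular Suc.prems by blast
  have s: "s \<in> I" using w_vecs[OF Suc.prems(2)] Suc.prems(4) by (auto simp: vecs_def)
  have js: "jmax k s" using w_support_jmax Suc.prems by blast
  have m: "mval E i s = mval E i t" if i: "i \<in> {1..n - 1}" for i
    using w_weight[OF i Suc.prems(2,4)] wt_eq[OF i Suc.prems(2)] by simp
  show ?case using jmax_weight_unique[of s "k + 1" t] s js Suc.prems(2,3) d above_sym[OF a] m by simp
qed

lemma w_proportional: "proportional_on I w ev"
  unfolding proportional_on_def
proof (intro exI[of _ "\<lambda>r. w r r"] ballI)
  fix r assume r: "r \<in> I"
  have d: "w r s \<noteq> 0 \<Longrightarrow> s = r" for s using w_diagonal_jmax[of 0 r s] r jmax_zero n_pos by simp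
  then have "w r r \<noteq> 0" using w_nonzero[OF r] by blast
  then show "w r r \<noteq> 0 \<and> w r = (\<lambda>b. w r r * ev r b)" using d by (auto simp: ev_def fun_eq_iff)
qed

end

lemma weight_basis_proportional:
  assumes w: "weight_basis n V I w" and sub: "suppg n V I w \<subseteq> E"
  shows "proportional_on I w ev"
proof -
  obtain u where "dual_pair I I w u" "\<And>i. i \<in> {1..n - 1} \<Longrightarrow> diag_on I I w u (hop V i)"
    using w unfolding weight_basis_iff[OF finite_bas_V] by (auto simp: bas_V)
  then show ?thesis by (rule w_proportional[OF _ _ sub])
qed

lemma solitary: "solitary n V I E"
  unfolding solitary_iff
  by (intro exI[of _ ev] conjI allI impI ev_weight_basis ev_suppg weight_basis_proportional) auto

text \<open>A weight basis with a smaller graph would be proportional to the standard one, but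
  proportional bases have equal graphs.\<close>

lemma edge_minimal: "edge_minimal n V I E"
proof -
  have "\<not> suppg n V I w \<subset> E" if w: "weight_basis n V I w" for w
  proof
    assume s: "suppg n V I w \<subset> E"
    then have "proportional_on I w ev" using weight_basis_proportional[OF w] by blast
    then have "suppg n V I w = E" using suppg_proportional[OF finite_bas_V w ev_weight_basis] ev_suppg by simp
    then show False using s by blast
  qed
  then show ?thesis unfolding edge_minimal_iff[OF finite_bas_V] is_supp_graph_def
    using ev_weight_basis ev_suppg by blast
qed

end

section \<open>Symmetries of skew-tabular lattices\<close>

lemma psig_edge_iff:
  fixes n :: nat
  assumes E: "E \<subseteq> I \<times> {1..n - 1} \<times> I" and i: "i \<in> {1..n - 1}"
  shows "(s, i, t) \<in> {(s, n - i, t) |s i t. (s, i, t) \<in> E} \<longleftrightarrow> (s, n - i, t) \<in> E"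
proof
  assume "(s, i, t) \<in> {(s, n - i, t) |s i t. (s, i, t) \<in> E}"
  then obtain i' where i': "i = n - i'" "(s, i', t) \<in> E" by auto
  have "i' \<in> {1..n - 1}" using E i'(2) by blast
  then have "i' \<le> n" by auto
  then have "n - (n - i') = i'" by simp
  then show "(s, n - i, t) \<in> E" using i' by simp
next
  assume "(s, n - i, t) \<in> E"
  moreover have "i = n - (n - i)" using i by auto
  ultimately show "(s, i, t) \<in> {(s, n - i, t) |s i t. (s, i, t) \<in> E}" by blast
qed

text \<open>Complementing reflects the row sums and adds a term linear in the level, which a second
  difference does not see.\<close>

lemma mval_sig:
  assumes g: "cpgraph n C a b I E h" and t: "t \<in> I" and i: "1 \<le> i" "i < n"
  shows "mval {(s, n - i, t) |s i t. (s, i, t) \<in> E} i t = mval E (n - i) t"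
proof -
  note g' = cpgraph_sig[OF g]
  have r: "rowsum C (\<lambda>i c. if i \<le> n \<and> c \<in> C then h t (n - i) c + int i else 0) j
    = rowsum C (h t) (n - j) + int j * int (card C)" if "j \<le> n" for j
    using that by (simp add: rowsum_def sum.distrib)
  have e: "n - (i - 1) = n - i + 1" "n - (i + 1) = n - i - 1" using i by auto
  have 1: "mval E (n - i) t = 2 * rowsum C (h t) (n - i) - rowsum C (h t) (n - i - 1) - rowsum C (h t) (n - i + 1)"
    by (rule mval_cpgraph[OF g t]) (use i in auto)
  show ?thesis unfolding mval_cpgraph[OF g' t i] 1 using i
    by (subst r r r; simp add: e of_nat_diff Suc_diff_le algebra_simps)+
qed

text \<open>Rotation reflects and negates the row sums up to a constant, so the second difference
  changes sign.\<close>

lemma mval_bow: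
  assumes g: "cpgraph n C a b I E h" and t: "t \<in> I" and i: "1 \<le> i" "i < n"
  shows "mval {(t, n - i, s) |s i t. (s, i, t) \<in> E} i t = - mval E (n - i) t"
proof -
  note g' = cpgraph_bow[OF g]
  have r: "rowsum (uminus ` C) (\<lambda>i c. if i \<le> n \<and> - c \<in> C then - h t (n - i) (- c) - 1 else 0) j
    = - rowsum C (h t) (n - j) - int (card C)" if "j \<le> n" for j
    using that by (simp add: rowsum_def sum.reindex sum_subtractf sum_negf)
  have e: "n - (i - 1) = n - i + 1" "n - (i + 1) = n - i - 1" using i by auto
  have 1: "mval E (n - i) t = 2 * rowsum C (h t) (n - i) - rowsum C (h t) (n - i - 1) - rowsum C (h t) (n - i + 1)"
    by (rule mval_cpgraph[OF g t]) (use i in auto)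
  show ?thesis unfolding mval_cpgraph[OF g' t i] 1 using i
    by (subst r r r; simp add: e Suc_diff_le algebra_simps)+
qed

text \<open>The bound \<open>a c\<close> of an empty column need not be the common top row of a
  Young shape. Once such columns are discarded, the lower bounds can be replaced by one
  constant.\<close>

lemma column_shape_nonempty_columns:
  assumes "column_shape C a b D" "\<And>c. c \<in> C \<Longrightarrow> a c < b c \<Longrightarrow> a c = a' c"
  shows "column_shape {c \<in> C. a c < b c} a' b D"
proof -
  have D: "D = {(r, c). c \<in> C \<and> a c < r \<and> r \<le> b c}" using assms(1) by (simp add: column_shape_def)
  have "D = {(r, c). c \<in> {c \<in> C. a c < b c} \<and> a' c < r \<and> r \<le> b c}"
    unfolding D using assms(2) by force
  moreover have "finite {c \<in> C. a c < b c}" using assms(1) by (simp add: column_shape_def)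
  moreover have "\<forall>c\<in>{c \<in> C. a c < b c}. a' c \<le> b c"
    using assms(2) by (force simp: less_imp_le)
  moreover have "\<forall>c\<in>{c \<in> C. a c < b c}. \<forall>c'\<in>{c \<in> C. a c < b c}. c < c' \<longrightarrow> a' c' \<le> a' c \<and> b c' \<le> b c"
  proof (intro ballI impI)
    fix c c' assume c: "c \<in> {c \<in> C. a c < b c}" "c' \<in> {c \<in> C. a c < b c}" "c < c'"
    then have "a c' \<le> a c \<and> b c' \<le> b c" using assms(1) unfolding column_shape_def by blast
    then show "a' c' \<le> a' c \<and> b c' \<le> b c" using assms(2) c by auto
  qed
  ultimately show ?thesis unfolding column_shape_def by blast
qed

lemma young_column_top:
  assumes y: "young_translate D"
  shows "\<exists>a. \<forall>c. (\<exists>r. (r, c) \<in> D) \<longrightarrow> (a + 1, c) \<in> D \<and> (\<forall>r. (r, c) \<in> D \<longrightarrow> a < r)"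
proof -
  obtain a b and lam :: "nat \<Rightarrow> nat" where lam: "\<forall>r. 1 \<le> r \<longrightarrow> lam (Suc r) \<le> lam r"
    and D: "D = {(a + int r, b + int c) | r c. 1 \<le> r \<and> 1 \<le> c \<and> c \<le> lam r}"
    using y unfolding young_translate_def by blast
  have l1: "lam r \<le> lam 1" if "1 \<le> r" for r
    using that
  proof (induction r rule: dec_induct)
    case (step r)
    then show ?case using lam[rule_format, of r] by simp
  qed simp
  have "(a + 1, c) \<in> D \<and> a < r" if rc: "(r, c) \<in> D" for r c
  proof -
    obtain r0 c0 where "r = a + int r0" "c = b + int c0" "1 \<le> r0" "1 \<le> c0" "c0 \<le> lam r0"
      using rc unfolding D by auto
    then show ?thesis unfolding D using l1[of r0] by (auto intro!: exI[of _ 1] exI[of _ c0])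
  qed
  then show ?thesis by (intro exI[of _ a]) blast
qed

context skew_shape
begin

lemma verts_L: "verts L = lsk_verts n D"
  and edges_L: "edges L = lsk_edges n D"
  and Xs_L: "Xs L T S = Xval m P Q T S"
  and Ys_L: "Ys L S T = Yval m P Q S T"
  by (simp_all add: Lskew_def)

lemma graph_L: "cpgraph n cols (col_top Q) (col_top P) (verts L) (edges L) (hcol n cols (col_top Q) D)"
  unfolding verts_L edges_L by (rule lsk_cpgraph[OF shape_D])

lemma edges_sub: "edges L \<subseteq> verts L \<times> {1..n - 1} \<times> verts L"
  by (rule cpgraph_edges[OF graph_L])

lemma finite_verts_L: "finite (verts L)"
  unfolding verts_L by (rule finite_lsk_verts[OF finite_D])

lemma verts_L_nonempty: "verts L \<noteq> {}"
proof -
  have "colpat n cols (col_top Q) (col_top P) \<noteq> {}" by (rule colpat_nonempty[OF shape_D col_len])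
  then show ?thesis using graph_L by (auto simp: cpgraph_def bij_betw_def)
qed

lemma verts_pop [simp]: "verts (pop n s L) = verts L"
  by (cases s) (simp_all add: psig_def pdual_def)

lemma bas_Vmod: "bas (Vmod R) = verts R"
  by (simp add: Vmod_def)

lemma bas_mop [simp]: "bas (mop n s (Vmod L)) = verts L"
  by (cases s) (simp_all add: msig_def mdual_def Vmod_def)

lemma edges_Sig: "edges (psig n L) = {(s, n - i, t) |s i t. (s, i, t) \<in> edges L}"
  by (simp add: psig_def)

lemma edges_Bow: "edges (pdual (psig n L)) = {(t, n - i, s) |s i t. (s, i, t) \<in> edges L}"
  by (auto simp: psig_def pdual_def)

lemma graph_Sig: "\<exists>h. cpgraph n cols (col_top P) (\<lambda>c. col_top Q c + int n) (verts L) (edges (psig n L)) h"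
  unfolding edges_Sig using cpgraph_sig[OF graph_L] by blast

text \<open>Dualizing is complementing followed by rotating, as the two color reversals cancel; the
  star operation thereby reduces to the two already treated.\<close>

lemma edges_Star: "edges (pdual L) = {(t, n - i, s) |s i t. (s, i, t) \<in> edges (psig n L)}" (is "?A = ?B")
proof
  show "?A \<subseteq> ?B"
  proof clarify
    fix t i s assume "(t, i, s) \<in> edges (pdual L)"
    then have e: "(s, i, t) \<in> edges L" by (simp add: pdual_def)
    have "i \<in> {1..n - 1}" using edges_sub e by blast
    then have "(s, n - i, t) \<in> edges (psig n L)" "i = n - (n - i)"
      using e unfolding edges_Sig by auto
    then show "\<exists>s' i' t'. (t, i, s) = (t', n - i', s') \<and> (s', i', t') \<in> edges (psig n L)" by blast
  qed
  show "?B \<subseteq> ?A"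
  proof clarify
    fix s i t assume "(s, i, t) \<in> edges (psig n L)"
    then obtain i' where i': "i = n - i'" "(s, i', t) \<in> edges L" unfolding edges_Sig by auto
    moreover have "i' \<in> {1..n - 1}" using edges_sub i'(2) by blast
    ultimately have "n - i = i'" by auto
    then show "(t, n - i, s) \<in> edges (pdual L)" using i' by (simp add: pdual_def)
  qed
qed

text \<open>The link between the two kinds of operations: the transformed poset has the patterns of
  the transformed shape, given by the same \<open>C\<close>, \<open>a\<close>,
  \<open>b\<close>.\<close>

lemma graph_pop:
  "\<exists>C a b h. column_shape C a b (sop n s D) \<and> cpgraph n C a b (verts L) (edges (pop n s L)) h"
proof (cases s)
  case Eps
  then show ?thesis using shape_D graph_L by auto
next
  case Sig
  then show ?thesis using shape_sigD graph_Sig by fastforce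
next
  case Star
  obtain h where h: "cpgraph n cols (col_top P) (\<lambda>c. col_top Q c + int n) (verts L) (edges (psig n L)) h"
    using graph_Sig by blast
  show ?thesis using shape_rotD[OF shape_sigD] cpgraph_bow[OF h] edges_Star Star by fastforce
next
  case Bow
  show ?thesis using shape_rotD[OF shape_D] cpgraph_bow[OF graph_L] edges_Bow Bow by fastforce
qed

lemma mval_Sig: "t \<in> verts L \<Longrightarrow> i \<in> {1..n - 1} \<Longrightarrow> mval (edges (psig n L)) i t = mval (edges L) (n - i) t"
  unfolding edges_Sig by (rule mval_sig[OF graph_L]) auto

lemma mval_Bow: "t \<in> verts L \<Longrightarrow> i \<in> {1..n - 1} \<Longrightarrow> mval (edges (pdual (psig n L))) i t = - mval (edges L) (n - i) t"
  unfolding edges_Bow by (rule mval_bow[OF graph_L]) auto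

lemma mval_Star:
  assumes t: "t \<in> verts L" and i: "i \<in> {1..n - 1}"
  shows "mval (edges (pdual L)) i t = - mval (edges L) i t"
proof -
  obtain h where h: "cpgraph n cols (col_top P) (\<lambda>c. col_top Q c + int n) (verts L) (edges (psig n L)) h"
    using graph_Sig by blast
  have "mval (edges (pdual L)) i t = - mval (edges (psig n L)) (n - i) t"
    unfolding edges_Star by (rule mval_bow[OF h t]) (use i in auto)
  also have "\<dots> = - mval (edges L) (n - (n - i)) t"
    by (subst mval_Sig[OF t]) (use i in auto)
  also have "n - (n - i) = i" using i by auto
  finally show ?thesis .
qed

lemma WGF_pop: "WGF n (pop n s L) = WGFop n s (WGF n L)"
proof -
  have w: "wvec n (pop n s L) t = wop n s (wvec n L t)" if t: "t \<in> verts L" for t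
  proof
    fix i
    show "wvec n (pop n s L) t i = wop n s (wvec n L t) i"
    proof (cases "i \<in> {1..n - 1}")
      case True
      then have "1 \<le> n - i \<and> n - i \<le> n - 1" by auto
      then show ?thesis using True mval_Sig[OF t True] mval_Star[OF t True] mval_Bow[OF t True]
        by (cases s) (simp_all add: wvec_def)
    next
      case False
      then show ?thesis by (cases s) (auto simp: wvec_def)
    qed
  qed
  have "WGF n (pop n s L) = image_mset (\<lambda>t. wop n s (wvec n L t)) (mset_set (verts L))"
    unfolding WGF_def verts_pop by (rule image_mset_cong) (use w finite_verts_L in auto)
  then show ?thesis by (simp add: WGFop_def WGF_def image_mset.compositionality o_def)
qed

lemma sig_iff: "i \<in> {1..n - 1} \<Longrightarrow> (s, i, t) \<in> edges (psig n L) \<longleftrightarrow> (s, n - i, t) \<in> edges L"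
  unfolding edges_Sig by (rule psig_edge_iff[OF edges_sub])

lemma dual_iff: "(s, i, t) \<in> edges (pdual R) \<longleftrightarrow> (t, i, s) \<in> edges R"
  by (auto simp: pdual_def)

lemma tags_pop:
  "Xs (psig n R) = Xs R" "Ys (psig n R) = Ys R" "Xs (pdual R) = Ys R" "Ys (pdual R) = Xs R"
  by (simp_all add: psig_def pdual_def)

lemma ops_Vmod:
  "xop (Vmod R) i u t = (if (t, i, u) \<in> edges R then Xs R u t else 0)"
  "yop (Vmod R) i s t = (if (s, i, t) \<in> edges R then Ys R s t else 0)"
  "hop (Vmod R) i s t = (if s = t then of_int (mval (edges R) i t) else 0)"
  by (simp_all add: Vmod_def)

lemma ops_mop:
  "xop (msig n W) i = xop W (n - i)" "yop (msig n W) i = yop W (n - i)" "hop (msig n W) i = hop W (n - i)"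
  "xop (mdual W) i a b = - xop W i b a" "yop (mdual W) i a b = - yop W i b a" "hop (mdual W) i a b = - hop W i b a"
  by (simp_all add: msig_def mdual_def)

lemma gt_norm_edge:
  assumes "(S, i, T) \<in> edges L"
  shows "gt_norm n m (gpart S) * Ys L S T = - Xs L T S * gt_norm n m (gpart T)"
    "gt_norm n m (gpart T) * Xs L T S = - Ys L S T * gt_norm n m (gpart S)"
  using edge_XY(3)[OF assms[unfolded edges_L]] unfolding Xs_L Ys_L by (simp_all add: mult.commute)

text \<open>The identity intertwines in the first two cases. In the other two the dual poset has X
  and Y exchanged while the dual module has them transposed and negated, and \<open>gt_norm\<close>
  mediates.\<close>

lemma miso_pop: "miso n (Vmod (pop n s L)) (mop n s (Vmod L))"
proof -
  let ?\<tau> = "\<lambda>T. gt_norm n m (gpart T)"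
  have nz: "?\<tau> T \<noteq> 0" if "T \<in> verts L" for T
    using gt_norm_gpart_nonzero that by (simp add: verts_L)
  show ?thesis
  proof (cases s)
    case Eps
    show ?thesis unfolding Eps
      by (rule miso_diagonal[where \<tau> = "\<lambda>_. 1"]) (simp_all add: bas_Vmod finite_verts_L)
  next
    case Sig
    show ?thesis unfolding Sig
      by (rule miso_diagonal[where \<tau> = "\<lambda>_. 1"])
        (use bas_mop[of Sig] verts_pop[of Sig] in \<open>simp_all add: bas_Vmod finite_verts_L ops_mop ops_Vmod sig_iff tags_pop mval_Sig\<close>)
  next
    case Star
    show ?thesis unfolding Star
      by (rule miso_diagonal[where \<tau> = ?\<tau>])
        (use bas_mop[of Star] verts_pop[of Star] nz gt_norm_edge in
          \<open>auto simp: bas_Vmod finite_verts_L ops_mop ops_Vmod dual_iff tags_pop mval_Star\<close>)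
  next
    case Bow
    show ?thesis unfolding Bow
      by (rule miso_diagonal[where \<tau> = ?\<tau>])
        (use bas_mop[of Bow] verts_pop[of Bow] nz gt_norm_edge in
          \<open>auto simp: bas_Vmod finite_verts_L ops_mop ops_Vmod dual_iff sig_iff tags_pop mval_Bow\<close>)
  qed
qed

end

text \<open>Bundles the two properties, so that each transport argument is made once.\<close>

definition extremal :: "bool \<Rightarrow> nat \<Rightarrow> 'b smod \<Rightarrow> 'r set \<Rightarrow> ('r \<times> nat \<times> 'r) set \<Rightarrow> bool" where
  "extremal e n V I E \<longleftrightarrow> (if e then edge_minimal n V I E else solitary n V I E)"

lemma linked_extremal:
  "linked n V I W J \<theta> \<Longrightarrow> finite (bas V) \<Longrightarrow> finite (bas W) \<Longrightarrow> extremal e n V I E \<Longrightarrow>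
    extremal e n W J (\<theta> ` E)"
  unfolding extremal_def using linked_solitary linked_edge_minimal by (cases e) auto

lemma extremal_msig:
  assumes "finite (bas V)" "E \<subseteq> I \<times> {1..n - 1} \<times> I"
  shows "extremal e n (msig n V) I ((\<lambda>(s, i, t). (s, n - i, t)) ` E) \<longleftrightarrow> extremal e n V I E"
proof -
  let ?g = "\<lambda>(s, i, t). (s, n - i, t)"
  have f: "finite (bas (msig n V))" using assms(1) by (simp add: msig_def)
  have "?g (?g x) = x" if "x \<in> E" for x
  proof -
    obtain s i t where x: "x = (s, i, t)" by (cases x) auto
    then have "i \<in> {1..n - 1}" using assms(2) that by blast
    then show ?thesis by (auto simp: x)
  qed
  then have "(\<lambda>x. ?g (?g x)) ` E = (\<lambda>x. x) ` E" by (rule image_cong[OF refl])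
  then have "?g ` ?g ` E = E" unfolding image_image by simp
  then show ?thesis
    using linked_extremal[OF linked_msig(1) assms(1) f, of e I E]
      linked_extremal[OF linked_msig(2) f assms(1), of e I "?g ` E"] by auto
qed

lemma extremal_mdual:
  assumes "finite (bas V)"
  shows "extremal e n (mdual V) I ((\<lambda>(s, i, t). (t, i, s)) ` E) \<longleftrightarrow> extremal e n V I E"
proof -
  let ?g = "\<lambda>(s, i, t). (t, i, s)"
  have f: "finite (bas (mdual V))" using assms(1) by (simp add: mdual_def)
  have "(\<lambda>x. ?g (?g x)) ` E = (\<lambda>x. x) ` E" by (rule image_cong) auto
  then have "?g ` ?g ` E = E" unfolding image_image by simp
  then show ?thesis
    using linked_extremal[OF linked_mdual[OF assms] assms f, of e n I E]
      linked_extremal[OF linked_mdual[OF f], of e n I "?g ` E"] assms f by (auto simp: mdual_mdual)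
qed

lemma extremal_cpgraph_iso:
  assumes "finite (bas V)" and g: "cpgraph n C a b I E h" and g': "cpgraph n C a b J F k"
    and "extremal e n V I E"
  shows "extremal e n V J F"
proof -
  obtain \<phi> where "bij_betw \<phi> I J" "(\<lambda>(s, i, t). (\<phi> s, i, \<phi> t)) ` E = F"
    using cpgraph_iso[OF g g'] by blast
  then show ?thesis using linked_extremal[OF linked_reindex[OF assms(1)] assms(1,1,4)] by metis
qed

context skew_shape
begin

lemma edges_psig_image: "edges (psig n R) = (\<lambda>(s, i, t). (s, n - i, t)) ` edges R"
  by (force simp: psig_def)

lemma edges_pdual_image: "edges (pdual R) = (\<lambda>(s, i, t). (t, i, s)) ` edges R"
  by (force simp: pdual_def)

lemma edges_pop_sub: "edges (pop n s L) \<subseteq> verts L \<times> {1..n - 1} \<times> verts L"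
  using graph_pop[of s] cpgraph_edges by metis

lemma extremal_pop:
  "extremal e n (mop n s (Vmod L)) (verts L) (edges (pop n s L)) \<longleftrightarrow>
   extremal e n (Vmod L) (verts L) (edges L)"
proof -
  have f: "finite (bas (Vmod L))" "finite (bas (mdual (Vmod L)))"
    using finite_verts_L by (simp_all add: Vmod_def mdual_def)
  show ?thesis
  proof (cases s)
    case Sig
    then show ?thesis using extremal_msig[OF f(1) edges_sub] by (simp add: edges_psig_image)
  next
    case Star
    then show ?thesis using extremal_mdual[OF f(1)] by (simp add: edges_pdual_image)
  next
    case Bow
    have sub: "edges (pdual L) \<subseteq> verts L \<times> {1..n - 1} \<times> verts L"
      using edges_pop_sub[of Star] by simp
    have "edges (pdual (psig n L)) = (\<lambda>(s, i, t). (s, n - i, t)) ` edges (pdual L)"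
      by (force simp: psig_def pdual_def)
    then show ?thesis
      using extremal_msig[OF f(2) sub] extremal_mdual[OF f(1)] Bow by (simp add: edges_pdual_image)
  qed simp
qed

text \<open>The fillings of the transformed shape form a graph with the patterns of the transformed
  poset; \<open>extremal\<close> moves across that isomorphism and then back to
  \<open>L\<close>.\<close>

lemma extremal_lsk:
  "extremal e n (mop n s (Vmod L)) (lsk_verts n (sop n s D)) (lsk_edges n (sop n s D)) \<longleftrightarrow>
   extremal e n (Vmod L) (verts L) (edges L)"
proof -
  obtain C a b h where sh: "column_shape C a b (sop n s D)"
    and g: "cpgraph n C a b (verts L) (edges (pop n s L)) h" using graph_pop by blast
  have f: "finite (bas (mop n s (Vmod L)))" using finite_verts_L by simp
  show ?thesis unfolding extremal_pop[of e s, symmetric]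
    using extremal_cpgraph_iso[OF f g lsk_cpgraph[OF sh]] extremal_cpgraph_iso[OF f lsk_cpgraph[OF sh] g]
    by blast
qed

section \<open>Twists of modules on \<open>L\<close> and the Young case\<close>

lemma supported_L: "supported_on n (Vmod L) (verts L) (edges L)"
proof -
  have "Xs L T S \<noteq> 0 \<and> Ys L S T \<noteq> 0" if "(S, i, T) \<in> edges L" for S i T
    using edge_XY(1,2)[of S i T] that unfolding edges_L Xs_L Ys_L by blast
  then show ?thesis unfolding supported_on_def by (auto simp: bas_Vmod ops_Vmod)
qed

lemma supported_pdual:
  assumes "supported_on n W (verts L) (edges R)"
    and "\<And>i t. i \<in> {1..n - 1} \<Longrightarrow> t \<in> verts L \<Longrightarrow> mval E i t = - mval (edges R) i t"
    and "\<And>s i t. (s, i, t) \<in> E \<longleftrightarrow> (t, i, s) \<in> edges R"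
  shows "supported_on n (mdual W) (verts L) E" "supported_on n (mswap W) (verts L) E"
  using assms unfolding supported_on_def by (auto simp: mdual_def mswap_def)

lemma supported_psig:
  assumes W: "supported_on n W (verts L) F"
    and m: "\<And>i t. i \<in> {1..n - 1} \<Longrightarrow> t \<in> verts L \<Longrightarrow> mval E i t = mval F (n - i) t"
    and e: "\<And>s i t. i \<in> {1..n - 1} \<Longrightarrow> (s, i, t) \<in> E \<longleftrightarrow> (s, n - i, t) \<in> F"
  shows "supported_on n (msig n W) (verts L) E"
  unfolding supported_on_def
proof (intro conjI ballI)
  fix i a b assume i: "i \<in> {1..n - 1}" and ab: "a \<in> verts L" "b \<in> verts L"
  then have "n - i \<in> {1..n - 1}" by auto
  then show "xop (msig n W) i b a \<noteq> 0 \<longleftrightarrow> (a, i, b) \<in> E" "yop (msig n W) i a b \<noteq> 0 \<longleftrightarrow> (a, i, b) \<in> E"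
    "hop (msig n W) i a b = (if a = b then of_int (mval E i a) else 0)"
    using W ab m[OF i] e[OF i] unfolding supported_on_def by (simp_all add: ops_mop)
qed (use W in \<open>simp add: supported_on_def msig_def\<close>)

text \<open>Follows the poset operations as \<open>mop\<close> does, but with \<open>mswap\<close>
  in place of \<open>mdual\<close>, so that all four twists have the same submodules.\<close>

fun mtwist :: "symop \<Rightarrow> 'b smod \<Rightarrow> 'b smod" where
  "mtwist Eps W = W"
| "mtwist Sig W = msig n W"
| "mtwist Star W = mswap W"
| "mtwist Bow W = msig n (mswap W)"

lemma irreducible_mtwist: "irreducible_mod n (mtwist s W) \<longleftrightarrow> irreducible_mod n W"
  by (cases s) (simp_all add: irreducible_msig irreducible_mswap)

lemma supported_mtwist:
  assumes W: "supported_on n W (verts L) (edges L)"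
  shows "supported_on n (mtwist s W) (verts L) (edges (pop n s L))"
proof (cases s)
  case Sig
  then show ?thesis using supported_psig[OF W mval_Sig sig_iff] by simp
next
  case Star
  then show ?thesis using supported_pdual(2)[OF W mval_Star dual_iff] by simp
next
  case Bow
  have "mval (edges (pdual (psig n L))) i t = mval (edges (pdual L)) (n - i) t"
    if "i \<in> {1..n - 1}" "t \<in> verts L" for i t
  proof -
    have "n - i \<in> {1..n - 1}" using that(1) by auto
    then show ?thesis using mval_Bow[OF that(2,1)] mval_Star[OF that(2), of "n - i"] by simp
  qed
  then show ?thesis
    using supported_psig[OF supported_pdual(2)[OF W mval_Star dual_iff]] Bow by (simp add: dual_iff sig_iff)
qed (use W in simp)

text \<open>For the two dualizing operations the module to be twisted is the transpose \<open>mswap (mdual V)\<close>,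
  which is again supported on \<open>L\<close> itself.\<close>
lemma mop_mtwist: "\<exists>W. supported_on n W (verts L) (edges L) \<and> mop n s (Vmod L) = mtwist s W"
proof -
  have "supported_on n (mdual (Vmod L)) (verts L) (edges (pdual L))"
    by (rule supported_pdual(1)[OF supported_L mval_Star dual_iff])
  then have "supported_on n (mswap (mdual (Vmod L))) (verts L) (edges L)"
    by (rule supported_pdual(2)) (simp_all add: mval_Star dual_iff)
  then show ?thesis using supported_L by (cases s) (auto simp: mswap_mswap intro: exI[of _ "mswap (mdual (Vmod L))"])
qed

lemma young_gt_module:
  assumes y: "young_translate (sop n s D)" and n: "1 \<le> n" and W: "supported_on n W (verts L) (edges L)"
  shows "\<exists>C \<alpha> \<beta> h. gt_module n C \<alpha> \<beta> (mtwist s W) (verts L) (edges (pop n s L)) h"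
proof -
  obtain C a b h where sh: "column_shape C a b (sop n s D)"
    and g: "cpgraph n C a b (verts L) (edges (pop n s L)) h" using graph_pop by blast
  obtain \<alpha> where al: "\<And>c r. (r, c) \<in> sop n s D \<Longrightarrow> (\<alpha> + 1, c) \<in> sop n s D \<and> \<alpha> < r"
    using young_column_top[OF y] by blast
  have "a c = \<alpha>" if c: "c \<in> C" "a c < b c" for c
  proof -
    have iff: "(r, c) \<in> sop n s D \<longleftrightarrow> a c < r \<and> r \<le> b c" for r
      using sh c(1) by (auto simp: column_shape_def)
    then have "(a c + 1, c) \<in> sop n s D" using c(2) by simp
    \<comment> \<open>The first cell of the column gives \<alpha> < a c + 1, and the cell (\<alpha>
      + 1, c) gives a c < \<alpha> + 1.\<close>
    then show ?thesis using al[of "a c + 1" c] iff[of "\<alpha> + 1"] by auto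
  qed
  then have sh': "column_shape {c \<in> C. a c < b c} (\<lambda>_. \<alpha>) b (sop n s D)"
    by (rule column_shape_nonempty_columns[OF sh])
  obtain \<phi> where \<phi>: "bij_betw \<phi> (verts L) (lsk_verts n (sop n s D))"
    "(\<lambda>(s, i, t). (\<phi> s, i, \<phi> t)) ` edges (pop n s L) = lsk_edges n (sop n s D)"
    using cpgraph_iso[OF g lsk_cpgraph[OF sh]] by blast
  have "edges (pop n s L) \<subseteq> verts L \<times> UNIV \<times> verts L" using edges_pop_sub by blast
  \<comment> \<open>The presentation is carried from the fillings of the Young shape to the vertices
    of \<open>L\<close>, where the module lives.\<close>
  from cpgraph_transport[OF lsk_cpgraph[OF sh'] \<phi> this]
  have "gt_module n {c \<in> C. a c < b c} \<alpha> b (mtwist s W) (verts L) (edges (pop n s L))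
    (hcol n {c \<in> C. a c < b c} (\<lambda>_. \<alpha>) (sop n s D) \<circ> \<phi>)"
    using finite_verts_L verts_L_nonempty supported_mtwist[OF W] n by unfold_locales
  then show ?thesis by blast
qed

text \<open>\<open>W\<close> is chosen for the target operation \<open>d\<close> but twisted by
  \<open>s\<close>, which lands it on the Young graph. Since twisting preserves irreducibility in
  both directions, the result returns to \<open>d\<close> through \<open>W\<close>.\<close>

lemma young_irreducible:
  assumes y: "young_translate (sop n s D)" and n: "1 \<le> n"
  shows "irreducible_mod n (mop n d (Vmod L))"
proof -
  obtain W where W: "supported_on n W (verts L) (edges L)" "mop n d (Vmod L) = mtwist d W"
    using mop_mtwist by blast
  obtain C \<alpha> \<beta> h where "gt_module n C \<alpha> \<beta> (mtwist s W) (verts L) (edges (pop n s L)) h"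
    using young_gt_module[OF y n W(1)] by blast
  then have "irreducible_mod n (mtwist s W)" by (rule gt_module.irreducible)
  then show ?thesis unfolding W(2) irreducible_mtwist .
qed

lemma young_extremal:
  assumes y: "young_translate (sop n s D)" and n: "1 \<le> n"
  shows "extremal e n (Vmod L) (verts L) (edges L)"
proof -
  obtain W where W: "supported_on n W (verts L) (edges L)" "mop n s (Vmod L) = mtwist s W"
    using mop_mtwist by blast
  obtain C \<alpha> \<beta> h where "gt_module n C \<alpha> \<beta> (mtwist s W) (verts L) (edges (pop n s L)) h"
    using young_gt_module[OF y n W(1)] by blast
  then interpret gt_module n C \<alpha> \<beta> "mtwist s W" "verts L" "edges (pop n s L)" h .
  have "extremal e n (mop n s (Vmod L)) (verts L) (edges (pop n s L))"
    using solitary edge_minimal by (simp add: extremal_def W(2))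
  then show ?thesis unfolding extremal_pop .
qed

end

theorem theorem8p3:
  fixes n m :: nat and P Q :: "nat \<Rightarrow> nat"
  assumes "2 \<le> n" and "n \<le> m"
    and "\<forall>r r'. 1 \<le> r \<longrightarrow> r \<le> r' \<longrightarrow> r' \<le> m \<longrightarrow> P r' \<le> P r"
    and "\<forall>r r'. 1 \<le> r \<longrightarrow> r \<le> r' \<longrightarrow> r' \<le> m \<longrightarrow> Q r' \<le> Q r"
    and "\<forall>r. 1 \<le> r \<longrightarrow> r \<le> m \<longrightarrow> Q r \<le> P r"
    and "\<forall>c. card {r. (r, c) \<in> skewD m P Q} \<le> n"
  shows
    "(\<forall>s. miso n (Vmod (pop n s (Lskew n m P Q))) (mop n s (Vmod (Lskew n m P Q))) \<and>
          WGF n (pop n s (Lskew n m P Q)) = WGFop n s (WGF n (Lskew n m P Q)))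
   \<and> ((\<exists>s. solitary n (mop n s (Vmod (Lskew n m P Q)))
              (lsk_verts n (sop n s (skewD m P Q))) (lsk_edges n (sop n s (skewD m P Q))))
       \<longrightarrow> (\<forall>d. solitary n (mop n d (Vmod (Lskew n m P Q)))
              (lsk_verts n (sop n d (skewD m P Q))) (lsk_edges n (sop n d (skewD m P Q)))))
   \<and> ((\<exists>s. edge_minimal n (mop n s (Vmod (Lskew n m P Q)))
              (lsk_verts n (sop n s (skewD m P Q))) (lsk_edges n (sop n s (skewD m P Q))))
       \<longrightarrow> (\<forall>d. edge_minimal n (mop n d (Vmod (Lskew n m P Q)))
              (lsk_verts n (sop n d (skewD m P Q))) (lsk_edges n (sop n d (skewD m P Q)))))
   \<and> ((\<exists>s. young_translate (sop n s (skewD m P Q)))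
       \<longrightarrow> (\<forall>d. irreducible_mod n (mop n d (Vmod (Lskew n m P Q))) \<and>
              solitary n (mop n d (Vmod (Lskew n m P Q)))
                (lsk_verts n (sop n d (skewD m P Q))) (lsk_edges n (sop n d (skewD m P Q))) \<and>
              edge_minimal n (mop n d (Vmod (Lskew n m P Q)))
                (lsk_verts n (sop n d (skewD m P Q))) (lsk_edges n (sop n d (skewD m P Q)))))"
proof -
  interpret skew_shape n m P Q
    by unfold_locales (use assms in blast)+
  \<comment> \<open>Each instance is equivalent to the one for \<open>L\<close>, hence any two are
    equivalent to each other.\<close>
  have tr: "extremal e n (mop n d (Vmod L)) (lsk_verts n (sop n d D)) (lsk_edges n (sop n d D))"
    if "extremal e n (mop n s (Vmod L)) (lsk_verts n (sop n s D)) (lsk_edges n (sop n s D))" for e s d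
    using that unfolding extremal_lsk .
  have n: "1 \<le> n" using assms(1) by simp
  have yg: "irreducible_mod n (mop n d (Vmod L)) \<and>
      extremal e n (mop n d (Vmod L)) (lsk_verts n (sop n d D)) (lsk_edges n (sop n d D))"
    if "young_translate (sop n s D)" for e s d
    using young_irreducible[OF that n] young_extremal[OF that n] unfolding extremal_lsk by blast
  show ?thesis
    using miso_pop WGF_pop tr[of False] tr[of True] yg[of _ _ False] yg[of _ _ True]
    by (simp only: extremal_def if_True if_False) blast
qed

end
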